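(* Let $P$ be a finite $p$-group and let $A$ be a $P$-interior $\mathcal{O}$-algebra. Let $\tilde A:=A\otimes_{\mathcal{O}P}\mathcal{O}[P\rtimes \operatorname{Aut}(P)]\simeq A\otimes_{\mathcal{O}}\mathcal{O}\operatorname{Aut}(P)$, with $P$ acting by $(a\otimes\varphi)^u=u^{-1}\cdot a\cdot\varphi(u)\otimes\varphi$, and let $\tilde A(P)$ be its Brauer quotient with respect to $P$. Then there is an isomorphism $$\tilde A(P)\simeq \bar N_A^{\operatorname{Aut}(P)}(P)$$ of $\operatorname{Aut}(P)$-graded algebras, where $\bar N_A^{\operatorname{Aut}(P)}(P)$ is the extended Brauer quotient of $A$.
   Context: $\mathcal{O}$ is a complete discrete valuation ring with maximal ideal $J(\mathcal{O})$ and residue field $k$ of characteristic $p>0$. A $P$-interior algebra is a (unital, associative) $\mathcal{O}$-algebra $A$ with a unital algebra homomorphism $\mathcal{O}P\to A$; for $u\in P$, $a\in A$ one writes $ua$, $au$ for the products with the image of $u$. Convention: the product in $\operatorname{Aut}(P)$ used for gradings is $\varphi\psi:=\psi\circ\varphi$ (first apply $\varphi$). Extended Brauer quotient. For $\varphi\in\operatorname{Aut}(P)$ and $Q\le P$ put $\Delta_\varphi(Q)=\{(u,\varphi(u))\mid u\in Q\}$ and $A^{\Delta_\varphi(Q)}=\{a\in A\mid ua=a\varphi(u)\ \text{for all } u\in Q\}$. For $Q<P$ let $A^{\Delta_\varphi(P)}_{\Delta_\varphi(Q)}$ be the set of elements $\operatorname{Tr}_{\Delta_\varphi(Q)}^{\Delta_\varphi(P)}(c)=\sum_{u\in[Q\backslash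 P]}u^{-1}c\varphi(u)$ with $c\in A^{\Delta_\varphi(Q)}$, the sum running over representatives $u$ of the cosets $Qu$ of $Q$ in $P$. Put $$A(\Delta_\varphi(P))=A^{\Delta_\varphi(P)}\Big/\Big(\sum_{Q<P}A^{\Delta_\varphi(P)}_{\Delta_\varphi(Q)}+J(\mathcal{O})A^{\Delta_\varphi(P)}\Big).$$ For a subgroup $K\le\operatorname{Aut}(P)$, $\bar N_A^K(P):=\bigoplus_{\varphi\in K}A(\Delta_\varphi(P))$ (external direct sum). It is a $K$-graded $k$-algebra with multiplication induced by that of $A$: if $a\in A^{\Delta_\varphi(P)}$ and $b\in A^{\Delta_\psi(P)}$ then $ab\in A^{\Delta_{\varphi\psi}(P)}$. The algebra $\tilde A(P)$. On the $\mathcal{O}$-module $\tilde A=\bigoplus_{\varphi\in\operatorname{Aut}(P)}A\otimes\varphi$ consider the multiplication $(a\otimes\varphi)(b\otimes\psi)=ab\otimes\varphi\psi$ and the $P$-action above. Let $\tilde A^P$ be the $P$-fixed points (a subalgebra), and for $Q<P$ let $\tilde A^P_Q$ be the image of the relative trace $\operatorname{Tr}_Q^P:\tilde A^Q\to\tilde A^P$, $\operatorname{Tr}_Q^P(c)=\sum_{u\in[Q\backslash P]}c^u$. Then $\tilde A(P)=\tilde A^P/(\sum_{Q<P}\tilde A_Q^P+J(\mathcal{O})\tilde A^P)$, with the multiplication induced from $\tilde A^P$ and the $\operatorname{Aut}(P)$-grading inherited from $\tilde A$. *)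

theory Defs
  imports
    "HOL-Computational_Algebra.Primes"
    "HOL-Algebra.Bij"
    "HOL-Algebra.Generated_Groups"
    "HOL-Algebra.Ideal_Product"
    "HOL-Algebra.Ring_Divisibility"
begin

section \<open>Complete discrete valuation rings\<close>

primrec ideal_pow :: "('a, 'm) ring_scheme \<Rightarrow> 'a set \<Rightarrow> nat \<Rightarrow> 'a set" where
  "ideal_pow R I 0 = carrier R"
| "ideal_pow R I (Suc n) = ideal_prod R I (ideal_pow R I n)"

text \<open>A discrete valuation ring is a principal ideal domain that is not a field and has exactly
  one maximal ideal \<open>J\<close>. Completeness says that the canonical map from \<open>R\<close> to the
  inverse limit of the rings \<open>R / J^n\<close> is injective and surjective.\<close>

locale complete_dvr = principal_domain R for R (structure) +
  fixes J
  assumes not_field: "\<not> field R"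
    and maximal_J: "maximalideal J R"
    and unique_J: "\<And>I. maximalideal I R \<Longrightarrow> I = J"
    and separated: "(\<Inter>n. ideal_pow R J n) = {\<zero>}"
    and complete: "\<And>x. \<lbrakk> \<And>n. x n \<in> carrier R; \<And>n. x (Suc n) \<ominus> x n \<in> ideal_pow R J n \<rbrakk>
                     \<Longrightarrow> \<exists>y \<in> carrier R. \<forall>n. y \<ominus> x n \<in> ideal_pow R J n"

definition has_characteristic :: "('a, 'm) ring_scheme \<Rightarrow> nat \<Rightarrow> bool" where
  "has_characteristic R p \<longleftrightarrow> (\<forall>n::nat. add_pow R n \<one>\<^bsub>R\<^esub> = \<zero>\<^bsub>R\<^esub> \<longleftrightarrow> p dvd n)"

definition p_group :: "nat \<Rightarrow> ('g, 'm) monoid_scheme \<Rightarrow> bool" where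
  "p_group p P \<longleftrightarrow> group P \<and> finite (carrier P) \<and> Factorial_Ring.prime p \<and> (\<exists>n. order P = p ^ n)"


section \<open>Associative algebras and gradings\<close>

text \<open>The library locale \<open>algebra\<close> is restricted to commutative algebras.\<close>

locale assoc_algebra = module R A + ring A for R (structure) and A (structure) +
  assumes smult_mult_left: "\<lbrakk> r \<in> carrier R; x \<in> carrier A; y \<in> carrier A \<rbrakk>
            \<Longrightarrow> (r \<odot>\<^bsub>A\<^esub> x) \<otimes>\<^bsub>A\<^esub> y = r \<odot>\<^bsub>A\<^esub> (x \<otimes>\<^bsub>A\<^esub> y)"
    and smult_mult_right: "\<lbrakk> r \<in> carrier R; x \<in> carrier A; y \<in> carrier A \<rbrakk>
            \<Longrightarrow> x \<otimes>\<^bsub>A\<^esub> (r \<odot>\<^bsub>A\<^esub> y) = r \<odot>\<^bsub>A\<^esub> (x \<otimes>\<^bsub>A\<^esub> y)"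

definition alg_hom ::
  "('r, 'm) ring_scheme \<Rightarrow> ('r, 'a, 'n) module_scheme \<Rightarrow> ('r, 'b, 'l) module_scheme \<Rightarrow> ('a \<Rightarrow> 'b) set"
where
  "alg_hom R A B = {h \<in> ring_hom A B.
     \<forall>r \<in> carrier R. \<forall>x \<in> carrier A. h (r \<odot>\<^bsub>A\<^esub> x) = r \<odot>\<^bsub>B\<^esub> h x}"

locale graded_algebra = assoc_algebra R B + group G
    for R (structure) and G (structure) and B (structure) +
  fixes comp
  assumes comp_submodule: "\<And>g. g \<in> carrier G \<Longrightarrow> submodule (comp g) R B"
    and comp_direct: "\<And>x. x \<in> carrier B \<Longrightarrow>
          \<exists>!f. f \<in> Pi\<^sub>E (carrier G) comp \<and> finite {g \<in> carrier G. f g \<noteq> \<zero>\<^bsub>B\<^esub>} \<and>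
               x = (\<Oplus>\<^bsub>B\<^esub>g\<in>{g \<in> carrier G. f g \<noteq> \<zero>\<^bsub>B\<^esub>}. f g)"
    and comp_mult: "\<And>g h x y. \<lbrakk> g \<in> carrier G; h \<in> carrier G; x \<in> comp g; y \<in> comp h \<rbrakk>
          \<Longrightarrow> x \<otimes>\<^bsub>B\<^esub> y \<in> comp (g \<otimes>\<^bsub>G\<^esub> h)"

definition graded_alg_iso ::
  "('r, 'm) ring_scheme \<Rightarrow> ('g, 'n) monoid_scheme \<Rightarrow>
   ('r, 'a, 'k) module_scheme \<Rightarrow> ('g \<Rightarrow> 'a set) \<Rightarrow>
   ('r, 'b, 'l) module_scheme \<Rightarrow> ('g \<Rightarrow> 'b set) \<Rightarrow> ('a \<Rightarrow> 'b) set"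
where
  "graded_alg_iso R G B compB C compC =
     {h \<in> alg_hom R B C. bij_betw h (carrier B) (carrier C) \<and>
        (\<forall>g \<in> carrier G. h ` compB g = compC g)}"


section \<open>Group algebras and interior algebras\<close>

text \<open>These constructions are only used for finite groups, so that no condition of
  finite support is needed.\<close>

definition convolution ::
  "('a, 'm) ring_scheme \<Rightarrow> ('g, 'n) monoid_scheme \<Rightarrow> ('g \<Rightarrow> 'a) \<Rightarrow> ('g \<Rightarrow> 'a) \<Rightarrow> 'g \<Rightarrow> 'a"
where
  "convolution A G f f' = (\<lambda>x \<in> carrier G.
     \<Oplus>\<^bsub>A\<^esub>w\<in>{(y, z) \<in> carrier G \<times> carrier G. y \<otimes>\<^bsub>G\<^esub> z = x}.
       f (fst w) \<otimes>\<^bsub>A\<^esub> f' (snd w))"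

definition group_algebra ::
  "('r, 'm) ring_scheme \<Rightarrow> ('g, 'n) monoid_scheme \<Rightarrow> ('r, 'g \<Rightarrow> 'r) module"
where
  "group_algebra R G =
     \<lparr> carrier = carrier G \<rightarrow>\<^sub>E carrier R,
       monoid.mult = convolution R G,
       one = (\<lambda>x \<in> carrier G. if x = \<one>\<^bsub>G\<^esub> then \<one>\<^bsub>R\<^esub> else \<zero>\<^bsub>R\<^esub>),
       ring.zero = (\<lambda>x \<in> carrier G. \<zero>\<^bsub>R\<^esub>),
       add = (\<lambda>f f'. \<lambda>x \<in> carrier G. f x \<oplus>\<^bsub>R\<^esub> f' x),
       smult = (\<lambda>r f. \<lambda>x \<in> carrier G. r \<otimes>\<^bsub>R\<^esub> f x) \<rparr>"

definition group_elem :: "('r, 'm) ring_scheme \<Rightarrow> ('g, 'n) monoid_scheme \<Rightarrow> 'g \<Rightarrow> 'g \<Rightarrow> 'r" where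
  "group_elem R G u = (\<lambda>x \<in> carrier G. if x = u then \<one>\<^bsub>R\<^esub> else \<zero>\<^bsub>R\<^esub>)"

locale interior_algebra = assoc_algebra R A + group P
    for R (structure) and P (structure) and A (structure) +
  fixes \<sigma>
  assumes structure_map: "\<sigma> \<in> alg_hom R (group_algebra R P) A"

text \<open>The products \<open>ua\<close> and \<open>au\<close> for \<open>u \<in> P\<close> and \<open>a \<in> A\<close>.\<close>

definition lact where
  "lact R P A \<sigma> u a = \<sigma> (group_elem R P u) \<otimes>\<^bsub>A\<^esub> a"

definition ract where
  "ract R P A \<sigma> a u = a \<otimes>\<^bsub>A\<^esub> \<sigma> (group_elem R P u)"


section \<open>The grading group and coset representatives\<close>

text \<open>The automorphism group with the product \<open>\<phi>\<psi> := \<psi> \<circ> \<phi>\<close>;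
  the product of the library group \<open>AutoGroup P\<close> is ordinary composition.\<close>

definition Aut :: "('g, 'n) monoid_scheme \<Rightarrow> ('g \<Rightarrow> 'g) monoid" where
  "Aut P = (AutoGroup P) \<lparr> monoid.mult := \<lambda>\<phi> \<psi>. \<psi> \<otimes>\<^bsub>AutoGroup P\<^esub> \<phi> \<rparr>"

definition proper_subgroups :: "('g, 'n) monoid_scheme \<Rightarrow> 'g set set" where
  "proper_subgroups P = {Q. subgroup Q P \<and> Q \<subset> carrier P}"

text \<open>The library's \<open>rcosets\<close> are the sets \<open>Qu\<close>, as required.\<close>

definition coset_rep :: "'g set \<Rightarrow> 'g" where
  "coset_rep X = (SOME u. u \<in> X)"


section \<open>Quotient modules over the residue field\<close>

text \<open>The set of finite sums of products of elements of \<open>J\<close> and \<open>N\<close>.\<close>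

definition ideal_smult :: "'r set \<Rightarrow> ('r, 'a, 'm) module_scheme \<Rightarrow> 'a set \<Rightarrow> 'a set" where
  "ideal_smult J M N = generate (add_monoid M) {r \<odot>\<^bsub>M\<^esub> x | r x. r \<in> J \<and> x \<in> N}"

text \<open>The sum of a (possibly empty) family of additive subgroups.\<close>

definition sum_subgroups :: "('a, 'm) ring_scheme \<Rightarrow> 'a set set \<Rightarrow> 'a set" where
  "sum_subgroups M \<N> = generate (add_monoid M) (\<Union>\<N>)"

text \<open>The quotient \<open>M / N\<close> with the induced action of \<open>R Quot J\<close>, for \<open>JM \<subseteq> N\<close>.
  The multiplication and the unit are meaningful only if \<open>N\<close> is an ideal of an algebra \<open>M\<close>.\<close>

definition quotient_module ::
  "('r, 'a, 'm) module_scheme \<Rightarrow> 'a set \<Rightarrow> ('r set, 'a set) module"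
where
  "quotient_module M N =
     \<lparr> carrier = a_rcosets\<^bsub>M\<^esub> N,
       monoid.mult = rcoset_mult M N,
       one = N +>\<^bsub>M\<^esub> \<one>\<^bsub>M\<^esub>,
       ring.zero = N,
       add = set_add M,
       smult = (\<lambda>c X. \<Union>r\<in>c. \<Union>x\<in>X. N +>\<^bsub>M\<^esub> (r \<odot>\<^bsub>M\<^esub> x)) \<rparr>"


section \<open>The extended Brauer quotient\<close>

definition Delta :: "('g \<Rightarrow> 'g) \<Rightarrow> 'g set \<Rightarrow> ('g \<times> 'g) set" where
  "Delta \<phi> Q = {(u, \<phi> u) | u. u \<in> Q}"

definition twisted_fixed where
  "twisted_fixed R P A \<sigma> \<phi> Q =
     {a \<in> carrier A. \<forall>(u, v) \<in> Delta \<phi> Q. lact R P A \<sigma> u a = ract R P A \<sigma> a v}"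

definition twisted_trace where
  "twisted_trace R P A \<sigma> \<phi> Q c =
     (\<Oplus>\<^bsub>A\<^esub>X\<in>rcosets\<^bsub>P\<^esub> Q.
        ract R P A \<sigma> (lact R P A \<sigma> (inv\<^bsub>P\<^esub> (coset_rep X)) c) (\<phi> (coset_rep X)))"

definition twisted_kernel where
  "twisted_kernel R J P A \<sigma> \<phi> =
     sum_subgroups A
       {twisted_trace R P A \<sigma> \<phi> Q ` twisted_fixed R P A \<sigma> \<phi> Q | Q. Q \<in> proper_subgroups P}
     <+>\<^bsub>A\<^esub> ideal_smult J A (twisted_fixed R P A \<sigma> \<phi> (carrier P))"

text \<open>This is \<open>A(\<Delta>\<^sub>\<phi>(P))\<close>. Only its module structure is used: \<open>twisted_fixed\<close> is in
  general not closed under multiplication.\<close>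

definition twisted_brauer where
  "twisted_brauer R J P A \<sigma> \<phi> =
     quotient_module (A\<lparr>carrier := twisted_fixed R P A \<sigma> \<phi> (carrier P)\<rparr>)
       (twisted_kernel R J P A \<sigma> \<phi>)"

text \<open>The external direct sum of the \<open>A(\<Delta>\<^sub>\<phi>(P))\<close> over \<open>\<phi> \<in> K\<close>; \<open>K\<close> is finite since \<open>P\<close> is.
  Homogeneous elements are multiplied by multiplying representatives in \<open>A\<close>.\<close>

definition extended_brauer_quotient where
  "extended_brauer_quotient R J P A \<sigma> K =
     (let D = twisted_brauer R J P A \<sigma>; N = twisted_kernel R J P A \<sigma> in
     \<lparr> carrier = (\<Pi>\<^sub>E \<phi>\<in>K. carrier (D \<phi>)),
       monoid.mult = (\<lambda>f f'. \<lambda>\<chi>\<in>K.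
         \<Oplus>\<^bsub>D \<chi>\<^esub>w\<in>{(\<phi>, \<psi>) \<in> K \<times> K. \<phi> \<otimes>\<^bsub>Aut P\<^esub> \<psi> = \<chi>}.
           rcoset_mult A (N \<chi>) (f (fst w)) (f' (snd w))),
       one = (\<lambda>\<phi>\<in>K. if \<phi> = \<one>\<^bsub>Aut P\<^esub> then N \<phi> +>\<^bsub>A\<^esub> \<one>\<^bsub>A\<^esub> else \<zero>\<^bsub>D \<phi>\<^esub>),
       ring.zero = (\<lambda>\<phi>\<in>K. \<zero>\<^bsub>D \<phi>\<^esub>),
       add = (\<lambda>f f'. \<lambda>\<phi>\<in>K. f \<phi> \<oplus>\<^bsub>D \<phi>\<^esub> f' \<phi>),
       smult = (\<lambda>c f. \<lambda>\<phi>\<in>K. c \<odot>\<^bsub>D \<phi>\<^esub> f \<phi>) \<rparr>)"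

definition extended_brauer_comp where
  "extended_brauer_comp R J P A \<sigma> K \<phi> =
     {f \<in> carrier (extended_brauer_quotient R J P A \<sigma> K).
        \<forall>\<psi>\<in>K. \<psi> \<noteq> \<phi> \<longrightarrow> f \<psi> = \<zero>\<^bsub>twisted_brauer R J P A \<sigma> \<psi>\<^esub>}"


section \<open>Brauer quotients of algebras with an action\<close>

text \<open>In this section \<open>act u x\<close> is the right action \<open>x^u\<close>.\<close>

definition fixed_points where
  "fixed_points M act Q = {x \<in> carrier M. \<forall>u\<in>Q. act u x = x}"

definition rel_trace where
  "rel_trace P M act Q c = (\<Oplus>\<^bsub>M\<^esub>X\<in>rcosets\<^bsub>P\<^esub> Q. act (coset_rep X) c)"

definition brauer_kernel where
  "brauer_kernel J P M act =
     sum_subgroups M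
       {rel_trace P M act Q ` fixed_points M act Q | Q. Q \<in> proper_subgroups P}
     <+>\<^bsub>M\<^esub> ideal_smult J M (fixed_points M act (carrier P))"

definition brauer_quotient where
  "brauer_quotient J P M act =
     quotient_module (M\<lparr>carrier := fixed_points M act (carrier P)\<rparr>) (brauer_kernel J P M act)"

text \<open>The component of the Brauer quotient inherited from the component \<open>S\<close> of \<open>M\<close>.\<close>

definition brauer_comp where
  "brauer_comp J P M act S =
     {brauer_kernel J P M act +>\<^bsub>M\<^esub> x | x. x \<in> fixed_points M act (carrier P) \<inter> S}"


section \<open>The algebra A tilde\<close>

text \<open>The tensor product of \<open>A\<close> over the group algebra of \<open>P\<close> with the group algebra of the
  holomorph of \<open>P\<close> is the direct sum of the copies \<open>A \<otimes> \<phi>\<close> of \<open>A\<close>, one for each automorphism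
  \<open>\<phi>\<close>. The function \<open>f\<close> stands for the sum of the \<open>f \<phi> \<otimes> \<phi>\<close>, and the multiplication is \<open>(a \<otimes> \<phi>)(b \<otimes> \<psi>) = ab \<otimes> \<phi>\<psi>\<close>.\<close>

definition tilde_algebra ::
  "('g, 'n) monoid_scheme \<Rightarrow> ('r, 'a, 'm) module_scheme \<Rightarrow> ('r, ('g \<Rightarrow> 'g) \<Rightarrow> 'a) module"
where
  "tilde_algebra P A =
     \<lparr> carrier = carrier (Aut P) \<rightarrow>\<^sub>E carrier A,
       monoid.mult = convolution A (Aut P),
       one = (\<lambda>\<phi> \<in> carrier (Aut P). if \<phi> = \<one>\<^bsub>Aut P\<^esub> then \<one>\<^bsub>A\<^esub> else \<zero>\<^bsub>A\<^esub>),
       ring.zero = (\<lambda>\<phi> \<in> carrier (Aut P). \<zero>\<^bsub>A\<^esub>),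
       add = (\<lambda>f f'. \<lambda>\<phi> \<in> carrier (Aut P). f \<phi> \<oplus>\<^bsub>A\<^esub> f' \<phi>),
       smult = (\<lambda>r f. \<lambda>\<phi> \<in> carrier (Aut P). r \<odot>\<^bsub>A\<^esub> f \<phi>) \<rparr>"

definition tilde_comp ::
  "('g, 'n) monoid_scheme \<Rightarrow> ('r, 'a, 'm) module_scheme \<Rightarrow> ('g \<Rightarrow> 'g) \<Rightarrow> (('g \<Rightarrow> 'g) \<Rightarrow> 'a) set"
where
  "tilde_comp P A \<phi> =
     {f \<in> carrier (tilde_algebra P A). \<forall>\<psi> \<in> carrier (Aut P). \<psi> \<noteq> \<phi> \<longrightarrow> f \<psi> = \<zero>\<^bsub>A\<^esub>}"

definition tilde_act where
  "tilde_act R P A \<sigma> u f =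
     (\<lambda>\<phi> \<in> carrier (Aut P). ract R P A \<sigma> (lact R P A \<sigma> (inv\<^bsub>P\<^esub> u) (f \<phi>)) (\<phi> u))"

definition tilde_brauer where
  "tilde_brauer R J P A \<sigma> = brauer_quotient J P (tilde_algebra P A) (tilde_act R P A \<sigma>)"

definition tilde_brauer_comp where
  "tilde_brauer_comp R J P A \<sigma> \<phi> =
     brauer_comp J P (tilde_algebra P A) (tilde_act R P A \<sigma>) (tilde_comp P A \<phi>)"

end

theory Submission
  imports Defs
begin

text \<open>Since \<open>P\<close> acts on \<open>A \<otimes> \<phi>\<close> by \<open>a \<mapsto> u\<^sup>-\<^sup>1 a \<phi>(u)\<close>, everything that enters the Brauer quotient of
  the algebra \<open>A \<otimes> Aut(P)\<close> decomposes along the automorphisms: the \<open>Q\<close>-fixed points are the families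
  \<open>f\<close> with \<open>f \<phi>\<close> in the \<open>\<Delta>\<^sub>\<phi>(Q)\<close>-fixed points of \<open>A\<close>, the relative traces are computed componentwise,
  and hence the Brauer kernel consists of the families with \<open>f \<phi>\<close> in the twisted kernel at \<open>\<phi>\<close>.
  The isomorphism sends the class of \<open>f\<close> to the family of the classes of the \<open>f \<phi>\<close>. It remains to see
  that the twisted kernels form a graded ideal of the twisted fixed points. The point is that
  \<open>a Tr(c) = Tr(a c)\<close> for \<open>a\<close> fixed by \<open>\<Delta>\<^sub>\<phi>(P)\<close> and \<open>c\<close> fixed by \<open>\<Delta>\<^sub>\<psi>(Q)\<close>, where the trace on the
  right starts from the preimage of \<open>Q\<close> under \<open>\<phi>\<close>, again a proper subgroup.\<close>

section \<open>Convolution algebras of finite groups\<close>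

text \<open>The description of the Brauer kernel needs an argument: a trace in the tilde algebra
  uses one subgroup \<open>Q\<close> for all automorphisms at once, whereas a family in the product
  of the twisted kernels may use different subgroups, and different numbers of summands, in its
  components. Both kernels are therefore rewritten as subgroups generated by traces and multiples by
  \<open>J\<close>, and a family is split into the finitely many families concentrated at one
  automorphism, each of which is generated separately. The extended Brauer quotient is a bare record
  whose product is a sum of products of cosets of different subgroups. Its algebra laws are
  inherited from the quotient of the fixed-point algebra along the comparison map; the direct sum
  decomposition is visible in the external direct sum and is pulled back in the other direction. To
  separate this formal part from the action of \<open>P\<close>, it is carried out for an arbitrary
  finite group and for families of submodules \<open>F\<close> and \<open>N\<close>.\<close>

lemma (in abelian_monoid) finsum_single:
  assumes "finite S" "i \<in> S" "f i \<in> carrier G" "\<And>j. \<lbrakk>j \<in> S; j \<noteq> i\<rbrakk> \<Longrightarrow> f j = \<zero>"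
  shows "finsum G f S = f i"
proof -
  have "finsum G f S = (\<Oplus>j\<in>S. if i = j then f j else \<zero>)"
    using assms by (intro finsum_cong') (auto simp: Pi_def)
  also have "\<dots> = (\<Oplus>j\<in>S. if i = j then f i else \<zero>)"
    using assms by (intro finsum_cong') (auto simp: Pi_def)
  also have "\<dots> = f i"
    using finsum_singleton[of i S "\<lambda>_. f i"] assms by simp
  finally show ?thesis .
qed

text \<open>The two bracketings of a triple convolution product lead to one double sum in the two
  orders of summation.\<close>

lemma (in abelian_monoid) finsum_swap:
  assumes "finite S" "finite T" "\<And>s t. \<lbrakk>s \<in> S; t \<in> T\<rbrakk> \<Longrightarrow> f s t \<in> carrier G"
  shows "(\<Oplus>s\<in>S. \<Oplus>t\<in>T. f s t) = (\<Oplus>t\<in>T. \<Oplus>s\<in>S. f s t)"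
  using assms(1,3)
proof (induction S rule: finite_induct)
  case (insert s S)
  have "(\<Oplus>t\<in>T. \<Oplus>s\<in>insert s S. f s t) = (\<Oplus>t\<in>T. f s t \<oplus> (\<Oplus>s\<in>S. f s t))"
    using insert.hyps insert.prems
    by (intro finsum_cong') (auto simp: Pi_def intro!: finsum_closed)
  also have "\<dots> = (\<Oplus>t\<in>T. f s t) \<oplus> (\<Oplus>t\<in>T. \<Oplus>s\<in>S. f s t)"
    using insert.prems by (intro finsum_addf) (auto simp: Pi_def intro!: finsum_closed)
  finally show ?case
    using insert by (simp add: Pi_def)
qed simp

lemma assoc_algebraI:
  assumes "module R A" "ring A"
    and "\<And>r x y. \<lbrakk> r \<in> carrier R; x \<in> carrier A; y \<in> carrier A \<rbrakk>
            \<Longrightarrow> (r \<odot>\<^bsub>A\<^esub> x) \<otimes>\<^bsub>A\<^esub> y = r \<odot>\<^bsub>A\<^esub> (x \<otimes>\<^bsub>A\<^esub> y)"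
    and "\<And>r x y. \<lbrakk> r \<in> carrier R; x \<in> carrier A; y \<in> carrier A \<rbrakk>
            \<Longrightarrow> x \<otimes>\<^bsub>A\<^esub> (r \<odot>\<^bsub>A\<^esub> y) = r \<odot>\<^bsub>A\<^esub> (x \<otimes>\<^bsub>A\<^esub> y)"
  shows "assoc_algebra R A"
  using assms by (simp add: assoc_algebra_def assoc_algebra_axioms_def)

text \<open>The group is arbitrary so that the algebra laws can be proved without unfolding the
  composition of automorphisms.\<close>

definition conv_algebra ::
  "('r, 'a, 'm) module_scheme \<Rightarrow> ('g, 'n) monoid_scheme \<Rightarrow> ('r, 'g \<Rightarrow> 'a) module"
where
  "conv_algebra A G =
     \<lparr> carrier = carrier G \<rightarrow>\<^sub>E carrier A,
       monoid.mult = convolution A G,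
       one = (\<lambda>g \<in> carrier G. if g = \<one>\<^bsub>G\<^esub> then \<one>\<^bsub>A\<^esub> else \<zero>\<^bsub>A\<^esub>),
       ring.zero = (\<lambda>g \<in> carrier G. \<zero>\<^bsub>A\<^esub>),
       add = (\<lambda>f f'. \<lambda>g \<in> carrier G. f g \<oplus>\<^bsub>A\<^esub> f' g),
       smult = (\<lambda>r f. \<lambda>g \<in> carrier G. r \<odot>\<^bsub>A\<^esub> f g) \<rparr>"

lemma conv_algebra_simps:
  "carrier (conv_algebra A G) = carrier G \<rightarrow>\<^sub>E carrier A"
  "f \<otimes>\<^bsub>conv_algebra A G\<^esub> f' = convolution A G f f'"
  "\<one>\<^bsub>conv_algebra A G\<^esub> = (\<lambda>g \<in> carrier G. if g = \<one>\<^bsub>G\<^esub> then \<one>\<^bsub>A\<^esub> else \<zero>\<^bsub>A\<^esub>)"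
  "\<zero>\<^bsub>conv_algebra A G\<^esub> = (\<lambda>g \<in> carrier G. \<zero>\<^bsub>A\<^esub>)"
  "f \<oplus>\<^bsub>conv_algebra A G\<^esub> f' = (\<lambda>g \<in> carrier G. f g \<oplus>\<^bsub>A\<^esub> f' g)"
  "r \<odot>\<^bsub>conv_algebra A G\<^esub> f = (\<lambda>g \<in> carrier G. r \<odot>\<^bsub>A\<^esub> f g)"
  by (simp_all add: conv_algebra_def)

lemma tilde_algebra_eq_conv_algebra: "tilde_algebra P A = conv_algebra A (Aut P)"
  by (simp add: tilde_algebra_def conv_algebra_def)

text \<open>The pairs with product \<open>x\<close> are parametrized by their first entry, as the
  second is forced to be \<open>y^-1 x\<close>. A sum over the whole group is easier to reindex and
  to interchange than a sum over pairs.\<close>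

lemma convolution_eq_finsum:
  assumes "group G" "ring A" and f: "f \<in> carrier G \<rightarrow> carrier A" "f' \<in> carrier G \<rightarrow> carrier A"
    and x: "x \<in> carrier G"
  shows "convolution A G f f' x = (\<Oplus>\<^bsub>A\<^esub>y\<in>carrier G. f y \<otimes>\<^bsub>A\<^esub> f' (inv\<^bsub>G\<^esub> y \<otimes>\<^bsub>G\<^esub> x))"
proof -
  interpret G: group G by fact
  interpret A: ring A by fact
  let ?h = "\<lambda>y. (y, inv\<^bsub>G\<^esub> y \<otimes>\<^bsub>G\<^esub> x)"
  have image: "{(y, z) \<in> carrier G \<times> carrier G. y \<otimes>\<^bsub>G\<^esub> z = x} = ?h ` carrier G"
    using x by (auto simp: image_iff G.m_assoc[symmetric])
  have "convolution A G f f' x = (\<Oplus>\<^bsub>A\<^esub>w\<in>?h ` carrier G. f (fst w) \<otimes>\<^bsub>A\<^esub> f' (snd w))"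
    unfolding image[symmetric] using x by (simp add: convolution_def)
  also have "\<dots> = (\<Oplus>\<^bsub>A\<^esub>y\<in>carrier G. f (fst (?h y)) \<otimes>\<^bsub>A\<^esub> f' (snd (?h y)))"
    using f x by (intro A.finsum_reindex) (auto simp: inj_on_def Pi_def)
  finally show ?thesis by simp
qed

lemma PiE_mem_iff: "f \<in> (\<Pi>\<^sub>E g\<in>S. F g) \<longleftrightarrow> f \<in> extensional S \<and> (\<forall>g\<in>S. f g \<in> F g)"
  by (auto simp: PiE_iff)

section \<open>Algebra laws for the \<open>A\<close>-valued functions on a finite group\<close>

locale group_convolution = assoc_algebra R A + G: group G
    for R (structure) and A (structure) and G (structure) +
  assumes finite_group: "finite (carrier G)"
begin

abbreviation "C \<equiv> conv_algebra A G"

lemma conv_carrier: "f \<in> carrier C \<longleftrightarrow> f \<in> extensional (carrier G) \<and> (\<forall>g\<in>carrier G. f g \<in> carrier A)"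
  by (simp add: conv_algebra_simps PiE_mem_iff)

lemma conv_closed: "f \<in> carrier C \<Longrightarrow> g \<in> carrier G \<Longrightarrow> f g \<in> carrier A"
  by (simp add: conv_carrier)

lemma conv_eqI:
  assumes "f \<in> carrier C" "f' \<in> carrier C" "\<And>g. g \<in> carrier G \<Longrightarrow> f g = f' g"
  shows "f = f'"
  using assms by (auto simp: conv_carrier intro: extensionalityI)

lemma conv_mult:
  assumes "f \<in> carrier C" "f' \<in> carrier C" "g \<in> carrier G"
  shows "(f \<otimes>\<^bsub>C\<^esub> f') g = (\<Oplus>\<^bsub>A\<^esub>y\<in>carrier G. f y \<otimes>\<^bsub>A\<^esub> f' (inv\<^bsub>G\<^esub> y \<otimes>\<^bsub>G\<^esub> g))"
  unfolding conv_algebra_simps(2)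
  by (rule convolution_eq_finsum) (use assms in \<open>auto simp: conv_carrier Pi_def intro: G.group_axioms ring_axioms\<close>)

lemma conv_mult_closed:
  assumes f: "f \<in> carrier C" and f': "f' \<in> carrier C"
  shows "f \<otimes>\<^bsub>C\<^esub> f' \<in> carrier C"
  unfolding conv_carrier
proof (intro conjI ballI)
  show "f \<otimes>\<^bsub>C\<^esub> f' \<in> extensional (carrier G)"
    by (simp add: conv_algebra_simps convolution_def)
  show "(f \<otimes>\<^bsub>C\<^esub> f') g \<in> carrier A" if "g \<in> carrier G" for g
    unfolding conv_mult[OF f f' that] using that conv_closed[OF f] conv_closed[OF f']
    by (intro finsum_closed) auto
qed

lemma conv_one_closed: "\<one>\<^bsub>C\<^esub> \<in> carrier C"
  by (auto simp: conv_carrier conv_algebra_simps(3-6))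

lemma conv_add_closed: "f \<in> carrier C \<Longrightarrow> f' \<in> carrier C \<Longrightarrow> f \<oplus>\<^bsub>C\<^esub> f' \<in> carrier C"
  by (auto simp: conv_carrier conv_algebra_simps(3-6))

lemma conv_smult_closed: "r \<in> carrier R \<Longrightarrow> f \<in> carrier C \<Longrightarrow> r \<odot>\<^bsub>C\<^esub> f \<in> carrier C"
  by (auto simp: conv_carrier conv_algebra_simps(3-6))

lemma conv_add: "g \<in> carrier G \<Longrightarrow> (f \<oplus>\<^bsub>C\<^esub> f') g = f g \<oplus>\<^bsub>A\<^esub> f' g"
  by (simp add: conv_algebra_simps)

lemma conv_smult: "g \<in> carrier G \<Longrightarrow> (r \<odot>\<^bsub>C\<^esub> f) g = r \<odot>\<^bsub>A\<^esub> f g"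
  by (simp add: conv_algebra_simps)

lemma conv_abelian_group: "abelian_group C"
proof (rule abelian_groupI)
  fix f assume f: "f \<in> carrier C"
  show "\<exists>f'\<in>carrier C. f' \<oplus>\<^bsub>C\<^esub> f = \<zero>\<^bsub>C\<^esub>"
    using f by (intro bexI[of _ "\<lambda>g\<in>carrier G. \<ominus>\<^bsub>A\<^esub> f g"])
      (auto simp: conv_carrier conv_algebra_simps(3-6) l_neg)
  show "\<zero>\<^bsub>C\<^esub> \<oplus>\<^bsub>C\<^esub> f = f"
    using f by (auto simp: conv_carrier conv_algebra_simps(3-6) fun_eq_iff extensional_def)
qed (auto simp: conv_carrier conv_algebra_simps(3-6) a_ac intro!: restrict_ext)

lemma conv_module: "module R C"
proof (rule moduleI[OF _ conv_abelian_group])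
  show "\<one>\<^bsub>R\<^esub> \<odot>\<^bsub>C\<^esub> f = f" if "f \<in> carrier C" for f
    using that by (auto simp: conv_carrier conv_algebra_simps(3-6) fun_eq_iff extensional_def)
qed (auto simp: conv_carrier conv_algebra_simps(3-6) smult_l_distr smult_r_distr smult_assoc1
      intro!: restrict_ext intro: R.cring_axioms)

lemma conv_l_one:
  assumes f: "f \<in> carrier C"
  shows "\<one>\<^bsub>C\<^esub> \<otimes>\<^bsub>C\<^esub> f = f"
proof (rule conv_eqI)
  fix g assume g: "g \<in> carrier G"
  note fg = conv_closed[OF f]
  have "(\<one>\<^bsub>C\<^esub> \<otimes>\<^bsub>C\<^esub> f) g = (\<Oplus>\<^bsub>A\<^esub>y\<in>carrier G. \<one>\<^bsub>C\<^esub> y \<otimes>\<^bsub>A\<^esub> f (inv\<^bsub>G\<^esub> y \<otimes>\<^bsub>G\<^esub> g))"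
    by (rule conv_mult[OF conv_one_closed f g])
  also have "\<dots> = \<one>\<^bsub>C\<^esub> \<one>\<^bsub>G\<^esub> \<otimes>\<^bsub>A\<^esub> f (inv\<^bsub>G\<^esub> \<one>\<^bsub>G\<^esub> \<otimes>\<^bsub>G\<^esub> g)"
    using finite_group g fg by (intro finsum_single) (auto simp: conv_algebra_simps(3))
  finally show "(\<one>\<^bsub>C\<^esub> \<otimes>\<^bsub>C\<^esub> f) g = f g" using g fg by (simp add: conv_algebra_simps(3))
qed (intro conv_mult_closed conv_one_closed f)+

lemma conv_r_one:
  assumes f: "f \<in> carrier C"
  shows "f \<otimes>\<^bsub>C\<^esub> \<one>\<^bsub>C\<^esub> = f"
proof (rule conv_eqI)
  fix g assume g: "g \<in> carrier G"
  note fg = conv_closed[OF f]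
  have "(f \<otimes>\<^bsub>C\<^esub> \<one>\<^bsub>C\<^esub>) g = (\<Oplus>\<^bsub>A\<^esub>y\<in>carrier G. f y \<otimes>\<^bsub>A\<^esub> \<one>\<^bsub>C\<^esub> (inv\<^bsub>G\<^esub> y \<otimes>\<^bsub>G\<^esub> g))"
    by (rule conv_mult[OF f conv_one_closed g])
  also have "\<dots> = f g \<otimes>\<^bsub>A\<^esub> \<one>\<^bsub>C\<^esub> (inv\<^bsub>G\<^esub> g \<otimes>\<^bsub>G\<^esub> g)"
  proof (intro finsum_single)
    fix y assume y: "y \<in> carrier G" "y \<noteq> g"
    then have "inv\<^bsub>G\<^esub> y \<otimes>\<^bsub>G\<^esub> g \<noteq> \<one>\<^bsub>G\<^esub>"
      using g G.inv_solve_left' G.r_one by fastforce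
    then show "f y \<otimes>\<^bsub>A\<^esub> \<one>\<^bsub>C\<^esub> (inv\<^bsub>G\<^esub> y \<otimes>\<^bsub>G\<^esub> g) = \<zero>\<^bsub>A\<^esub>"
      using y g fg by (simp add: conv_algebra_simps(3))
  qed (use finite_group g fg in \<open>auto simp: conv_algebra_simps(3)\<close>)
  finally show "(f \<otimes>\<^bsub>C\<^esub> \<one>\<^bsub>C\<^esub>) g = f g" using g fg by (simp add: conv_algebra_simps(3))
qed (intro conv_mult_closed conv_one_closed f)+

text \<open>Both sides are brought to the sum over all \<open>s\<close> and \<open>y\<close> of the
  products of \<open>f s\<close>, \<open>f1 (s^-1 y)\<close> and \<open>f2 (y^-1 x)\<close>.\<close>

lemma conv_assoc:
  assumes f: "f \<in> carrier C" and f1: "f1 \<in> carrier C" and f2: "f2 \<in> carrier C"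
  shows "f \<otimes>\<^bsub>C\<^esub> f1 \<otimes>\<^bsub>C\<^esub> f2 = f \<otimes>\<^bsub>C\<^esub> (f1 \<otimes>\<^bsub>C\<^esub> f2)"
proof (rule conv_eqI)
  fix x assume x: "x \<in> carrier G"
  note cl = conv_closed[OF f] conv_closed[OF f1] conv_closed[OF f2]
  let ?s = "\<lambda>s y. f s \<otimes>\<^bsub>A\<^esub> (f1 (inv\<^bsub>G\<^esub> s \<otimes>\<^bsub>G\<^esub> y) \<otimes>\<^bsub>A\<^esub> f2 (inv\<^bsub>G\<^esub> y \<otimes>\<^bsub>G\<^esub> x))"
  have left: "(f \<otimes>\<^bsub>C\<^esub> f1) y \<otimes>\<^bsub>A\<^esub> f2 (inv\<^bsub>G\<^esub> y \<otimes>\<^bsub>G\<^esub> x) = (\<Oplus>\<^bsub>A\<^esub>s\<in>carrier G. ?s s y)"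
    if y: "y \<in> carrier G" for y
  proof -
    have "(f \<otimes>\<^bsub>C\<^esub> f1) y \<otimes>\<^bsub>A\<^esub> f2 (inv\<^bsub>G\<^esub> y \<otimes>\<^bsub>G\<^esub> x)
        = (\<Oplus>\<^bsub>A\<^esub>s\<in>carrier G. f s \<otimes>\<^bsub>A\<^esub> f1 (inv\<^bsub>G\<^esub> s \<otimes>\<^bsub>G\<^esub> y) \<otimes>\<^bsub>A\<^esub> f2 (inv\<^bsub>G\<^esub> y \<otimes>\<^bsub>G\<^esub> x))"
      unfolding conv_mult[OF f f1 y] using x y cl finite_group
      by (intro finsum_ldistr) auto
    also have "\<dots> = (\<Oplus>\<^bsub>A\<^esub>s\<in>carrier G. ?s s y)"
      using x y cl by (intro finsum_cong') (auto simp: m_assoc)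
    finally show ?thesis .
  qed
  have right: "f s \<otimes>\<^bsub>A\<^esub> (f1 \<otimes>\<^bsub>C\<^esub> f2) (inv\<^bsub>G\<^esub> s \<otimes>\<^bsub>G\<^esub> x) = (\<Oplus>\<^bsub>A\<^esub>y\<in>carrier G. ?s s y)"
    if s: "s \<in> carrier G" for s
  proof -
    have sx: "inv\<^bsub>G\<^esub> s \<otimes>\<^bsub>G\<^esub> x \<in> carrier G" using s x by simp
    have *: "s \<otimes>\<^bsub>G\<^esub> (inv\<^bsub>G\<^esub> s \<otimes>\<^bsub>G\<^esub> x) = x"
      using s x by (simp add: G.m_assoc[symmetric])
    \<comment> \<open>The inner sum is reindexed by \<open>t = s^-1 y\<close>, as left translation
      permutes the group; the argument \<open>t^-1 s^-1 x\<close> then becomes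
      \<open>y^-1 x\<close>.\<close>
    have "(f1 \<otimes>\<^bsub>C\<^esub> f2) (inv\<^bsub>G\<^esub> s \<otimes>\<^bsub>G\<^esub> x) = (\<Oplus>\<^bsub>A\<^esub>t\<in>(\<lambda>y. inv\<^bsub>G\<^esub> s \<otimes>\<^bsub>G\<^esub> y) ` carrier G.
        f1 t \<otimes>\<^bsub>A\<^esub> f2 (inv\<^bsub>G\<^esub> t \<otimes>\<^bsub>G\<^esub> (inv\<^bsub>G\<^esub> s \<otimes>\<^bsub>G\<^esub> x)))"
      unfolding conv_mult[OF f1 f2 sx] using s by (simp add: G.surj_const_mult)
    also have "\<dots> = (\<Oplus>\<^bsub>A\<^esub>y\<in>carrier G. f1 (inv\<^bsub>G\<^esub> s \<otimes>\<^bsub>G\<^esub> y) \<otimes>\<^bsub>A\<^esub>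
        f2 (inv\<^bsub>G\<^esub> (inv\<^bsub>G\<^esub> s \<otimes>\<^bsub>G\<^esub> y) \<otimes>\<^bsub>G\<^esub> (inv\<^bsub>G\<^esub> s \<otimes>\<^bsub>G\<^esub> x)))"
      using s x cl by (intro finsum_reindex) (auto simp: G.inj_on_cmult)
    also have "\<dots> = (\<Oplus>\<^bsub>A\<^esub>y\<in>carrier G. f1 (inv\<^bsub>G\<^esub> s \<otimes>\<^bsub>G\<^esub> y) \<otimes>\<^bsub>A\<^esub> f2 (inv\<^bsub>G\<^esub> y \<otimes>\<^bsub>G\<^esub> x))"
      using s x cl by (intro finsum_cong') (auto simp: G.inv_mult_group G.m_assoc *)
    finally show ?thesis
      using s x cl finite_group by (simp add: finsum_rdistr Pi_def)
  qed
  have "(f \<otimes>\<^bsub>C\<^esub> f1 \<otimes>\<^bsub>C\<^esub> f2) x = (\<Oplus>\<^bsub>A\<^esub>y\<in>carrier G. (f \<otimes>\<^bsub>C\<^esub> f1) y \<otimes>\<^bsub>A\<^esub> f2 (inv\<^bsub>G\<^esub> y \<otimes>\<^bsub>G\<^esub> x))"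
    by (rule conv_mult[OF conv_mult_closed[OF f f1] f2 x])
  also have "\<dots> = (\<Oplus>\<^bsub>A\<^esub>y\<in>carrier G. \<Oplus>\<^bsub>A\<^esub>s\<in>carrier G. ?s s y)"
    using x cl by (intro finsum_cong' left) (auto intro!: finsum_closed)
  also have "\<dots> = (\<Oplus>\<^bsub>A\<^esub>s\<in>carrier G. \<Oplus>\<^bsub>A\<^esub>y\<in>carrier G. ?s s y)"
    using finite_group x cl by (intro finsum_swap) auto
  also have "\<dots> = (\<Oplus>\<^bsub>A\<^esub>s\<in>carrier G. f s \<otimes>\<^bsub>A\<^esub> (f1 \<otimes>\<^bsub>C\<^esub> f2) (inv\<^bsub>G\<^esub> s \<otimes>\<^bsub>G\<^esub> x))"
    using x cl conv_closed[OF conv_mult_closed[OF f1 f2]]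
    by (intro finsum_cong' right[symmetric]) auto
  also have "\<dots> = (f \<otimes>\<^bsub>C\<^esub> (f1 \<otimes>\<^bsub>C\<^esub> f2)) x"
    by (rule conv_mult[OF f conv_mult_closed[OF f1 f2] x, symmetric])
  finally show "(f \<otimes>\<^bsub>C\<^esub> f1 \<otimes>\<^bsub>C\<^esub> f2) x = (f \<otimes>\<^bsub>C\<^esub> (f1 \<otimes>\<^bsub>C\<^esub> f2)) x" .
qed (intro conv_mult_closed f f1 f2)+

lemma conv_l_distr:
  assumes f: "f \<in> carrier C" and f1: "f1 \<in> carrier C" and f2: "f2 \<in> carrier C"
  shows "(f \<oplus>\<^bsub>C\<^esub> f1) \<otimes>\<^bsub>C\<^esub> f2 = f \<otimes>\<^bsub>C\<^esub> f2 \<oplus>\<^bsub>C\<^esub> f1 \<otimes>\<^bsub>C\<^esub> f2"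
proof (rule conv_eqI)
  fix x assume x: "x \<in> carrier G"
  note cl = conv_closed[OF f] conv_closed[OF f1] conv_closed[OF f2]
  have "((f \<oplus>\<^bsub>C\<^esub> f1) \<otimes>\<^bsub>C\<^esub> f2) x = (\<Oplus>\<^bsub>A\<^esub>y\<in>carrier G.
      f y \<otimes>\<^bsub>A\<^esub> f2 (inv\<^bsub>G\<^esub> y \<otimes>\<^bsub>G\<^esub> x) \<oplus>\<^bsub>A\<^esub> f1 y \<otimes>\<^bsub>A\<^esub> f2 (inv\<^bsub>G\<^esub> y \<otimes>\<^bsub>G\<^esub> x))"
    unfolding conv_mult[OF conv_add_closed[OF f f1] f2 x] using x cl
    by (intro finsum_cong') (auto simp: conv_add l_distr)
  also have "\<dots> = (f \<otimes>\<^bsub>C\<^esub> f2 \<oplus>\<^bsub>C\<^esub> f1 \<otimes>\<^bsub>C\<^esub> f2) x"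
    unfolding conv_add[OF x] conv_mult[OF f f2 x] conv_mult[OF f1 f2 x] using x cl
    by (intro finsum_addf) auto
  finally show "((f \<oplus>\<^bsub>C\<^esub> f1) \<otimes>\<^bsub>C\<^esub> f2) x = (f \<otimes>\<^bsub>C\<^esub> f2 \<oplus>\<^bsub>C\<^esub> f1 \<otimes>\<^bsub>C\<^esub> f2) x" .
qed (intro conv_mult_closed conv_add_closed f f1 f2)+

lemma conv_r_distr:
  assumes f: "f \<in> carrier C" and f1: "f1 \<in> carrier C" and f2: "f2 \<in> carrier C"
  shows "f2 \<otimes>\<^bsub>C\<^esub> (f \<oplus>\<^bsub>C\<^esub> f1) = f2 \<otimes>\<^bsub>C\<^esub> f \<oplus>\<^bsub>C\<^esub> f2 \<otimes>\<^bsub>C\<^esub> f1"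
proof (rule conv_eqI)
  fix x assume x: "x \<in> carrier G"
  note cl = conv_closed[OF f] conv_closed[OF f1] conv_closed[OF f2]
  have "(f2 \<otimes>\<^bsub>C\<^esub> (f \<oplus>\<^bsub>C\<^esub> f1)) x = (\<Oplus>\<^bsub>A\<^esub>y\<in>carrier G.
      f2 y \<otimes>\<^bsub>A\<^esub> f (inv\<^bsub>G\<^esub> y \<otimes>\<^bsub>G\<^esub> x) \<oplus>\<^bsub>A\<^esub> f2 y \<otimes>\<^bsub>A\<^esub> f1 (inv\<^bsub>G\<^esub> y \<otimes>\<^bsub>G\<^esub> x))"
    unfolding conv_mult[OF f2 conv_add_closed[OF f f1] x] using x cl
    by (intro finsum_cong') (auto simp: conv_add r_distr)
  also have "\<dots> = (f2 \<otimes>\<^bsub>C\<^esub> f \<oplus>\<^bsub>C\<^esub> f2 \<otimes>\<^bsub>C\<^esub> f1) x"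
    unfolding conv_add[OF x] conv_mult[OF f2 f x] conv_mult[OF f2 f1 x] using x cl
    by (intro finsum_addf) auto
  finally show "(f2 \<otimes>\<^bsub>C\<^esub> (f \<oplus>\<^bsub>C\<^esub> f1)) x = (f2 \<otimes>\<^bsub>C\<^esub> f \<oplus>\<^bsub>C\<^esub> f2 \<otimes>\<^bsub>C\<^esub> f1) x" .
qed (intro conv_mult_closed conv_add_closed f f1 f2)+

lemma conv_smult_mult_left:
  assumes r: "r \<in> carrier R" and f: "f \<in> carrier C" and f1: "f1 \<in> carrier C"
  shows "(r \<odot>\<^bsub>C\<^esub> f) \<otimes>\<^bsub>C\<^esub> f1 = r \<odot>\<^bsub>C\<^esub> (f \<otimes>\<^bsub>C\<^esub> f1)"
proof (rule conv_eqI)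
  fix x assume x: "x \<in> carrier G"
  note cl = conv_closed[OF f] conv_closed[OF f1]
  have "((r \<odot>\<^bsub>C\<^esub> f) \<otimes>\<^bsub>C\<^esub> f1) x
      = (\<Oplus>\<^bsub>A\<^esub>y\<in>carrier G. r \<odot>\<^bsub>A\<^esub> (f y \<otimes>\<^bsub>A\<^esub> f1 (inv\<^bsub>G\<^esub> y \<otimes>\<^bsub>G\<^esub> x)))"
    unfolding conv_mult[OF conv_smult_closed[OF r f] f1 x] using x cl r
    by (intro finsum_cong') (auto simp: conv_smult smult_mult_left)
  also have "\<dots> = (r \<odot>\<^bsub>C\<^esub> (f \<otimes>\<^bsub>C\<^esub> f1)) x"
    unfolding conv_smult[OF x] conv_mult[OF f f1 x] using finite_group x cl r
    by (intro finsum_smult_ldistr[symmetric]) auto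
  finally show "((r \<odot>\<^bsub>C\<^esub> f) \<otimes>\<^bsub>C\<^esub> f1) x = (r \<odot>\<^bsub>C\<^esub> (f \<otimes>\<^bsub>C\<^esub> f1)) x" .
qed (intro conv_mult_closed conv_smult_closed r f f1)+

lemma conv_smult_mult_right:
  assumes r: "r \<in> carrier R" and f: "f \<in> carrier C" and f1: "f1 \<in> carrier C"
  shows "f \<otimes>\<^bsub>C\<^esub> (r \<odot>\<^bsub>C\<^esub> f1) = r \<odot>\<^bsub>C\<^esub> (f \<otimes>\<^bsub>C\<^esub> f1)"
proof (rule conv_eqI)
  fix x assume x: "x \<in> carrier G"
  note cl = conv_closed[OF f] conv_closed[OF f1]
  have "(f \<otimes>\<^bsub>C\<^esub> (r \<odot>\<^bsub>C\<^esub> f1)) x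
      = (\<Oplus>\<^bsub>A\<^esub>y\<in>carrier G. r \<odot>\<^bsub>A\<^esub> (f y \<otimes>\<^bsub>A\<^esub> f1 (inv\<^bsub>G\<^esub> y \<otimes>\<^bsub>G\<^esub> x)))"
    unfolding conv_mult[OF f conv_smult_closed[OF r f1] x] using x cl r
    by (intro finsum_cong') (auto simp: conv_smult smult_mult_right)
  also have "\<dots> = (r \<odot>\<^bsub>C\<^esub> (f \<otimes>\<^bsub>C\<^esub> f1)) x"
    unfolding conv_smult[OF x] conv_mult[OF f f1 x] using finite_group x cl r
    by (intro finsum_smult_ldistr[symmetric]) auto
  finally show "(f \<otimes>\<^bsub>C\<^esub> (r \<odot>\<^bsub>C\<^esub> f1)) x = (r \<odot>\<^bsub>C\<^esub> (f \<otimes>\<^bsub>C\<^esub> f1)) x" .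
qed (intro conv_mult_closed conv_smult_closed r f f1)+

lemma conv_algebra_assoc_algebra: "assoc_algebra R C"
  by (intro assoc_algebraI conv_module ringI conv_abelian_group monoidI conv_mult_closed
      conv_one_closed conv_l_one conv_r_one conv_assoc conv_l_distr conv_r_distr
      conv_smult_mult_left conv_smult_mult_right)

end


section \<open>Quotients over a residue ring\<close>

text \<open>Only additivity of \<open>h\<close> enters, so this covers coset maps, evaluation at one
  component, inclusions of submodules and multiplication by a fixed element. Infinite index sets are
  harmless because both sums are then zero.\<close>

lemma finsum_hom:
  assumes "abelian_monoid B" "abelian_monoid C" "h \<in> carrier B \<rightarrow> carrier C"
    and add: "\<And>x y. \<lbrakk>x \<in> carrier B; y \<in> carrier B\<rbrakk> \<Longrightarrow> h (x \<oplus>\<^bsub>B\<^esub> y) = h x \<oplus>\<^bsub>C\<^esub> h y"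
    and zero: "h \<zero>\<^bsub>B\<^esub> = \<zero>\<^bsub>C\<^esub>" and u: "u \<in> I \<rightarrow> carrier B"
  shows "h (finsum B u I) = (\<Oplus>\<^bsub>C\<^esub>i\<in>I. h (u i))"
proof -
  interpret B: abelian_monoid B by fact
  interpret C: abelian_monoid C by fact
  show ?thesis
    using u
  proof (induction I rule: infinite_finite_induct)
    case (insert i I)
    then have "h (u i) \<in> carrier C" "(\<lambda>i. h (u i)) \<in> I \<rightarrow> carrier C"
      using assms(3) by auto
    with insert show ?case by (simp add: add Pi_def)
  qed (simp_all add: zero)
qed

lemma (in abelian_monoid) finsum_mem:
  assumes "\<zero> \<in> H" "\<And>x y. \<lbrakk>x \<in> H; y \<in> H\<rbrakk> \<Longrightarrow> x \<oplus> y \<in> H" "H \<subseteq> carrier G" "f \<in> I \<rightarrow> H"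
  shows "finsum G f I \<in> H"
  using assms(4)
proof (induction I rule: infinite_finite_induct)
  case (insert i I)
  then have "f i \<in> H" "f \<in> I \<rightarrow> H" "f \<in> I \<rightarrow> carrier G" "f i \<in> carrier G"
    using assms(3) by auto
  with insert show ?case by (simp add: assms)
qed (simp_all add: assms)

lemma (in abelian_subgroup) coset_eq_iff:
  assumes "x \<in> carrier G" "y \<in> carrier G"
  shows "H +> x = H +> y \<longleftrightarrow> x \<ominus> y \<in> H"
proof -
  have "H +> x = H +> y \<longleftrightarrow> x \<in> H +> y"
    using a_rcos_self[OF assms(1)] a_repr_independence[OF _ assms(2) a_subgroup] by blast
  then show ?thesis
    using a_rcos_module[OF assms(2,1)] by (simp add: a_minus_def)
qed

text \<open>A coset depends on the addition alone, so cosets formed inside a submodule and inside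
  the whole module are the same sets.\<close>

lemma a_r_coset_carrier_update [simp]: "a_r_coset (M\<lparr>carrier := S\<rparr>) H x = a_r_coset M H x"
  by (simp add: a_r_coset_def r_coset_def)

lemma (in assoc_algebra) subalgebra_assoc_algebra:
  assumes S: "submodule S R A" and "\<one>\<^bsub>A\<^esub> \<in> S"
    and "\<And>x y. \<lbrakk>x \<in> S; y \<in> S\<rbrakk> \<Longrightarrow> x \<otimes>\<^bsub>A\<^esub> y \<in> S"
  shows "assoc_algebra R (A\<lparr>carrier := S\<rparr>)"
proof -
  have sub: "x \<in> carrier A" if "x \<in> S" for x
    using submoduleE(1)[OF S] that by auto
  have "module R (A\<lparr>carrier := S\<rparr>)"
    by (intro submodule.submodule_is_module[OF S] module_axioms)
  then show ?thesis
    using assms(2,3)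
    by (intro assoc_algebraI ringI monoidI)
      (auto simp: sub m_assoc l_distr r_distr smult_mult_left smult_mult_right dest: module.axioms)
qed

text \<open>\<open>J_smult\<close> is what lets \<open>R Quot J\<close> act on the quotient.
  \<open>N\<close> is only a submodule here, since a single twisted component carries no product;
  the multiplicative facts ask separately that \<open>N\<close> be an ideal.\<close>

locale residue_quotient = module R M + J: ideal J R
    for R (structure) and J and M (structure) +
  fixes N
  assumes N_submodule: "submodule N R M"
    and J_smult: "\<lbrakk>r \<in> J; x \<in> carrier M\<rbrakk> \<Longrightarrow> r \<odot>\<^bsub>M\<^esub> x \<in> N"
begin

sublocale N: abelian_subgroup N M
  using N_submodule
  by (intro abelian_subgroupI3 additive_subgroup.intro M.abelian_group_axioms)
    (simp add: submodule_def)

abbreviation "Q \<equiv> quotient_module M N"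

lemma quot_carrier: "carrier Q = (\<lambda>x. N +>\<^bsub>M\<^esub> x) ` carrier M"
  by (auto simp: quotient_module_def A_RCOSETS_def' )

lemma quot_add:
  "\<lbrakk>x \<in> carrier M; y \<in> carrier M\<rbrakk> \<Longrightarrow> (N +>\<^bsub>M\<^esub> x) \<oplus>\<^bsub>Q\<^esub> (N +>\<^bsub>M\<^esub> y) = N +>\<^bsub>M\<^esub> (x \<oplus>\<^bsub>M\<^esub> y)"
  by (simp add: quotient_module_def N.a_rcos_sum)

lemma quot_zero: "\<zero>\<^bsub>Q\<^esub> = N +>\<^bsub>M\<^esub> \<zero>\<^bsub>M\<^esub>"
  by (simp add: quotient_module_def N.a_subset)

text \<open>The scalar product is a union over all representatives of both cosets, so each of them
  has to contribute the same coset: for \<open>s = j + r\<close> and \<open>y = n + x\<close>, the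
  element \<open>s y\<close> differs from \<open>r x\<close> by \<open>j y + r n\<close>, and both
  terms lie in \<open>N\<close>.\<close>

lemma quot_smult:
  assumes r: "r \<in> carrier R" and x: "x \<in> carrier M"
  shows "(J +> r) \<odot>\<^bsub>Q\<^esub> (N +>\<^bsub>M\<^esub> x) = N +>\<^bsub>M\<^esub> (r \<odot>\<^bsub>M\<^esub> x)"
proof -
  have "N +>\<^bsub>M\<^esub> (s \<odot>\<^bsub>M\<^esub> y) = N +>\<^bsub>M\<^esub> (r \<odot>\<^bsub>M\<^esub> x)" if s: "s \<in> J +> r" and y: "y \<in> N +>\<^bsub>M\<^esub> x" for s y
  proof -
    obtain j where j: "j \<in> J" "s = j \<oplus> r" using s by (auto simp: a_r_coset_def')
    obtain n where n: "n \<in> N" "y = n \<oplus>\<^bsub>M\<^esub> x" using y by (auto simp: a_r_coset_def')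
    have c: "j \<in> carrier R" "n \<in> carrier M" "y \<in> carrier M"
      using j n r x J.a_subset N.a_subset by auto
    have "s \<odot>\<^bsub>M\<^esub> y = (j \<odot>\<^bsub>M\<^esub> y \<oplus>\<^bsub>M\<^esub> r \<odot>\<^bsub>M\<^esub> n) \<oplus>\<^bsub>M\<^esub> r \<odot>\<^bsub>M\<^esub> x"
      using j n c r x by (simp add: smult_l_distr smult_r_distr M.a_ac)
    moreover have "j \<odot>\<^bsub>M\<^esub> y \<oplus>\<^bsub>M\<^esub> r \<odot>\<^bsub>M\<^esub> n \<in> N"
      using J_smult[OF j(1) c(3)] submoduleE(4)[OF N_submodule r n(1)] by simp
    ultimately have "s \<odot>\<^bsub>M\<^esub> y \<in> N +>\<^bsub>M\<^esub> (r \<odot>\<^bsub>M\<^esub> x)"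
      by (auto simp: a_r_coset_def')
    from M.a_repr_independence[OF this smult_closed[OF r x] N.a_subgroup] show ?thesis ..
  qed
  then have "(\<Union>s\<in>J +> r. \<Union>y\<in>N +>\<^bsub>M\<^esub> x. N +>\<^bsub>M\<^esub> (s \<odot>\<^bsub>M\<^esub> y))
      = (\<Union>s\<in>J +> r. \<Union>y\<in>N +>\<^bsub>M\<^esub> x. N +>\<^bsub>M\<^esub> (r \<odot>\<^bsub>M\<^esub> x))"
    by (intro SUP_cong refl)
  also have "\<dots> = N +>\<^bsub>M\<^esub> (r \<odot>\<^bsub>M\<^esub> x)"
    using J.a_rcos_self[OF r] N.a_rcos_self[OF x] by auto
  finally show ?thesis by (simp add: quotient_module_def)
qed

lemma residue_cring: "cring (R Quot J)"
  by (rule J.quotient_is_cring) (rule R.cring_axioms)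

lemma residue_carrier: "carrier (R Quot J) = (\<lambda>r. J +> r) ` carrier R"
  by (auto simp: FactRing_def A_RCOSETS_def')

lemma residue_simps:
  "\<lbrakk>r \<in> carrier R; s \<in> carrier R\<rbrakk> \<Longrightarrow> (J +> r) \<oplus>\<^bsub>R Quot J\<^esub> (J +> s) = J +> (r \<oplus> s)"
  "\<lbrakk>r \<in> carrier R; s \<in> carrier R\<rbrakk> \<Longrightarrow> (J +> r) \<otimes>\<^bsub>R Quot J\<^esub> (J +> s) = J +> (r \<otimes> s)"
  "\<one>\<^bsub>R Quot J\<^esub> = J +> \<one>"
  by (simp_all add: FactRing_def J.a_rcos_sum J.rcoset_mult_add)

lemma quot_abelian_group: "abelian_group Q"
proof (rule abelian_groupI)
  fix X assume "X \<in> carrier Q"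
  then obtain x where "x \<in> carrier M" "X = N +>\<^bsub>M\<^esub> x" by (auto simp: quot_carrier)
  then show "\<exists>Y\<in>carrier Q. Y \<oplus>\<^bsub>Q\<^esub> X = \<zero>\<^bsub>Q\<^esub>"
    by (intro bexI[of _ "N +>\<^bsub>M\<^esub> (\<ominus>\<^bsub>M\<^esub> x)"]) (auto simp: quot_add quot_zero quot_carrier M.l_neg)
qed (auto simp: quot_carrier quot_add quot_zero M.a_ac)

lemma quot_module: "module (R Quot J) Q"
  by (rule moduleI[OF residue_cring quot_abelian_group])
    (auto simp: residue_carrier quot_carrier quot_smult quot_add residue_simps
      smult_l_distr smult_r_distr smult_assoc1)

lemma quot_finsum:
  assumes "u \<in> I \<rightarrow> carrier M"
  shows "(\<Oplus>\<^bsub>Q\<^esub>i\<in>I. N +>\<^bsub>M\<^esub> u i) = N +>\<^bsub>M\<^esub> finsum M u I"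
proof (rule finsum_hom[symmetric])
  show "abelian_monoid M" ..
  show "abelian_monoid Q" using quot_abelian_group by (rule abelian_group.axioms)
qed (use assms in \<open>auto simp: quot_carrier quot_add quot_zero\<close>)

lemma quot_mult:
  assumes "ideal N M" "x \<in> carrier M" "y \<in> carrier M"
  shows "(N +>\<^bsub>M\<^esub> x) \<otimes>\<^bsub>Q\<^esub> (N +>\<^bsub>M\<^esub> y) = N +>\<^bsub>M\<^esub> (x \<otimes>\<^bsub>M\<^esub> y)"
  using assms by (simp add: quotient_module_def ideal.rcoset_mult_add)

lemma quot_assoc_algebra:
  assumes A: "assoc_algebra R M" and N: "ideal N M"
  shows "assoc_algebra (R Quot J) Q"
proof -
  interpret A: assoc_algebra R M by fact
  note mult = quot_mult[OF N]
  have one: "\<one>\<^bsub>Q\<^esub> = N +>\<^bsub>M\<^esub> \<one>\<^bsub>M\<^esub>" by (simp add: quotient_module_def)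
  show ?thesis
    by (intro assoc_algebraI quot_module ringI quot_abelian_group monoidI)
      (auto simp: quot_carrier one mult quot_add A.m_assoc A.l_distr A.r_distr residue_carrier
        quot_smult A.smult_mult_left A.smult_mult_right)
qed

end

text \<open>Every element of \<open>C\<close> is an image under \<open>h\<close>, and
  \<open>h\<close> carries each law of \<open>B\<close> to the same law in \<open>C\<close>. This
  spares a direct verification of the axioms for the extended Brauer quotient.\<close>

lemma assoc_algebra_transfer:
  assumes "assoc_algebra R B" and bij: "bij_betw h (carrier B) (carrier C)"
    and add: "\<And>x y. \<lbrakk>x \<in> carrier B; y \<in> carrier B\<rbrakk> \<Longrightarrow> h (x \<oplus>\<^bsub>B\<^esub> y) = h x \<oplus>\<^bsub>C\<^esub> h y"
    and mult: "\<And>x y. \<lbrakk>x \<in> carrier B; y \<in> carrier B\<rbrakk> \<Longrightarrow> h (x \<otimes>\<^bsub>B\<^esub> y) = h x \<otimes>\<^bsub>C\<^esub> h y"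
    and smult: "\<And>r x. \<lbrakk>r \<in> carrier R; x \<in> carrier B\<rbrakk> \<Longrightarrow> h (r \<odot>\<^bsub>B\<^esub> x) = r \<odot>\<^bsub>C\<^esub> h x"
    and zero: "h \<zero>\<^bsub>B\<^esub> = \<zero>\<^bsub>C\<^esub>" and one: "h \<one>\<^bsub>B\<^esub> = \<one>\<^bsub>C\<^esub>"
  shows "assoc_algebra R C"
proof -
  interpret B: assoc_algebra R B by fact
  have C: "carrier C = h ` carrier B" using bij by (simp add: bij_betw_def)
  \<comment> \<open>Reversed, these equations pull every operation of \<open>C\<close> inside
    \<open>h\<close>, where the laws of \<open>B\<close> apply.\<close>
  note hom = C add[symmetric] mult[symmetric] smult[symmetric] zero[symmetric] one[symmetric]
  have ab: "abelian_group C"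
  proof (rule abelian_groupI)
    fix x assume "x \<in> carrier C"
    then obtain y where "y \<in> carrier B" "x = h y" by (auto simp: C)
    then show "\<exists>z\<in>carrier C. z \<oplus>\<^bsub>C\<^esub> x = \<zero>\<^bsub>C\<^esub>"
      by (intro bexI[of _ "h (\<ominus>\<^bsub>B\<^esub> y)"]) (auto simp: hom B.l_neg)
  qed (auto simp: hom B.a_ac)
  show ?thesis
  proof (intro assoc_algebraI moduleI ringI ab monoidI)
    show "cring R" by (rule B.R.cring_axioms)
  qed (auto simp: hom B.m_assoc B.l_distr B.r_distr B.smult_l_distr B.smult_r_distr
      B.smult_assoc1 B.smult_mult_left B.smult_mult_right)
qed

text \<open>The grading travels against the direction of \<open>assoc_algebra_transfer\<close>:
  unique homogeneous decompositions are easy to see in the external direct sum \<open>C\<close> and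
  are pulled back to \<open>B\<close>.\<close>

lemma graded_algebra_pullback:
  assumes "assoc_algebra R B" "graded_algebra R G C compC" and h: "h \<in> alg_hom R B C"
    and bij: "bij_betw h (carrier B) (carrier C)"
    and sub: "\<And>g. g \<in> carrier G \<Longrightarrow> compB g \<subseteq> carrier B"
    and comp: "\<And>g. g \<in> carrier G \<Longrightarrow> h ` compB g = compC g"
  shows "graded_algebra R G B compB"
proof -
  interpret B: assoc_algebra R B by fact
  interpret C: graded_algebra R G C compC by fact
  have h_add: "h (x \<oplus>\<^bsub>B\<^esub> y) = h x \<oplus>\<^bsub>C\<^esub> h y" if "x \<in> carrier B" "y \<in> carrier B" for x y
    using h that by (simp add: alg_hom_def ring_hom_add)
  have h_mult: "h (x \<otimes>\<^bsub>B\<^esub> y) = h x \<otimes>\<^bsub>C\<^esub> h y" if "x \<in> carrier B" "y \<in> carrier B" for x y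
    using h that by (simp add: alg_hom_def ring_hom_mult)
  have h_smult: "h (r \<odot>\<^bsub>B\<^esub> x) = r \<odot>\<^bsub>C\<^esub> h x" if "r \<in> carrier R" "x \<in> carrier B" for r x
    using h that by (simp add: alg_hom_def)
  have h_closed: "h x \<in> carrier C" if "x \<in> carrier B" for x
    using bij that by (auto simp: bij_betw_def)
  have inj: "x = y" if "h x = h y" "x \<in> carrier B" "y \<in> carrier B" for x y
    using bij that by (auto simp: bij_betw_def inj_on_def)
  have h_zero: "h \<zero>\<^bsub>B\<^esub> = \<zero>\<^bsub>C\<^esub>"
    using h_add[of "\<zero>\<^bsub>B\<^esub>" "\<zero>\<^bsub>B\<^esub>"] h_closed[of "\<zero>\<^bsub>B\<^esub>"] by (simp add: C.add.r_cancel_one')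
  \<comment> \<open>Injectivity makes each \<open>compB g\<close> the full preimage of
    \<open>compC g\<close> in the carrier.\<close>
  have mem: "x \<in> compB g \<longleftrightarrow> h x \<in> compC g" if "g \<in> carrier G" "x \<in> carrier B" for g x
    using comp[OF that(1)] sub[OF that(1)] inj that(2) by (metis image_iff subsetD)
  have h_minus: "h (\<ominus>\<^bsub>B\<^esub> x) = \<ominus>\<^bsub>C\<^esub> h x" if "x \<in> carrier B" for x
    using that h_add[of "\<ominus>\<^bsub>B\<^esub> x" x] h_zero h_closed by (simp add: B.l_neg C.minus_equality)
  have h_finsum: "h (finsum B u I) = (\<Oplus>\<^bsub>C\<^esub>i\<in>I. h (u i))" if "I \<subseteq> carrier G" "u \<in> I \<rightarrow> carrier B" for u I
    by (rule finsum_hom) (use that h_add h_zero h_closed in \<open>auto intro: B.abelian_monoid_axioms C.abelian_monoid_axioms\<close>)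
  show ?thesis
  proof (intro graded_algebra.intro graded_algebra_axioms.intro B.assoc_algebra_axioms C.group_axioms)
    fix g assume g: "g \<in> carrier G"
    have s: "x \<in> carrier B" if "x \<in> compB g" for x using sub g that by auto
    have hc: "h x \<in> compC g" if "x \<in> compB g" for x using comp[OF g] that by auto
    note CS = C.submoduleE[OF C.comp_submodule[OF g]]
    have Cz: "\<zero>\<^bsub>C\<^esub> \<in> compC g"
      using C.comp_submodule[OF g] subgroup.one_closed by (fastforce simp: submodule_def)
    show "submodule (compB g) R B"
    proof (rule B.submoduleI)
      show "compB g \<subseteq> carrier B" using sub g .
      show "\<zero>\<^bsub>B\<^esub> \<in> compB g" using Cz g by (simp add: mem h_zero)
      show "\<ominus>\<^bsub>B\<^esub> x \<in> compB g" if "x \<in> compB g" for x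
        using that CS(3) g by (simp add: mem h_minus s hc)
      show "x \<oplus>\<^bsub>B\<^esub> y \<in> compB g" if "x \<in> compB g" "y \<in> compB g" for x y
        using that CS(5) g by (simp add: mem h_add s hc)
      show "r \<odot>\<^bsub>B\<^esub> x \<in> compB g" if "r \<in> carrier R" "x \<in> compB g" for r x
        using that CS(4) g by (simp add: mem h_smult s hc)
    qed
    fix k x y assume k: "k \<in> carrier G" and x: "x \<in> compB g" and y: "y \<in> compB k"
    have xy: "x \<in> carrier B" "y \<in> carrier B" "h y \<in> compC k"
      using s[OF x] sub[OF k] comp[OF k] y by auto
    then have "h (x \<otimes>\<^bsub>B\<^esub> y) \<in> compC (g \<otimes>\<^bsub>G\<^esub> k)"
      using C.comp_mult[OF g k hc[OF x]] by (simp add: h_mult)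
    then show "x \<otimes>\<^bsub>B\<^esub> y \<in> compB (g \<otimes>\<^bsub>G\<^esub> k)"
      using mem xy g k by simp
  next
    fix x assume x: "x \<in> carrier B"
    let ?P = "\<lambda>x f. f \<in> Pi\<^sub>E (carrier G) compC \<and> finite {g \<in> carrier G. f g \<noteq> \<zero>\<^bsub>C\<^esub>} \<and>
               x = (\<Oplus>\<^bsub>C\<^esub>g\<in>{g \<in> carrier G. f g \<noteq> \<zero>\<^bsub>C\<^esub>}. f g)"
    let ?PB = "\<lambda>f. f \<in> Pi\<^sub>E (carrier G) compB \<and> finite {g \<in> carrier G. f g \<noteq> \<zero>\<^bsub>B\<^esub>} \<and>
               x = (\<Oplus>\<^bsub>B\<^esub>g\<in>{g \<in> carrier G. f g \<noteq> \<zero>\<^bsub>B\<^esub>}. f g)"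
    have ex1: "\<exists>!f. ?P (h x) f" using C.comp_direct[OF h_closed[OF x]] .
    \<comment> \<open>A family of homogeneous elements of \<open>B\<close> is compared with its
      image under \<open>h\<close>: one decomposes \<open>x\<close> exactly when the other
      decomposes \<open>h x\<close>.\<close>
    let ?H = "\<lambda>u. \<lambda>g\<in>carrier G. h (u g)"
    have H: "?PB u \<longleftrightarrow> ?P (h x) (?H u)" if u: "u \<in> Pi\<^sub>E (carrier G) compB" for u
    proof -
      have u': "u g \<in> carrier B" if "g \<in> carrier G" for g using u that sub by auto
      \<comment> \<open>The supports agree because \<open>h\<close> is injective and preserves
        zero.\<close>
      have supp: "{g \<in> carrier G. u g \<noteq> \<zero>\<^bsub>B\<^esub>} = {g \<in> carrier G. ?H u g \<noteq> \<zero>\<^bsub>C\<^esub>}" (is "?S = _")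
        using u' inj[OF _ u' B.zero_closed] by (auto simp: h_zero)
      have "h (\<Oplus>\<^bsub>B\<^esub>g\<in>?S. u g) = (\<Oplus>\<^bsub>C\<^esub>g\<in>?S. h (u g))"
        using u' by (intro h_finsum) auto
      also have "\<dots> = (\<Oplus>\<^bsub>C\<^esub>g\<in>?S. ?H u g)"
        using u' h_closed by (intro C.finsum_cong') auto
      finally have "h (\<Oplus>\<^bsub>B\<^esub>g\<in>?S. u g) = (\<Oplus>\<^bsub>C\<^esub>g\<in>?S. ?H u g)" .
      moreover have "(\<Oplus>\<^bsub>B\<^esub>g\<in>?S. u g) \<in> carrier B"
        by (rule B.finsum_closed) (use u' in simp)
      ultimately have "x = (\<Oplus>\<^bsub>B\<^esub>g\<in>?S. u g) \<longleftrightarrow> h x = (\<Oplus>\<^bsub>C\<^esub>g\<in>?S. ?H u g)"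
        using inj[OF _ x] by auto
      moreover have "?H u \<in> Pi\<^sub>E (carrier G) compC"
        using u comp by auto
      ultimately show ?thesis using u supp by simp
    qed
    show "\<exists>!f. ?PB f"
    proof (rule ex_ex1I)
      obtain f where f: "?P (h x) f" using ex1 by blast
      have "\<forall>g\<in>carrier G. \<exists>y\<in>compB g. h y = f g"
        using f comp by (metis PiE_mem image_iff)
      then obtain u where u: "\<forall>g\<in>carrier G. u g \<in> compB g \<and> h (u g) = f g" by metis
      have "?H (restrict u (carrier G)) = f"
        using u f by (intro extensionalityI[of _ "carrier G"]) (auto simp: PiE_def)
      then show "\<exists>f. ?PB f"
        using H[of "restrict u (carrier G)"] f u by (intro exI[of _ "restrict u (carrier G)"]) auto
    next
      fix u v assume uv: "?PB u" "?PB v"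
      then have "?H u = ?H v" using ex1 H by blast
      then have "h (u g) = h (v g)" if "g \<in> carrier G" for g
        using that by (metis restrict_apply')
      moreover have "u g \<in> carrier B" "v g \<in> carrier B" if "g \<in> carrier G" for g
        using uv that sub by blast+
      ultimately show "u = v"
        using uv inj by (intro PiE_ext[of u "carrier G" compB v]) auto
    qed
  qed
qed


section \<open>Graded subquotients of a convolution algebra\<close>

text \<open>The extended Brauer quotient with \<open>Aut P\<close> replaced by a group
  \<open>G\<close>, and the twisted fixed points and kernels by families \<open>F\<close> and
  \<open>N\<close>. The record has the same shape, so that unfolding exhibits the extended Brauer
  quotient as an instance.\<close>

definition quotient_sum ::
  "('r, 'a, 'm) module_scheme \<Rightarrow> ('g, 'n) monoid_scheme \<Rightarrow> ('g \<Rightarrow> 'a set) \<Rightarrow> ('g \<Rightarrow> 'a set)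
    \<Rightarrow> ('r set, 'g \<Rightarrow> 'a set) module"
where
  "quotient_sum A G F N =
     (let D = (\<lambda>g. quotient_module (A\<lparr>carrier := F g\<rparr>) (N g)) in
     \<lparr> carrier = (\<Pi>\<^sub>E g\<in>carrier G. carrier (D g)),
       monoid.mult = (\<lambda>f f'. \<lambda>x\<in>carrier G.
         \<Oplus>\<^bsub>D x\<^esub>w\<in>{(y, z) \<in> carrier G \<times> carrier G. y \<otimes>\<^bsub>G\<^esub> z = x}.
           rcoset_mult A (N x) (f (fst w)) (f' (snd w))),
       one = (\<lambda>g\<in>carrier G. if g = \<one>\<^bsub>G\<^esub> then N g +>\<^bsub>A\<^esub> \<one>\<^bsub>A\<^esub> else \<zero>\<^bsub>D g\<^esub>),
       ring.zero = (\<lambda>g\<in>carrier G. \<zero>\<^bsub>D g\<^esub>),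
       add = (\<lambda>f f'. \<lambda>g\<in>carrier G. f g \<oplus>\<^bsub>D g\<^esub> f' g),
       smult = (\<lambda>c f. \<lambda>g\<in>carrier G. c \<odot>\<^bsub>D g\<^esub> f g) \<rparr>)"

lemma (in module) submodule_restrict:
  assumes "submodule N R M" "submodule F R M" "N \<subseteq> F"
  shows "submodule N R (M\<lparr>carrier := F\<rparr>)"
  using assms add.subgroup_incl[of N F]
  by (simp add: submodule_def submodule_axioms_def)

text \<open>Expressed through homogeneous components: \<open>F\<close> is a graded subalgebra and
  \<open>N\<close> a graded two-sided ideal of it that contains all multiples by \<open>J\<close>.
  No single \<open>F g\<close> or \<open>N g\<close> is assumed to be closed under
  multiplication.\<close>

locale graded_subquotient = group_convolution R A G + J: ideal J R
    for R (structure) and A (structure) and G (structure) and J +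
  fixes F N
  assumes F_submodule: "g \<in> carrier G \<Longrightarrow> submodule (F g) R A"
    and N_submodule: "g \<in> carrier G \<Longrightarrow> submodule (N g) R A"
    and N_subset: "g \<in> carrier G \<Longrightarrow> N g \<subseteq> F g"
    and J_smult: "\<lbrakk>g \<in> carrier G; r \<in> J; x \<in> F g\<rbrakk> \<Longrightarrow> r \<odot>\<^bsub>A\<^esub> x \<in> N g"
    and one_mem: "\<one>\<^bsub>A\<^esub> \<in> F \<one>\<^bsub>G\<^esub>"
    and F_mult: "\<lbrakk>g \<in> carrier G; h \<in> carrier G; x \<in> F g; y \<in> F h\<rbrakk> \<Longrightarrow> x \<otimes>\<^bsub>A\<^esub> y \<in> F (g \<otimes>\<^bsub>G\<^esub> h)"
    and F_N_mult: "\<lbrakk>g \<in> carrier G; h \<in> carrier G; x \<in> F g; y \<in> N h\<rbrakk> \<Longrightarrow> x \<otimes>\<^bsub>A\<^esub> y \<in> N (g \<otimes>\<^bsub>G\<^esub> h)"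
    and N_F_mult: "\<lbrakk>g \<in> carrier G; h \<in> carrier G; x \<in> N g; y \<in> F h\<rbrakk> \<Longrightarrow> x \<otimes>\<^bsub>A\<^esub> y \<in> N (g \<otimes>\<^bsub>G\<^esub> h)"
begin

text \<open>In the application \<open>F \<phi>\<close> and \<open>N \<phi>\<close> are the twisted fixed points and the twisted kernel, so that
  \<open>B\<close> becomes the Brauer quotient of \<open>A \<otimes> Aut(P)\<close> and \<open>E\<close> the extended Brauer quotient.\<close>

abbreviation "S \<equiv> \<Pi>\<^sub>E g\<in>carrier G. F g"
abbreviation "K \<equiv> \<Pi>\<^sub>E g\<in>carrier G. N g"
abbreviation "B \<equiv> quotient_module (C\<lparr>carrier := S\<rparr>) K"
abbreviation "D g \<equiv> quotient_module (A\<lparr>carrier := F g\<rparr>) (N g)"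
abbreviation "E \<equiv> quotient_sum A G F N"

lemma F_closed: "g \<in> carrier G \<Longrightarrow> x \<in> F g \<Longrightarrow> x \<in> carrier A"
  using submoduleE(1)[OF F_submodule] by blast

lemma N_F: "g \<in> carrier G \<Longrightarrow> x \<in> N g \<Longrightarrow> x \<in> F g"
  using N_subset by blast

lemma submodule_zero: "submodule H R A \<Longrightarrow> \<zero>\<^bsub>A\<^esub> \<in> H"
  using subgroup.one_closed by (fastforce simp: submodule_def)

lemma submodule_finsum: "submodule H R A \<Longrightarrow> u \<in> I \<rightarrow> H \<Longrightarrow> finsum A u I \<in> H"
  by (rule finsum_mem) (auto intro: submodule_zero submoduleE(5) dest: submoduleE(1))

lemma N_abelian_subgroup: "g \<in> carrier G \<Longrightarrow> abelian_subgroup (N g) A"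
  using N_submodule[of g]
  by (intro abelian_subgroupI3 additive_subgroup.intro abelian_group_axioms)
    (simp add: submodule_def)

lemma coset_eq:
  "\<lbrakk>g \<in> carrier G; x \<in> carrier A; y \<in> carrier A\<rbrakk>
    \<Longrightarrow> N g +>\<^bsub>A\<^esub> x = N g +>\<^bsub>A\<^esub> y \<longleftrightarrow> x \<ominus>\<^bsub>A\<^esub> y \<in> N g"
  by (intro abelian_subgroup.coset_eq_iff N_abelian_subgroup)

lemma D_residue_quotient:
  assumes g: "g \<in> carrier G"
  shows "residue_quotient R J (A\<lparr>carrier := F g\<rparr>) (N g)"
proof (intro residue_quotient.intro residue_quotient_axioms.intro J.ideal_axioms)
  show "module R (A\<lparr>carrier := F g\<rparr>)"
    by (intro submodule.submodule_is_module[OF F_submodule[OF g]] module_axioms)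
  show "submodule (N g) R (A\<lparr>carrier := F g\<rparr>)"
    by (intro submodule_restrict N_submodule F_submodule N_subset g)
qed (simp add: J_smult g)

lemma D_carrier: "g \<in> carrier G \<Longrightarrow> carrier (D g) = (\<lambda>x. N g +>\<^bsub>A\<^esub> x) ` F g"
  using residue_quotient.quot_carrier[OF D_residue_quotient] by simp

lemma D_add:
  "\<lbrakk>g \<in> carrier G; x \<in> F g; y \<in> F g\<rbrakk> \<Longrightarrow> (N g +>\<^bsub>A\<^esub> x) \<oplus>\<^bsub>D g\<^esub> (N g +>\<^bsub>A\<^esub> y) = N g +>\<^bsub>A\<^esub> (x \<oplus>\<^bsub>A\<^esub> y)"
  using residue_quotient.quot_add[OF D_residue_quotient] by simp

lemma D_zero: "g \<in> carrier G \<Longrightarrow> \<zero>\<^bsub>D g\<^esub> = N g +>\<^bsub>A\<^esub> \<zero>\<^bsub>A\<^esub>"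
  using residue_quotient.quot_zero[OF D_residue_quotient] by simp

lemma D_smult:
  "\<lbrakk>g \<in> carrier G; r \<in> carrier R; x \<in> F g\<rbrakk>
    \<Longrightarrow> (J +> r) \<odot>\<^bsub>D g\<^esub> (N g +>\<^bsub>A\<^esub> x) = N g +>\<^bsub>A\<^esub> (r \<odot>\<^bsub>A\<^esub> x)"
  using residue_quotient.quot_smult[OF D_residue_quotient] by simp

lemma D_module: "g \<in> carrier G \<Longrightarrow> module (R Quot J) (D g)"
  by (rule residue_quotient.quot_module[OF D_residue_quotient])

lemma D_abelian_monoid: "g \<in> carrier G \<Longrightarrow> abelian_monoid (D g)"
  using D_module module.axioms(2) abelian_group.axioms(1) by blast

lemma D_finsum:
  assumes g: "g \<in> carrier G" and u: "u \<in> I \<rightarrow> F g"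
  shows "(\<Oplus>\<^bsub>D g\<^esub>i\<in>I. N g +>\<^bsub>A\<^esub> u i) = N g +>\<^bsub>A\<^esub> finsum A u I"
proof -
  interpret M: module R "A\<lparr>carrier := F g\<rparr>"
    by (intro submodule.submodule_is_module[OF F_submodule[OF g]] module_axioms)
  \<comment> \<open>A sum formed in the submodule equals the sum formed in \<open>A\<close>; the
    inclusion is treated as an additive map.\<close>
  have "finsum (A\<lparr>carrier := F g\<rparr>) u I = (\<Oplus>\<^bsub>A\<^esub>i\<in>I. u i)"
    using finsum_hom[of "A\<lparr>carrier := F g\<rparr>" A "\<lambda>x. x" u I] u F_closed[OF g]
      M.abelian_monoid_axioms abelian_monoid_axioms by auto
  then show ?thesis
    using residue_quotient.quot_finsum[OF D_residue_quotient[OF g], of u I] u by simp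
qed

lemma S_mem: "f \<in> S \<longleftrightarrow> f \<in> extensional (carrier G) \<and> (\<forall>g\<in>carrier G. f g \<in> F g)"
  by (rule PiE_mem_iff)

lemma K_mem: "f \<in> K \<longleftrightarrow> f \<in> extensional (carrier G) \<and> (\<forall>g\<in>carrier G. f g \<in> N g)"
  by (rule PiE_mem_iff)

lemma S_carrier: "S \<subseteq> carrier C"
  unfolding subset_iff conv_carrier S_mem using F_closed by blast

lemma K_S: "K \<subseteq> S"
  using N_subset by (auto simp: S_mem K_mem simp del: PiE_iff)

section \<open>The subalgebra \<open>S\<close> of the convolution algebra and its ideal
  \<open>K\<close>\<close>

lemma pointwise_submodule:
  assumes "\<And>g. g \<in> carrier G \<Longrightarrow> submodule (H g) R A"
  shows "submodule (\<Pi>\<^sub>E g\<in>carrier G. H g) R C"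
proof (rule module.submoduleI[OF conv_module])
  note H = submoduleE[OF assms] and z = submodule_zero[OF assms]
  show sub: "(\<Pi>\<^sub>E g\<in>carrier G. H g) \<subseteq> carrier C"
    unfolding subset_iff conv_carrier PiE_mem_iff using H(1) by blast
  show "\<zero>\<^bsub>C\<^esub> \<in> (\<Pi>\<^sub>E g\<in>carrier G. H g)"
    using z by (auto simp: conv_algebra_simps(4))
  fix f assume f: "f \<in> (\<Pi>\<^sub>E g\<in>carrier G. H g)"
  then have fc: "f \<in> carrier C" using sub by blast
  \<comment> \<open>The additive inverse is determined by the addition of the record, so its
    pointwise form has to come from the uniqueness of inverses.\<close>
  have "(\<lambda>g\<in>carrier G. \<ominus>\<^bsub>A\<^esub> f g) \<oplus>\<^bsub>C\<^esub> f = \<zero>\<^bsub>C\<^esub>"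
    using fc conv_closed[OF fc] by (auto simp: conv_algebra_simps(4,5) l_neg intro!: restrict_ext)
  then have minus: "\<ominus>\<^bsub>C\<^esub> f = (\<lambda>g\<in>carrier G. \<ominus>\<^bsub>A\<^esub> f g)"
    using fc conv_closed[OF fc]
    by (intro abelian_group.minus_equality[OF conv_abelian_group]) (auto simp: conv_carrier)
  show "\<ominus>\<^bsub>C\<^esub> f \<in> (\<Pi>\<^sub>E g\<in>carrier G. H g)"
    unfolding minus restrict_PiE_iff by (intro ballI H(3) PiE_mem[OF f])
  show "f \<oplus>\<^bsub>C\<^esub> f' \<in> (\<Pi>\<^sub>E g\<in>carrier G. H g)" if "f' \<in> (\<Pi>\<^sub>E g\<in>carrier G. H g)" for f'
    unfolding conv_algebra_simps(5) restrict_PiE_iff by (intro ballI H(5) PiE_mem[OF f] PiE_mem[OF that])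
  show "r \<odot>\<^bsub>C\<^esub> f \<in> (\<Pi>\<^sub>E g\<in>carrier G. H g)" if "r \<in> carrier R" for r
    unfolding conv_algebra_simps(6) restrict_PiE_iff by (intro ballI H(4) PiE_mem[OF f] that)
qed

text \<open>The term of the convolution at \<open>g\<close> indexed by \<open>y\<close> has degree
  \<open>y (y^-1 g) = g\<close>. With \<open>X\<close> and \<open>Y\<close> chosen among
  \<open>F\<close> and \<open>N\<close>, this gives both that \<open>S\<close> is closed under
  products and that \<open>K\<close> is a two-sided ideal of it.\<close>

lemma pointwise_mult:
  assumes "f \<in> (\<Pi>\<^sub>E g\<in>carrier G. X g)" "f' \<in> (\<Pi>\<^sub>E g\<in>carrier G. Y g)"
    and XY: "\<And>g. g \<in> carrier G \<Longrightarrow> X g \<subseteq> carrier A" "\<And>g. g \<in> carrier G \<Longrightarrow> Y g \<subseteq> carrier A"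
    and H: "\<And>g. g \<in> carrier G \<Longrightarrow> submodule (H g) R A"
    and mult: "\<And>g h x y. \<lbrakk>g \<in> carrier G; h \<in> carrier G; x \<in> X g; y \<in> Y h\<rbrakk>
      \<Longrightarrow> x \<otimes>\<^bsub>A\<^esub> y \<in> H (g \<otimes>\<^bsub>G\<^esub> h)"
  shows "f \<otimes>\<^bsub>C\<^esub> f' \<in> (\<Pi>\<^sub>E g\<in>carrier G. H g)"
proof -
  have f: "f y \<in> X y" "f' y \<in> Y y" if "y \<in> carrier G" for y using assms(1,2) that by auto
  have fc: "f \<in> carrier C" "f' \<in> carrier C"
    using assms(1,2) XY unfolding conv_carrier PiE_mem_iff by blast+
  have "(f \<otimes>\<^bsub>C\<^esub> f') g \<in> H g" if g: "g \<in> carrier G" for g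
    unfolding conv_mult[OF fc g]
  proof (intro submodule_finsum H g Pi_I)
    fix y assume y: "y \<in> carrier G"
    have "f y \<otimes>\<^bsub>A\<^esub> f' (inv\<^bsub>G\<^esub> y \<otimes>\<^bsub>G\<^esub> g) \<in> H (y \<otimes>\<^bsub>G\<^esub> (inv\<^bsub>G\<^esub> y \<otimes>\<^bsub>G\<^esub> g))"
      using y g by (intro mult f) auto
    then show "f y \<otimes>\<^bsub>A\<^esub> f' (inv\<^bsub>G\<^esub> y \<otimes>\<^bsub>G\<^esub> g) \<in> H g"
      using y g by (simp add: G.m_assoc[symmetric])
  qed
  then show ?thesis
    using conv_mult_closed[OF fc] by (simp add: conv_carrier PiE_mem_iff del: PiE_iff)
qed

lemma S_assoc_algebra: "assoc_algebra R (C\<lparr>carrier := S\<rparr>)"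
proof (rule assoc_algebra.subalgebra_assoc_algebra[OF conv_algebra_assoc_algebra])
  show "submodule S R C" by (intro pointwise_submodule F_submodule)
  show "\<one>\<^bsub>C\<^esub> \<in> S"
    using one_mem submodule_zero[OF F_submodule] by (auto simp: conv_algebra_simps(3))
  show "f \<otimes>\<^bsub>C\<^esub> f' \<in> S" if "f \<in> S" "f' \<in> S" for f f'
    using that by (rule pointwise_mult) (auto intro: F_mult F_submodule F_closed)
qed

lemma K_submodule: "submodule K R (C\<lparr>carrier := S\<rparr>)"
  by (intro module.submodule_restrict[OF conv_module] pointwise_submodule F_submodule
      N_submodule K_S)

lemma K_ideal: "ideal K (C\<lparr>carrier := S\<rparr>)"
proof (rule idealI)
  interpret S: assoc_algebra R "C\<lparr>carrier := S\<rparr>" by (rule S_assoc_algebra)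
  show "ring (C\<lparr>carrier := S\<rparr>)" by (rule S.ring_axioms)
  show "subgroup K (add_monoid (C\<lparr>carrier := S\<rparr>))"
    using K_submodule by (simp add: submodule_def)
  fix f f' assume f: "f \<in> K" and "f' \<in> carrier (C\<lparr>carrier := S\<rparr>)"
  then have f': "f' \<in> S" by simp
  have "f' \<otimes>\<^bsub>C\<^esub> f \<in> K"
    using f' f by (rule pointwise_mult) (auto intro: F_N_mult N_submodule F_closed N_F)
  then show "f' \<otimes>\<^bsub>C\<lparr>carrier := S\<rparr>\<^esub> f \<in> K" by simp
  have "f \<otimes>\<^bsub>C\<^esub> f' \<in> K"
    using f f' by (rule pointwise_mult) (auto intro: N_F_mult N_submodule F_closed N_F)
  then show "f \<otimes>\<^bsub>C\<lparr>carrier := S\<rparr>\<^esub> f' \<in> K" by simp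
qed

lemma B_residue_quotient: "residue_quotient R J (C\<lparr>carrier := S\<rparr>) K"
proof (intro residue_quotient.intro residue_quotient_axioms.intro J.ideal_axioms K_submodule)
  interpret S: assoc_algebra R "C\<lparr>carrier := S\<rparr>" by (rule S_assoc_algebra)
  show "module R (C\<lparr>carrier := S\<rparr>)" by (rule S.module_axioms)
  show "r \<odot>\<^bsub>C\<lparr>carrier := S\<rparr>\<^esub> f \<in> K" if "r \<in> J" "f \<in> carrier (C\<lparr>carrier := S\<rparr>)" for r f
    using that J_smult by (auto simp: conv_algebra_simps(6))
qed

lemma B_assoc_algebra: "assoc_algebra (R Quot J) B"
  by (rule residue_quotient.quot_assoc_algebra[OF B_residue_quotient S_assoc_algebra K_ideal])

lemma B_carrier: "carrier B = (\<lambda>f. K +>\<^bsub>C\<^esub> f) ` S"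
  using residue_quotient.quot_carrier[OF B_residue_quotient] by simp

text \<open>Subtraction in \<open>C\<close> is pointwise, so congruence modulo \<open>K\<close> is
  congruence in every component. Read in one direction this makes the comparison map well defined,
  read in the other it makes it injective.\<close>

lemma B_coset_eq:
  assumes f: "f \<in> S" and f': "f' \<in> S"
  shows "K +>\<^bsub>C\<^esub> f = K +>\<^bsub>C\<^esub> f' \<longleftrightarrow> (\<forall>g\<in>carrier G. N g +>\<^bsub>A\<^esub> f g = N g +>\<^bsub>A\<^esub> f' g)"
proof -
  interpret C: abelian_group C by (rule conv_abelian_group)
  have fc: "f \<in> carrier C" "f' \<in> carrier C" using S_carrier f f' by auto
  have K: "abelian_subgroup K C"
    using pointwise_submodule[OF N_submodule]
    by (intro abelian_subgroupI3 additive_subgroup.intro conv_abelian_group) (simp add: submodule_def)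
  have eq: "f \<ominus>\<^bsub>C\<^esub> f' = (\<lambda>g\<in>carrier G. f g \<ominus>\<^bsub>A\<^esub> f' g)"
  proof -
    have "(\<lambda>g\<in>carrier G. f g \<ominus>\<^bsub>A\<^esub> f' g) \<oplus>\<^bsub>C\<^esub> f' = f"
      using fc conv_closed[OF fc(1)] conv_closed[OF fc(2)]
      by (intro conv_eqI) (auto simp: conv_carrier conv_algebra_simps(5) a_minus_def a_assoc l_neg)
    moreover have "(\<lambda>g\<in>carrier G. f g \<ominus>\<^bsub>A\<^esub> f' g) \<in> carrier C"
      using conv_closed[OF fc(1)] conv_closed[OF fc(2)] by (auto simp: conv_carrier)
    ultimately show ?thesis
      using fc C.add.inv_solve_right[of "\<lambda>g\<in>carrier G. f g \<ominus>\<^bsub>A\<^esub> f' g" f f']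
      by (simp add: a_minus_def)
  qed
  show ?thesis
    unfolding abelian_subgroup.coset_eq_iff[OF K fc] eq restrict_PiE_iff
    by (intro ball_cong refl coset_eq[symmetric] conv_closed[OF fc(1)] conv_closed[OF fc(2)])
qed

section \<open>The comparison map from the quotient algebra to the sum of quotients\<close>

lemma E_simps:
  "carrier E = (\<Pi>\<^sub>E g\<in>carrier G. carrier (D g))"
  "f \<otimes>\<^bsub>E\<^esub> f' = (\<lambda>x\<in>carrier G.
         \<Oplus>\<^bsub>D x\<^esub>w\<in>{(y, z) \<in> carrier G \<times> carrier G. y \<otimes>\<^bsub>G\<^esub> z = x}.
           rcoset_mult A (N x) (f (fst w)) (f' (snd w)))"
  "\<one>\<^bsub>E\<^esub> = (\<lambda>g\<in>carrier G. if g = \<one>\<^bsub>G\<^esub> then N g +>\<^bsub>A\<^esub> \<one>\<^bsub>A\<^esub> else \<zero>\<^bsub>D g\<^esub>)"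
  "\<zero>\<^bsub>E\<^esub> = (\<lambda>g\<in>carrier G. \<zero>\<^bsub>D g\<^esub>)"
  "f \<oplus>\<^bsub>E\<^esub> f' = (\<lambda>g\<in>carrier G. f g \<oplus>\<^bsub>D g\<^esub> f' g)"
  "c \<odot>\<^bsub>E\<^esub> f = (\<lambda>g\<in>carrier G. c \<odot>\<^bsub>D g\<^esub> f g)"
  by (simp_all add: quotient_sum_def)

lemma E_ext: "y \<in> carrier E \<Longrightarrow> y \<in> extensional (carrier G)"
  unfolding E_simps(1) by (simp add: PiE_def)

lemma E_val: "y \<in> carrier E \<Longrightarrow> g \<in> carrier G \<Longrightarrow> y g \<in> carrier (D g)"
  unfolding E_simps(1) by (rule PiE_mem)

text \<open>The union over all representatives avoids choosing one.\<close>

definition comp_map where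
  "comp_map X = (\<lambda>g\<in>carrier G. \<Union>f\<in>X. N g +>\<^bsub>A\<^esub> f g)"

text \<open>All representatives of the class of \<open>f\<close> lie in \<open>S\<close> and have
  the same coset in each component, so the union has a single value; it is not empty because
  \<open>f\<close> is a representative of its own class.\<close>

lemma comp_map_coset:
  assumes f: "f \<in> S"
  shows "comp_map (K +>\<^bsub>C\<^esub> f) = (\<lambda>g\<in>carrier G. N g +>\<^bsub>A\<^esub> f g)"
  unfolding comp_map_def
proof (intro restrict_ext)
  fix g assume g: "g \<in> carrier G"
  have mem: "f' \<in> S \<and> K +>\<^bsub>C\<^esub> f' = K +>\<^bsub>C\<^esub> f" if f': "f' \<in> K +>\<^bsub>C\<^esub> f" for f'
  proof
    obtain k where k: "k \<in> K" "f' = k \<oplus>\<^bsub>C\<^esub> f" using f' by (auto simp: a_r_coset_def' simp del: PiE_iff)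
    show "f' \<in> S"
      unfolding k(2)
      by (rule module.submoduleE(5)[OF conv_module pointwise_submodule[OF F_submodule]])
        (use k(1) K_S f in blast)+
    show "K +>\<^bsub>C\<^esub> f' = K +>\<^bsub>C\<^esub> f"
      using abelian_group.a_repr_independence[OF conv_abelian_group f'] S_carrier f
        pointwise_submodule[OF N_submodule] by (auto simp: submodule_def simp del: PiE_iff)
  qed
  have "f \<in> K +>\<^bsub>C\<^esub> f"
  proof -
    have "\<zero>\<^bsub>C\<^esub> \<in> K" using submodule_zero[OF N_submodule] by (auto simp: conv_algebra_simps(4))
    moreover have "\<zero>\<^bsub>C\<^esub> \<oplus>\<^bsub>C\<^esub> f = f"
      using abelian_monoid.l_zero[OF abelian_group.axioms(1)[OF conv_abelian_group]] S_carrier f by blast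
    ultimately show ?thesis unfolding a_r_coset_def' by force
  qed
  moreover have "N g +>\<^bsub>A\<^esub> f' g = N g +>\<^bsub>A\<^esub> f g" if "f' \<in> K +>\<^bsub>C\<^esub> f" for f'
    using mem[OF that] B_coset_eq[of f' f] f g by blast
  ultimately show "(\<Union>f'\<in>K +>\<^bsub>C\<^esub> f. N g +>\<^bsub>A\<^esub> f' g) = N g +>\<^bsub>A\<^esub> f g"
    by blast
qed

lemma comp_map_bij: "bij_betw comp_map (carrier B) (carrier E)"
proof (rule bij_betw_imageI)
  show "inj_on comp_map (carrier B)"
  proof (rule inj_onI)
    fix X Y assume "X \<in> carrier B" "Y \<in> carrier B" and eq: "comp_map X = comp_map Y"
    then obtain f f' where f: "f \<in> S" "X = K +>\<^bsub>C\<^esub> f" and f': "f' \<in> S" "Y = K +>\<^bsub>C\<^esub> f'"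
      unfolding B_carrier by blast
    have "N g +>\<^bsub>A\<^esub> f g = N g +>\<^bsub>A\<^esub> f' g" if "g \<in> carrier G" for g
      using fun_cong[OF eq, of g] that unfolding f(2) f'(2) comp_map_coset[OF f(1)] comp_map_coset[OF f'(1)]
      by simp
    then show "X = Y" unfolding f(2) f'(2) B_coset_eq[OF f(1) f'(1)] by blast
  qed
  show "comp_map ` carrier B = carrier E"
  proof (intro equalityI subsetI)
    fix y assume "y \<in> comp_map ` carrier B"
    then obtain f where f: "f \<in> S" "y = comp_map (K +>\<^bsub>C\<^esub> f)" unfolding B_carrier by blast
    show "y \<in> carrier E"
      unfolding f(2) comp_map_coset[OF f(1)] E_simps using PiE_mem[OF f(1)] by (auto simp: D_carrier)
  next
    fix y assume y: "y \<in> carrier E"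
    have "\<exists>x. x \<in> F g \<and> y g = N g +>\<^bsub>A\<^esub> x" if "g \<in> carrier G" for g
      using E_val[OF y that] D_carrier[OF that] by auto
    \<comment> \<open>\<open>S\<close> is the full product of the \<open>F g\<close>, so
      representatives chosen independently in each component form an element of it.\<close>
    then obtain f where f: "\<forall>g\<in>carrier G. f g \<in> F g \<and> y g = N g +>\<^bsub>A\<^esub> f g"
      using bchoice[of "carrier G" "\<lambda>g x. x \<in> F g \<and> y g = N g +>\<^bsub>A\<^esub> x"] by blast
    then have fS: "restrict f (carrier G) \<in> S" by auto
    have "y = (\<lambda>g\<in>carrier G. N g +>\<^bsub>A\<^esub> restrict f (carrier G) g)"
      by (rule extensionalityI[OF E_ext[OF y] restrict_extensional]) (simp add: f)
    then have "y = comp_map (K +>\<^bsub>C\<^esub> restrict f (carrier G))" unfolding comp_map_coset[OF fS] .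
    then show "y \<in> comp_map ` carrier B" unfolding B_carrier using fS by blast
  qed
qed

text \<open>Three different subgroups occur, so the rule for the quotient by one ideal does not
  apply. With \<open>x' = m + x\<close> and \<open>y' = n + y\<close>, the difference of
  \<open>x' y'\<close> and \<open>x y\<close> is \<open>m y' + x n\<close>; the two summands lie in
  the target by \<open>N_F_mult\<close> and \<open>F_N_mult\<close>.\<close>

lemma rcoset_mult_coset:
  assumes g: "g \<in> carrier G" and h: "h \<in> carrier G" and x: "x \<in> F g" and y: "y \<in> F h"
  shows "rcoset_mult A (N (g \<otimes>\<^bsub>G\<^esub> h)) (N g +>\<^bsub>A\<^esub> x) (N h +>\<^bsub>A\<^esub> y) = N (g \<otimes>\<^bsub>G\<^esub> h) +>\<^bsub>A\<^esub> (x \<otimes>\<^bsub>A\<^esub> y)"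
proof -
  have gh: "g \<otimes>\<^bsub>G\<^esub> h \<in> carrier G" using g h by simp
  have eq: "N (g \<otimes>\<^bsub>G\<^esub> h) +>\<^bsub>A\<^esub> (x' \<otimes>\<^bsub>A\<^esub> y') = N (g \<otimes>\<^bsub>G\<^esub> h) +>\<^bsub>A\<^esub> (x \<otimes>\<^bsub>A\<^esub> y)"
    if x': "x' \<in> N g +>\<^bsub>A\<^esub> x" and y': "y' \<in> N h +>\<^bsub>A\<^esub> y" for x' y'
  proof -
    obtain m where m: "m \<in> N g" "x' = m \<oplus>\<^bsub>A\<^esub> x" using x' by (auto simp: a_r_coset_def')
    obtain n where n: "n \<in> N h" "y' = n \<oplus>\<^bsub>A\<^esub> y" using y' by (auto simp: a_r_coset_def')
    have y'F: "y' \<in> F h"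
      using n N_F[OF h] y submoduleE(5)[OF F_submodule[OF h]] by simp
    have c: "m \<in> carrier A" "n \<in> carrier A" "x \<in> carrier A" "y \<in> carrier A" "y' \<in> carrier A"
      using m(1) n(1) x y y'F F_closed g h N_F by auto
    have "x' \<otimes>\<^bsub>A\<^esub> y' = (m \<otimes>\<^bsub>A\<^esub> y' \<oplus>\<^bsub>A\<^esub> x \<otimes>\<^bsub>A\<^esub> n) \<oplus>\<^bsub>A\<^esub> x \<otimes>\<^bsub>A\<^esub> y"
      using m n c by (simp add: l_distr r_distr a_ac)
    moreover have "m \<otimes>\<^bsub>A\<^esub> y' \<oplus>\<^bsub>A\<^esub> x \<otimes>\<^bsub>A\<^esub> n \<in> N (g \<otimes>\<^bsub>G\<^esub> h)"
      using N_F_mult[OF g h m(1) y'F] F_N_mult[OF g h x n(1)] submoduleE(5)[OF N_submodule[OF gh]]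
      by blast
    ultimately have "x' \<otimes>\<^bsub>A\<^esub> y' \<in> N (g \<otimes>\<^bsub>G\<^esub> h) +>\<^bsub>A\<^esub> (x \<otimes>\<^bsub>A\<^esub> y)"
      by (auto simp: a_r_coset_def')
    moreover have "x \<otimes>\<^bsub>A\<^esub> y \<in> carrier A" using c by simp
    moreover have "subgroup (N (g \<otimes>\<^bsub>G\<^esub> h)) (add_monoid A)"
      using N_submodule[OF gh] by (simp add: submodule_def)
    ultimately show ?thesis by (rule a_repr_independence[symmetric])
  qed
  have "x \<in> N g +>\<^bsub>A\<^esub> x" "y \<in> N h +>\<^bsub>A\<^esub> y"
    using abelian_subgroup.a_rcos_self[OF N_abelian_subgroup] F_closed g h x y by auto
  then show ?thesis
    unfolding rcoset_mult_def using eq by blast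
qed

lemma comp_map_add:
  assumes "f \<in> S" "f' \<in> S"
  shows "comp_map ((K +>\<^bsub>C\<^esub> f) \<oplus>\<^bsub>B\<^esub> (K +>\<^bsub>C\<^esub> f')) = comp_map (K +>\<^bsub>C\<^esub> f) \<oplus>\<^bsub>E\<^esub> comp_map (K +>\<^bsub>C\<^esub> f')"
proof -
  interpret S: assoc_algebra R "C\<lparr>carrier := S\<rparr>" by (rule S_assoc_algebra)
  have sum: "f \<oplus>\<^bsub>C\<^esub> f' \<in> S" using S.a_closed[of f f'] assms by simp
  have "(K +>\<^bsub>C\<^esub> f) \<oplus>\<^bsub>B\<^esub> (K +>\<^bsub>C\<^esub> f') = K +>\<^bsub>C\<^esub> (f \<oplus>\<^bsub>C\<^esub> f')"
    using residue_quotient.quot_add[OF B_residue_quotient, of f f'] assms by simp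
  then show ?thesis
    unfolding comp_map_coset[OF assms(1)] comp_map_coset[OF assms(2)] E_simps
    using PiE_mem[OF assms(1)] PiE_mem[OF assms(2)]
    by (simp add: comp_map_coset[OF sum] conv_add D_add cong: restrict_cong)
qed

lemma comp_map_smult:
  assumes r: "r \<in> carrier R" and f: "f \<in> S"
  shows "comp_map ((J +> r) \<odot>\<^bsub>B\<^esub> (K +>\<^bsub>C\<^esub> f)) = (J +> r) \<odot>\<^bsub>E\<^esub> comp_map (K +>\<^bsub>C\<^esub> f)"
proof -
  interpret S: assoc_algebra R "C\<lparr>carrier := S\<rparr>" by (rule S_assoc_algebra)
  have rf: "r \<odot>\<^bsub>C\<^esub> f \<in> S" using S.smult_closed[of r f] r f by simp
  have "(J +> r) \<odot>\<^bsub>B\<^esub> (K +>\<^bsub>C\<^esub> f) = K +>\<^bsub>C\<^esub> (r \<odot>\<^bsub>C\<^esub> f)"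
    using residue_quotient.quot_smult[OF B_residue_quotient r, of f] f by simp
  then show ?thesis
    unfolding comp_map_coset[OF f] E_simps
    using PiE_mem[OF f] r by (simp add: comp_map_coset[OF rf] conv_smult D_smult cong: restrict_cong)
qed

text \<open>A component of the product in \<open>C\<close> is a finite sum of products. Passing to
  its coset gives a sum of cosets in \<open>D x\<close>, and each summand is the product of the
  cosets of its factors.\<close>

lemma comp_map_mult:
  assumes f: "f \<in> S" and f': "f' \<in> S"
  shows "comp_map ((K +>\<^bsub>C\<^esub> f) \<otimes>\<^bsub>B\<^esub> (K +>\<^bsub>C\<^esub> f')) = comp_map (K +>\<^bsub>C\<^esub> f) \<otimes>\<^bsub>E\<^esub> comp_map (K +>\<^bsub>C\<^esub> f')"
proof -
  interpret S: assoc_algebra R "C\<lparr>carrier := S\<rparr>" by (rule S_assoc_algebra)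
  have ff': "f \<otimes>\<^bsub>C\<^esub> f' \<in> S" using S.m_closed[of f f'] f f' by simp
  have "(K +>\<^bsub>C\<^esub> f) \<otimes>\<^bsub>B\<^esub> (K +>\<^bsub>C\<^esub> f') = K +>\<^bsub>C\<^esub> (f \<otimes>\<^bsub>C\<^esub> f')"
    using residue_quotient.quot_mult[OF B_residue_quotient K_ideal, of f f'] f f' by simp
  moreover have "N x +>\<^bsub>A\<^esub> (f \<otimes>\<^bsub>C\<^esub> f') x = (comp_map (K +>\<^bsub>C\<^esub> f) \<otimes>\<^bsub>E\<^esub> comp_map (K +>\<^bsub>C\<^esub> f')) x"
    if x: "x \<in> carrier G" for x
  proof -
    let ?W = "{(y, z) \<in> carrier G \<times> carrier G. y \<otimes>\<^bsub>G\<^esub> z = x}"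
    have u: "(\<lambda>w. f (fst w) \<otimes>\<^bsub>A\<^esub> f' (snd w)) \<in> ?W \<rightarrow> F x"
    proof
      fix w assume "w \<in> ?W"
      then show "f (fst w) \<otimes>\<^bsub>A\<^esub> f' (snd w) \<in> F x"
        using F_mult[of "fst w" "snd w", OF _ _ PiE_mem[OF f] PiE_mem[OF f']] by auto
    qed
    have "N x +>\<^bsub>A\<^esub> (f \<otimes>\<^bsub>C\<^esub> f') x = N x +>\<^bsub>A\<^esub> (\<Oplus>\<^bsub>A\<^esub>w\<in>?W. f (fst w) \<otimes>\<^bsub>A\<^esub> f' (snd w))"
      using x by (simp add: conv_algebra_simps(2) convolution_def)
    also have "\<dots> = (\<Oplus>\<^bsub>D x\<^esub>w\<in>?W. N x +>\<^bsub>A\<^esub> (f (fst w) \<otimes>\<^bsub>A\<^esub> f' (snd w)))"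
      by (rule D_finsum[OF x u, symmetric])
    also have "\<dots> = (\<Oplus>\<^bsub>D x\<^esub>w\<in>?W. rcoset_mult A (N x) (comp_map (K +>\<^bsub>C\<^esub> f) (fst w)) (comp_map (K +>\<^bsub>C\<^esub> f') (snd w)))"
    proof (rule abelian_monoid.finsum_cong'[OF D_abelian_monoid[OF x] refl])
      have eq: "rcoset_mult A (N x) (comp_map (K +>\<^bsub>C\<^esub> f) (fst w)) (comp_map (K +>\<^bsub>C\<^esub> f') (snd w))
          = N x +>\<^bsub>A\<^esub> (f (fst w) \<otimes>\<^bsub>A\<^esub> f' (snd w))" if "w \<in> ?W" for w
        using that rcoset_mult_coset[of "fst w" "snd w", OF _ _ PiE_mem[OF f] PiE_mem[OF f']]
        unfolding comp_map_coset[OF f] comp_map_coset[OF f'] by auto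
      show "N x +>\<^bsub>A\<^esub> (f (fst w) \<otimes>\<^bsub>A\<^esub> f' (snd w))
          = rcoset_mult A (N x) (comp_map (K +>\<^bsub>C\<^esub> f) (fst w)) (comp_map (K +>\<^bsub>C\<^esub> f') (snd w))"
        if "w \<in> ?W" for w using eq[OF that] by (rule sym)
      show "(\<lambda>w. rcoset_mult A (N x) (comp_map (K +>\<^bsub>C\<^esub> f) (fst w)) (comp_map (K +>\<^bsub>C\<^esub> f') (snd w))) \<in> ?W \<rightarrow> carrier (D x)"
        unfolding D_carrier[OF x] using funcset_mem[OF u] eq by (intro funcsetI) blast
    qed
    also have "\<dots> = (comp_map (K +>\<^bsub>C\<^esub> f) \<otimes>\<^bsub>E\<^esub> comp_map (K +>\<^bsub>C\<^esub> f')) x"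
      using x by (simp add: E_simps(2))
    finally show ?thesis .
  qed
  moreover have "comp_map (K +>\<^bsub>C\<^esub> f) \<otimes>\<^bsub>E\<^esub> comp_map (K +>\<^bsub>C\<^esub> f') \<in> extensional (carrier G)"
    by (simp add: E_simps(2))
  ultimately show ?thesis
    by (intro extensionalityI[of _ "carrier G"]) (simp_all add: comp_map_coset[OF ff'])
qed

lemma comp_map_zero: "comp_map \<zero>\<^bsub>B\<^esub> = \<zero>\<^bsub>E\<^esub>"
proof -
  interpret S: assoc_algebra R "C\<lparr>carrier := S\<rparr>" by (rule S_assoc_algebra)
  have "\<zero>\<^bsub>C\<^esub> \<in> S" using S.zero_closed by simp
  moreover have "\<zero>\<^bsub>B\<^esub> = K +>\<^bsub>C\<^esub> \<zero>\<^bsub>C\<^esub>"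
    using residue_quotient.quot_zero[OF B_residue_quotient] by simp
  ultimately show ?thesis
    by (auto simp: comp_map_coset E_simps(4) conv_algebra_simps(4) D_zero intro!: restrict_ext)
qed

lemma comp_map_one: "comp_map \<one>\<^bsub>B\<^esub> = \<one>\<^bsub>E\<^esub>"
proof -
  interpret S: assoc_algebra R "C\<lparr>carrier := S\<rparr>" by (rule S_assoc_algebra)
  have "\<one>\<^bsub>C\<^esub> \<in> S" using S.one_closed by simp
  moreover have "\<one>\<^bsub>B\<^esub> = K +>\<^bsub>C\<^esub> \<one>\<^bsub>C\<^esub>" by (simp add: quotient_module_def)
  ultimately show ?thesis
    by (auto simp: comp_map_coset E_simps(3) conv_algebra_simps(3) D_zero intro!: restrict_ext)
qed

lemma residue_carrier: "carrier (R Quot J) = (\<lambda>r. J +> r) ` carrier R"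
  by (rule residue_quotient.residue_carrier[OF B_residue_quotient])

lemma E_assoc_algebra: "assoc_algebra (R Quot J) E"
proof (rule assoc_algebra_transfer[OF B_assoc_algebra comp_map_bij])
  fix X Y assume "X \<in> carrier B" "Y \<in> carrier B"
  then obtain f f' where "f \<in> S" "X = K +>\<^bsub>C\<^esub> f" "f' \<in> S" "Y = K +>\<^bsub>C\<^esub> f'"
    unfolding B_carrier by blast
  then show "comp_map (X \<oplus>\<^bsub>B\<^esub> Y) = comp_map X \<oplus>\<^bsub>E\<^esub> comp_map Y" "comp_map (X \<otimes>\<^bsub>B\<^esub> Y) = comp_map X \<otimes>\<^bsub>E\<^esub> comp_map Y"
    using comp_map_add comp_map_mult by blast+
next
  fix c X assume "c \<in> carrier (R Quot J)" "X \<in> carrier B"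
  then show "comp_map (c \<odot>\<^bsub>B\<^esub> X) = c \<odot>\<^bsub>E\<^esub> comp_map X"
    unfolding B_carrier residue_carrier using comp_map_smult by blast
qed (rule comp_map_zero comp_map_one)+

lemma comp_map_alg_hom: "comp_map \<in> alg_hom (R Quot J) B E"
  unfolding alg_hom_def
proof (intro CollectI conjI ballI ring_hom_memI)
  fix X Y assume X: "X \<in> carrier B"
  then show "comp_map X \<in> carrier E" using comp_map_bij by (auto simp: bij_betw_def)
  assume "Y \<in> carrier B"
  with X obtain f f' where "f \<in> S" "X = K +>\<^bsub>C\<^esub> f" "f' \<in> S" "Y = K +>\<^bsub>C\<^esub> f'"
    unfolding B_carrier by blast
  then show "comp_map (X \<oplus>\<^bsub>B\<^esub> Y) = comp_map X \<oplus>\<^bsub>E\<^esub> comp_map Y" "comp_map (X \<otimes>\<^bsub>B\<^esub> Y) = comp_map X \<otimes>\<^bsub>E\<^esub> comp_map Y"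
    using comp_map_add comp_map_mult by blast+
next
  fix c X assume "c \<in> carrier (R Quot J)" "X \<in> carrier B"
  then show "comp_map (c \<odot>\<^bsub>B\<^esub> X) = c \<odot>\<^bsub>E\<^esub> comp_map X"
    unfolding B_carrier residue_carrier using comp_map_smult by blast
qed (rule comp_map_one)

section \<open>Homogeneous components and the grading of the sum\<close>

definition B_comp where
  "B_comp g = {K +>\<^bsub>C\<^esub> f | f. f \<in> S \<and> (\<forall>h\<in>carrier G. h \<noteq> g \<longrightarrow> f h = \<zero>\<^bsub>A\<^esub>)}"

definition E_comp where
  "E_comp g = {f \<in> carrier E. \<forall>h\<in>carrier G. h \<noteq> g \<longrightarrow> f h = \<zero>\<^bsub>D h\<^esub>}"

lemma comp_map_comp:
  assumes g: "g \<in> carrier G"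
  shows "comp_map ` B_comp g = E_comp g"
proof (intro equalityI subsetI)
  fix y assume "y \<in> comp_map ` B_comp g"
  then obtain f where f: "f \<in> S" "\<forall>h\<in>carrier G. h \<noteq> g \<longrightarrow> f h = \<zero>\<^bsub>A\<^esub>" "y = comp_map (K +>\<^bsub>C\<^esub> f)"
    unfolding B_comp_def by blast
  then show "y \<in> E_comp g"
    unfolding E_comp_def f(3) comp_map_coset[OF f(1)] using PiE_mem[OF f(1)] by (auto simp: E_simps(1) D_carrier D_zero)
next
  fix y assume y: "y \<in> E_comp g"
  then obtain x where x: "x \<in> F g" "y g = N g +>\<^bsub>A\<^esub> x"
    using E_val[of y g] g by (auto simp: E_comp_def D_carrier)
  \<comment> \<open>Off \<open>g\<close> the entry of \<open>y\<close> is the coset of zero, so zero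
    itself can be taken as representative there.\<close>
  define f where "f = (\<lambda>h\<in>carrier G. if h = g then x else \<zero>\<^bsub>A\<^esub>)"
  have fS: "f \<in> S" using x submodule_zero[OF F_submodule] by (auto simp: f_def)
  have "y = (\<lambda>h\<in>carrier G. N h +>\<^bsub>A\<^esub> f h)"
  proof (rule extensionalityI[OF E_ext restrict_extensional])
    show "y \<in> carrier E" using y by (simp add: E_comp_def)
    show "y h = (\<lambda>h\<in>carrier G. N h +>\<^bsub>A\<^esub> f h) h" if "h \<in> carrier G" for h
      using y x that by (auto simp: E_comp_def f_def D_zero)
  qed
  then have "y = comp_map (K +>\<^bsub>C\<^esub> f)" unfolding comp_map_coset[OF fS] .
  moreover have "K +>\<^bsub>C\<^esub> f \<in> B_comp g"
    unfolding B_comp_def by (intro CollectI exI[of _ f] conjI refl fS) (simp add: f_def)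
  ultimately show "y \<in> comp_map ` B_comp g" by blast
qed

text \<open>The entry of the sum at \<open>h\<close> only receives a contribution from
  \<open>u h\<close>, so the sum is the diagonal of \<open>u\<close>. Existence and uniqueness of
  homogeneous decompositions are both read off from this formula.\<close>

lemma E_comp_direct:
  assumes u: "u \<in> Pi\<^sub>E (carrier G) E_comp"
  shows "(\<Oplus>\<^bsub>E\<^esub>g\<in>{g \<in> carrier G. u g \<noteq> \<zero>\<^bsub>E\<^esub>}. u g) = (\<lambda>g\<in>carrier G. u g g)" (is "finsum E u ?I = _")
proof -
  interpret E: assoc_algebra "R Quot J" E by (rule E_assoc_algebra)
  have uE: "u g \<in> carrier E" if "g \<in> carrier G" for g
    using PiE_mem[OF u that] by (simp add: E_comp_def)
  have off: "u g h = \<zero>\<^bsub>D h\<^esub>" if "g \<in> carrier G" "h \<in> carrier G" "h \<noteq> g" for g h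
    using PiE_mem[OF u that(1)] that by (simp add: E_comp_def)
  have sum: "finsum E u ?I \<in> carrier E"
    by (rule E.finsum_closed) (use uE in simp)
  have "finsum E u ?I h = u h h" if h: "h \<in> carrier G" for h
  proof -
    interpret D: module "R Quot J" "D h" by (rule D_module[OF h])
    have c: "f h \<in> carrier (D h)" if "f \<in> carrier E" for f
      by (rule E_val[OF that h])
    have "finsum E u ?I h = (\<Oplus>\<^bsub>D h\<^esub>g\<in>?I. u g h)"
      by (rule finsum_hom[of E "D h" "\<lambda>f. f h"])
        (use uE c h in \<open>auto simp: E_simps(4,5) intro!: E.abelian_monoid_axioms D.abelian_monoid_axioms\<close>)
    also have "\<dots> = u h h"
    proof (cases "h \<in> ?I")
      case True
      then show ?thesis
        using finite_group h c uE off by (intro D.finsum_single) auto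
    next
      case False
      \<comment> \<open>An automatically omitted summand is zero, so the diagonal entry is the
        correct value in this case as well.\<close>
      then have "u h = \<zero>\<^bsub>E\<^esub>" using h by simp
      then have "u h h = \<zero>\<^bsub>D h\<^esub>" using h by (simp add: E_simps(4))
      moreover have "(\<Oplus>\<^bsub>D h\<^esub>g\<in>?I. u g h) = (\<Oplus>\<^bsub>D h\<^esub>g\<in>?I. \<zero>\<^bsub>D h\<^esub>)"
        using False h off by (intro D.finsum_cong') auto
      ultimately show ?thesis by simp
    qed
    finally show ?thesis .
  qed
  then show ?thesis
    by (intro extensionalityI[OF E_ext[OF sum] restrict_extensional]) simp
qed

lemma E_graded_algebra: "graded_algebra (R Quot J) G E E_comp"
proof -
  interpret E: assoc_algebra "R Quot J" E by (rule E_assoc_algebra)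
  have DM: "module (R Quot J) (D h)" if "h \<in> carrier G" for h
    by (rule D_module[OF that])
  show ?thesis
  proof (intro graded_algebra.intro graded_algebra_axioms.intro E.assoc_algebra_axioms G.group_axioms)
    fix g assume g: "g \<in> carrier G"
    have sub: "E_comp g \<subseteq> carrier E" by (auto simp: E_comp_def)
    have val: "f h = \<zero>\<^bsub>D h\<^esub>" if "f \<in> E_comp g" "h \<in> carrier G" "h \<noteq> g" for f h
      using that by (auto simp: E_comp_def)
    have z: "x \<oplus>\<^bsub>D h\<^esub> \<zero>\<^bsub>D h\<^esub> = x" if "h \<in> carrier G" "x \<in> carrier (D h)" for h x
      by (rule abelian_monoid.r_zero[OF D_abelian_monoid[OF that(1)] that(2)])
    have s: "c \<odot>\<^bsub>D h\<^esub> \<zero>\<^bsub>D h\<^esub> = \<zero>\<^bsub>D h\<^esub>" if "h \<in> carrier G" "c \<in> carrier (R Quot J)" for h c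
      by (rule module.smult_r_null[OF DM[OF that(1)] that(2)])
    show "submodule (E_comp g) (R Quot J) E"
    proof (rule E.submoduleI[OF sub])
      show zero: "\<zero>\<^bsub>E\<^esub> \<in> E_comp g"
        using E.zero_closed by (auto simp: E_comp_def E_simps(4))
      fix f assume f: "f \<in> E_comp g"
      then have fE: "f \<in> carrier E" using sub by blast
      show add: "f \<oplus>\<^bsub>E\<^esub> f' \<in> E_comp g" if f': "f' \<in> E_comp g" for f'
      proof -
        have "f \<oplus>\<^bsub>E\<^esub> f' \<in> carrier E" using fE f' sub by blast
        moreover have "(f \<oplus>\<^bsub>E\<^esub> f') h = \<zero>\<^bsub>D h\<^esub>" if "h \<in> carrier G" "h \<noteq> g" for h
          using that val[OF f that] val[OF f' that] abelian_monoid.r_zero[OF D_abelian_monoid[OF that(1)]]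
            abelian_monoid.zero_closed[OF D_abelian_monoid[OF that(1)]] by (simp add: E_simps(5))
        ultimately show ?thesis by (auto simp: E_comp_def)
      qed
      show "c \<odot>\<^bsub>E\<^esub> f \<in> E_comp g" if c: "c \<in> carrier (R Quot J)" for c
        using E.smult_closed[OF c fE] val[OF f] s[OF _ c] by (simp add: E_comp_def E_simps(6))
      show "\<ominus>\<^bsub>E\<^esub> f \<in> E_comp g"
      proof -
        have "(\<ominus>\<^bsub>E\<^esub> f) h = \<zero>\<^bsub>D h\<^esub>" if h: "h \<in> carrier G" "h \<noteq> g" for h
        proof -
          have m: "(\<ominus>\<^bsub>E\<^esub> f) h \<in> carrier (D h)"
            by (rule E_val[OF E.a_inv_closed[OF fE] h(1)])
          have "(\<ominus>\<^bsub>E\<^esub> f \<oplus>\<^bsub>E\<^esub> f) h = \<zero>\<^bsub>D h\<^esub>"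
            using E.l_neg[OF fE] h by (simp add: E_simps(4))
          then show ?thesis
            using h val[OF f h] z[OF h(1) m] by (simp add: E_simps(5))
        qed
        then show ?thesis using E.a_inv_closed[OF fE] by (simp add: E_comp_def)
      qed
    qed
    fix k x y assume k: "k \<in> carrier G" and x: "x \<in> E_comp g" and y: "y \<in> E_comp k"
    \<comment> \<open>The product is computed with special representatives: an element of
      \<open>E_comp g\<close> has one that vanishes in \<open>A\<close> off \<open>g\<close>,
      whereas an arbitrary representative vanishes there only modulo \<open>N\<close>.\<close>
    obtain X where X: "X \<in> B_comp g" "x = comp_map X" using x comp_map_comp[OF g] by blast
    obtain f where f: "f \<in> S" "\<forall>h\<in>carrier G. h \<noteq> g \<longrightarrow> f h = \<zero>\<^bsub>A\<^esub>" "X = K +>\<^bsub>C\<^esub> f"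
      using X(1) unfolding B_comp_def by blast
    obtain Y where Y: "Y \<in> B_comp k" "y = comp_map Y" using y comp_map_comp[OF k] by blast
    obtain f' where f': "f' \<in> S" "\<forall>h\<in>carrier G. h \<noteq> k \<longrightarrow> f' h = \<zero>\<^bsub>A\<^esub>" "Y = K +>\<^bsub>C\<^esub> f'"
      using Y(1) unfolding B_comp_def by blast
    interpret S: assoc_algebra R "C\<lparr>carrier := S\<rparr>" by (rule S_assoc_algebra)
    have ff': "f \<otimes>\<^bsub>C\<^esub> f' \<in> S" using S.m_closed[of f f'] f(1) f'(1) by simp
    have fc: "f \<in> carrier C" "f' \<in> carrier C" using S_carrier f(1) f'(1) by auto
    have "(f \<otimes>\<^bsub>C\<^esub> f') h = \<zero>\<^bsub>A\<^esub>" if h: "h \<in> carrier G" "h \<noteq> g \<otimes>\<^bsub>G\<^esub> k" for h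
    proof -
      \<comment> \<open>A nonzero left factor forces \<open>t = g\<close>, a nonzero right factor
        forces \<open>t^-1 h = k\<close>, and together they give \<open>h = g k\<close>.\<close>
      have "f t \<otimes>\<^bsub>A\<^esub> f' (inv\<^bsub>G\<^esub> t \<otimes>\<^bsub>G\<^esub> h) = \<zero>\<^bsub>A\<^esub>" if t: "t \<in> carrier G" for t
      proof (cases "t = g")
        case True
        have "inv\<^bsub>G\<^esub> g \<otimes>\<^bsub>G\<^esub> h \<noteq> k"
        proof
          assume "inv\<^bsub>G\<^esub> g \<otimes>\<^bsub>G\<^esub> h = k"
          then have "g \<otimes>\<^bsub>G\<^esub> (inv\<^bsub>G\<^esub> g \<otimes>\<^bsub>G\<^esub> h) = g \<otimes>\<^bsub>G\<^esub> k" by simp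
          then show False using g h by (simp add: G.m_assoc[symmetric])
        qed
        then show ?thesis using True f'(2) g h conv_closed[OF fc(1) g] by simp
      next
        case False
        then show ?thesis using f(2) t h conv_closed[OF fc(2)] by simp
      qed
      then have "(\<Oplus>\<^bsub>A\<^esub>t\<in>carrier G. f t \<otimes>\<^bsub>A\<^esub> f' (inv\<^bsub>G\<^esub> t \<otimes>\<^bsub>G\<^esub> h)) = (\<Oplus>\<^bsub>A\<^esub>t\<in>carrier G. \<zero>\<^bsub>A\<^esub>)"
        by (intro finsum_cong') auto
      then show ?thesis unfolding conv_mult[OF fc h(1)] by simp
    qed
    then have "K +>\<^bsub>C\<^esub> (f \<otimes>\<^bsub>C\<^esub> f') \<in> B_comp (g \<otimes>\<^bsub>G\<^esub> k)"
      unfolding B_comp_def using ff' by blast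
    moreover have "(K +>\<^bsub>C\<^esub> f) \<otimes>\<^bsub>B\<^esub> (K +>\<^bsub>C\<^esub> f') = K +>\<^bsub>C\<^esub> (f \<otimes>\<^bsub>C\<^esub> f')"
      using residue_quotient.quot_mult[OF B_residue_quotient K_ideal, of f f'] f(1) f'(1) by simp
    ultimately have "comp_map (X \<otimes>\<^bsub>B\<^esub> Y) \<in> E_comp (g \<otimes>\<^bsub>G\<^esub> k)"
      using comp_map_comp[of "g \<otimes>\<^bsub>G\<^esub> k"] g k f(3) f'(3) by auto
    then show "x \<otimes>\<^bsub>E\<^esub> y \<in> E_comp (g \<otimes>\<^bsub>G\<^esub> k)"
      using comp_map_mult[OF f(1) f'(1)] X(2) Y(2) f(3) f'(3) by simp
  next
    fix x assume x: "x \<in> carrier E"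
    have fin: "finite {g \<in> carrier G. u g \<noteq> \<zero>\<^bsub>E\<^esub>}" for u using finite_group by simp
    \<comment> \<open>The part of degree \<open>g\<close> keeps the entry at \<open>g\<close> and
      has zero cosets elsewhere.\<close>
    let ?u = "\<lambda>g\<in>carrier G. \<lambda>h\<in>carrier G. if h = g then x g else \<zero>\<^bsub>D h\<^esub>"
    have Dz: "\<zero>\<^bsub>D h\<^esub> \<in> carrier (D h)" if "h \<in> carrier G" for h
      using D_abelian_monoid[OF that] by (rule abelian_monoid.zero_closed)
    show "\<exists>!f. f \<in> Pi\<^sub>E (carrier G) E_comp \<and> finite {g \<in> carrier G. f g \<noteq> \<zero>\<^bsub>E\<^esub>} \<and>
               x = (\<Oplus>\<^bsub>E\<^esub>g\<in>{g \<in> carrier G. f g \<noteq> \<zero>\<^bsub>E\<^esub>}. f g)"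
    proof (rule ex1I[of _ ?u])
      have u: "?u \<in> Pi\<^sub>E (carrier G) E_comp"
        unfolding restrict_PiE_iff E_comp_def E_simps(1) using E_val[OF x] Dz by simp
      have "x = (\<lambda>g\<in>carrier G. ?u g g)"
        by (rule extensionalityI[OF E_ext[OF x] restrict_extensional]) simp
      then show "?u \<in> Pi\<^sub>E (carrier G) E_comp \<and> finite {g \<in> carrier G. ?u g \<noteq> \<zero>\<^bsub>E\<^esub>} \<and>
               x = (\<Oplus>\<^bsub>E\<^esub>g\<in>{g \<in> carrier G. ?u g \<noteq> \<zero>\<^bsub>E\<^esub>}. ?u g)"
        unfolding E_comp_direct[OF u] using u fin by blast
    next
      fix v assume v: "v \<in> Pi\<^sub>E (carrier G) E_comp \<and> finite {g \<in> carrier G. v g \<noteq> \<zero>\<^bsub>E\<^esub>} \<and>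
               x = (\<Oplus>\<^bsub>E\<^esub>g\<in>{g \<in> carrier G. v g \<noteq> \<zero>\<^bsub>E\<^esub>}. v g)"
      then have vE: "v \<in> Pi\<^sub>E (carrier G) E_comp" by blast
      \<comment> \<open>The sum of a decomposition is its diagonal, so \<open>v g g\<close> must be
        \<open>x g\<close>; the other entries of \<open>v g\<close> vanish by homogeneity.\<close>
      have xv: "x = (\<lambda>g\<in>carrier G. v g g)" using v E_comp_direct[OF vE] by simp
      have "v g = ?u g" if g: "g \<in> carrier G" for g
      proof (rule extensionalityI[of _ "carrier G"])
        have vg: "v g \<in> E_comp g" by (rule PiE_mem[OF vE g])
        then show "v g \<in> extensional (carrier G)" by (intro E_ext) (simp add: E_comp_def)
        show "v g h = ?u g h" if "h \<in> carrier G" for h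
          using g that vg by (simp add: xv E_comp_def)
      qed (use g in simp)
      then show "v = ?u"
        using vE by (intro extensionalityI[OF _ restrict_extensional]) (simp_all add: PiE_def)
    qed
  qed
qed

theorem graded_iso:
  "graded_algebra (R Quot J) G B B_comp" (is ?B)
  "graded_algebra (R Quot J) G E E_comp" (is ?E)
  "comp_map \<in> graded_alg_iso (R Quot J) G B B_comp E E_comp" (is ?I)
proof -
  show ?E by (rule E_graded_algebra)
  show ?B
    by (rule graded_algebra_pullback[OF B_assoc_algebra E_graded_algebra comp_map_alg_hom comp_map_bij])
      (unfold B_comp_def B_carrier, blast, fold B_comp_def, rule comp_map_comp)
  show ?I
    by (simp add: graded_alg_iso_def comp_map_alg_hom comp_map_bij comp_map_comp)
qed

end


section \<open>The twisted action of P\<close>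

context group
begin

lemma Aut_simps:
  "carrier (Aut G) = auto G" "\<one>\<^bsub>Aut G\<^esub> = (\<lambda>u\<in>carrier G. u)"
  "\<phi> \<otimes>\<^bsub>Aut G\<^esub> \<psi> = \<psi> \<otimes>\<^bsub>AutoGroup G\<^esub> \<phi>"
  by (simp_all add: Aut_def AutoGroup_def BijGroup_def)

text \<open>\<open>Aut G\<close> is the opposite of \<open>AutoGroup G\<close>: the left inverse
  required here is a right inverse there.\<close>

lemma Aut_group: "group (Aut G)"
proof -
  interpret A: group "AutoGroup G" by (rule AutoGroup)
  have c: "carrier (AutoGroup G) = auto G" "\<one>\<^bsub>AutoGroup G\<^esub> = (\<lambda>u\<in>carrier G. u)"
    by (simp_all add: AutoGroup_def BijGroup_def)
  show ?thesis
  proof (rule groupI)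
    fix \<phi> assume "\<phi> \<in> carrier (Aut G)"
    then have "\<phi> \<in> carrier (AutoGroup G)" by (simp add: Aut_simps c)
    then show "\<exists>\<psi>\<in>carrier (Aut G). \<psi> \<otimes>\<^bsub>Aut G\<^esub> \<phi> = \<one>\<^bsub>Aut G\<^esub>"
      unfolding Aut_simps c[symmetric] using A.r_inv A.inv_closed by blast
  qed (simp_all add: Aut_simps c[symmetric] A.m_assoc del: c)
qed

lemma finite_Aut: "finite (carrier G) \<Longrightarrow> finite (carrier (Aut G))"
  by (rule finite_subset[OF _ finite_PiE, of _ "carrier G" "\<lambda>_. carrier G"])
    (auto simp: Aut_simps auto_def hom_def Bij_def PiE_def)

lemma Aut_one_apply: "u \<in> carrier G \<Longrightarrow> \<one>\<^bsub>Aut G\<^esub> u = u"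
  by (simp add: Aut_simps)

lemma Aut_mult_apply:
  "\<lbrakk>\<phi> \<in> carrier (Aut G); \<psi> \<in> carrier (Aut G); u \<in> carrier G\<rbrakk> \<Longrightarrow> (\<phi> \<otimes>\<^bsub>Aut G\<^esub> \<psi>) u = \<psi> (\<phi> u)"
  by (simp add: Aut_simps AutoGroup_def BijGroup_def auto_def compose_def)

lemma Aut_group_hom: "\<phi> \<in> carrier (Aut G) \<Longrightarrow> group_hom G G \<phi>"
  by (simp add: Aut_simps auto_def group_hom_def group_hom_axioms_def is_group)

lemma Aut_bij: "\<phi> \<in> carrier (Aut G) \<Longrightarrow> bij_betw \<phi> (carrier G) (carrier G)"
  by (simp add: Aut_simps auto_def Bij_def)

lemma coset_rep_mem:
  assumes "subgroup Q G" "X \<in> rcosets Q"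
  shows "coset_rep X \<in> carrier G" "Q #> coset_rep X = X"
proof -
  obtain u where u: "u \<in> carrier G" "X = Q #> u" using assms(2) by (auto simp: RCOSETS_def)
  then have "u \<in> X" using assms(1) by (simp add: rcos_self)
  then have "coset_rep X \<in> X" unfolding coset_rep_def by (rule someI)
  then show "coset_rep X \<in> carrier G" "Q #> coset_rep X = X"
    using u assms(1) repr_independence[of "coset_rep X" Q u] subgroup.elemrcos_carrier[OF assms(1) is_group]
    by auto
qed

end

text \<open>Memberships in the kernels are checked on generators in this way; \<open>h\<close> will
  be multiplication by a fixed element, evaluation at an automorphism, or the embedding of
  \<open>A\<close> as one component.\<close>

lemma generate_hom_mem:
  assumes "abelian_group A" "abelian_group B" "h \<in> carrier A \<rightarrow> carrier B"
    and add: "\<And>x y. \<lbrakk>x \<in> carrier A; y \<in> carrier A\<rbrakk> \<Longrightarrow> h (x \<oplus>\<^bsub>A\<^esub> y) = h x \<oplus>\<^bsub>B\<^esub> h y"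
    and H: "subgroup H (add_monoid B)" and X: "X \<subseteq> carrier A" and hX: "\<And>x. x \<in> X \<Longrightarrow> h x \<in> H"
    and x: "x \<in> generate (add_monoid A) X"
  shows "h x \<in> H"
proof -
  interpret h: abelian_group_hom A B h
    by (intro abelian_group_homI group_hom.intro group_hom_axioms.intro homI assms(1,2)
        abelian_group.a_group) (use assms(3,4) in auto)
  have "additive_subgroup H B" using H by (rule additive_subgroup.intro)
  then interpret H: additive_subgroup H B .
  show ?thesis
    using x
  proof (induction rule: generate.induct)
    case (inv y)
    then have "h (\<ominus>\<^bsub>A\<^esub> y) \<in> H" using X hX by auto
    then show ?case by (simp add: a_inv_def)
  next
    case (eng y z)
    have "y \<in> carrier A" "z \<in> carrier A"
      using eng(1,2) h.G.add.generate_in_carrier[of X] X by auto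
    then show ?case using eng by simp
  qed (use hX in auto)
qed

text \<open>The kernels are defined as a sum of two generated subgroups, one for the traces and one
  for the multiples by \<open>J\<close>. With a single generating set one induction treats
  both.\<close>

lemma (in abelian_group) set_add_generate:
  assumes "X \<subseteq> carrier G" "Y \<subseteq> carrier G"
  shows "generate (add_monoid G) X <+> generate (add_monoid G) Y = generate (add_monoid G) (X \<union> Y)"
proof
  have XY: "X \<union> Y \<subseteq> carrier G" using assms by blast
  note sub = add.generate_is_subgroup
  show "generate (add_monoid G) X <+> generate (add_monoid G) Y \<subseteq> generate (add_monoid G) (X \<union> Y)"
    using add.mono_generate[of X "X \<union> Y"] add.mono_generate[of Y "X \<union> Y"]
      subgroup.m_closed[OF sub[OF XY]] by (fastforce simp: set_add_def')
  have "subgroup (generate (add_monoid G) X <+> generate (add_monoid G) Y) (add_monoid G)"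
    using add_additive_subgroups[of "generate (add_monoid G) X" "generate (add_monoid G) Y"]
      sub assms by (simp add: additive_subgroup_def)
  moreover have "X \<union> Y \<subseteq> generate (add_monoid G) X <+> generate (add_monoid G) Y"
  proof -
    have zero: "\<zero> \<in> generate (add_monoid G) Z" for Z
      using generate.one[of "add_monoid G" Z] by simp
    have "x \<oplus> \<zero> \<in> generate (add_monoid G) X <+> generate (add_monoid G) Y" if "x \<in> X" for x
      using generate.incl[OF that] zero by (auto simp: set_add_def')
    moreover have "\<zero> \<oplus> y \<in> generate (add_monoid G) X <+> generate (add_monoid G) Y" if "y \<in> Y" for y
      using generate.incl[OF that] zero by (auto simp: set_add_def')
    ultimately show ?thesis using assms by fastforce
  qed
  ultimately show "generate (add_monoid G) (X \<union> Y)
      \<subseteq> generate (add_monoid G) X <+> generate (add_monoid G) Y"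
    by (metis add.generateI add.generate_subgroup_incl)
qed

section \<open>The action of \<open>P\<close> on the component at one automorphism\<close>

locale finite_interior_algebra = assoc_algebra R A + P: group P + J: ideal J R
    for R (structure) and A (structure) and P (structure) and J +
  fixes \<sigma>
  assumes structure_map: "\<sigma> \<in> alg_hom R (group_algebra R P) A"
    and finite_P: "finite (carrier P)"
begin

abbreviation e where "e u \<equiv> \<sigma> (group_elem R P u)"

text \<open>The action of \<open>u\<close> on the component at \<open>\<phi>\<close>. In these terms
  twisted fixed points and twisted traces are ordinary fixed points and traces of an action.\<close>

definition twist where "twist \<phi> u a = e (inv\<^bsub>P\<^esub> u) \<otimes>\<^bsub>A\<^esub> a \<otimes>\<^bsub>A\<^esub> e (\<phi> u)"

abbreviation tfix where "tfix \<phi> Q \<equiv> twisted_fixed R P A \<sigma> \<phi> Q"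
abbreviation tr where "tr \<phi> Q c \<equiv> twisted_trace R P A \<sigma> \<phi> Q c"
abbreviation ker where "ker \<phi> \<equiv> twisted_kernel R J P A \<sigma> \<phi>"

lemma group_elem_closed: "group_elem R P u \<in> carrier (group_algebra R P)"
  by (auto simp: group_elem_def group_algebra_def)

lemma e_closed [simp]: "e u \<in> carrier A"
  using structure_map group_elem_closed by (auto simp: alg_hom_def ring_hom_def)

text \<open>Group elements are delta functions, so only the term \<open>y = u\<close> of the
  convolution survives.\<close>

lemma group_elem_mult:
  assumes u: "u \<in> carrier P" and v: "v \<in> carrier P"
  shows "group_elem R P u \<otimes>\<^bsub>group_algebra R P\<^esub> group_elem R P v = group_elem R P (u \<otimes>\<^bsub>P\<^esub> v)"
proof (rule extensionalityI[of _ "carrier P"])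
  fix x assume x: "x \<in> carrier P"
  have "(group_elem R P u \<otimes>\<^bsub>group_algebra R P\<^esub> group_elem R P v) x
      = convolution R P (group_elem R P u) (group_elem R P v) x"
    by (simp add: group_algebra_def)
  also have "\<dots> = (\<Oplus>y\<in>carrier P. group_elem R P u y \<otimes> group_elem R P v (inv\<^bsub>P\<^esub> y \<otimes>\<^bsub>P\<^esub> x))"
    by (rule convolution_eq_finsum[OF P.is_group R.ring_axioms]) (auto simp: group_elem_def x)
  also have "\<dots> = group_elem R P u u \<otimes> group_elem R P v (inv\<^bsub>P\<^esub> u \<otimes>\<^bsub>P\<^esub> x)"
    using u x finite_P by (intro R.finsum_single) (auto simp: group_elem_def)
  also have "\<dots> = group_elem R P (u \<otimes>\<^bsub>P\<^esub> v) x"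
    using u v x P.inv_solve_left[of v u x] by (auto simp: group_elem_def)
  finally show "(group_elem R P u \<otimes>\<^bsub>group_algebra R P\<^esub> group_elem R P v) x
      = group_elem R P (u \<otimes>\<^bsub>P\<^esub> v) x" .
qed (auto simp: group_algebra_def convolution_def group_elem_def)

lemma e_mult: "\<lbrakk>u \<in> carrier P; v \<in> carrier P\<rbrakk> \<Longrightarrow> e u \<otimes>\<^bsub>A\<^esub> e v = e (u \<otimes>\<^bsub>P\<^esub> v)"
  using structure_map group_elem_closed ring_hom_mult[of \<sigma> "group_algebra R P" A]
  by (auto simp: alg_hom_def group_elem_mult[symmetric])

lemma e_one: "e \<one>\<^bsub>P\<^esub> = \<one>\<^bsub>A\<^esub>"
proof -
  have "group_elem R P \<one>\<^bsub>P\<^esub> = \<one>\<^bsub>group_algebra R P\<^esub>"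
    by (simp add: group_elem_def group_algebra_def)
  then show ?thesis
    using structure_map ring_hom_one[of \<sigma> "group_algebra R P" A] by (simp add: alg_hom_def)
qed

lemma e_mult_left:
  "\<lbrakk>u \<in> carrier P; v \<in> carrier P; a \<in> carrier A\<rbrakk> \<Longrightarrow> e u \<otimes>\<^bsub>A\<^esub> (e v \<otimes>\<^bsub>A\<^esub> a) = e (u \<otimes>\<^bsub>P\<^esub> v) \<otimes>\<^bsub>A\<^esub> a"
  by (simp add: e_mult[symmetric] m_assoc)

lemma fix_iff: "a \<in> tfix \<phi> Q \<longleftrightarrow> a \<in> carrier A \<and> (\<forall>u\<in>Q. e u \<otimes>\<^bsub>A\<^esub> a = a \<otimes>\<^bsub>A\<^esub> e (\<phi> u))"
  by (auto simp: twisted_fixed_def Delta_def lact_def ract_def)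

lemma twist_closed: "a \<in> carrier A \<Longrightarrow> twist \<phi> u a \<in> carrier A"
  by (simp add: twist_def)

text \<open>Multiplying from the left by the image of \<open>u\<close> or of its inverse passes
  between invariance and the commutation rule.\<close>

lemma twist_eq_iff:
  assumes u: "u \<in> carrier P" and a: "a \<in> carrier A"
  shows "twist \<phi> u a = a \<longleftrightarrow> e u \<otimes>\<^bsub>A\<^esub> a = a \<otimes>\<^bsub>A\<^esub> e (\<phi> u)"
proof
  assume "twist \<phi> u a = a"
  then have "e u \<otimes>\<^bsub>A\<^esub> a = e u \<otimes>\<^bsub>A\<^esub> (e (inv\<^bsub>P\<^esub> u) \<otimes>\<^bsub>A\<^esub> (a \<otimes>\<^bsub>A\<^esub> e (\<phi> u)))"
    using a by (simp add: twist_def m_assoc)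
  then show "e u \<otimes>\<^bsub>A\<^esub> a = a \<otimes>\<^bsub>A\<^esub> e (\<phi> u)"
    using u a by (simp add: e_mult_left e_one)
next
  assume "e u \<otimes>\<^bsub>A\<^esub> a = a \<otimes>\<^bsub>A\<^esub> e (\<phi> u)"
  then have "twist \<phi> u a = e (inv\<^bsub>P\<^esub> u) \<otimes>\<^bsub>A\<^esub> (e u \<otimes>\<^bsub>A\<^esub> a)"
    using a by (simp add: twist_def m_assoc)
  then show "twist \<phi> u a = a" using u a by (simp add: e_mult_left e_one)
qed

lemma fix_iff_twist:
  "Q \<subseteq> carrier P \<Longrightarrow> a \<in> tfix \<phi> Q \<longleftrightarrow> a \<in> carrier A \<and> (\<forall>u\<in>Q. twist \<phi> u a = a)"
  unfolding fix_iff using twist_eq_iff by blast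

text \<open>A right action: inversion reverses the product on the left of \<open>a\<close>, while
  \<open>\<phi>\<close> preserves it on the right.\<close>

lemma twist_mult:
  assumes \<phi>: "\<phi> \<in> carrier (Aut P)" and u: "u \<in> carrier P" and v: "v \<in> carrier P" and a: "a \<in> carrier A"
  shows "twist \<phi> (u \<otimes>\<^bsub>P\<^esub> v) a = twist \<phi> v (twist \<phi> u a)"
proof -
  interpret \<phi>: group_hom P P \<phi> by (rule P.Aut_group_hom[OF \<phi>])
  show ?thesis
    using u v a by (simp add: twist_def m_assoc e_mult e_mult_left P.inv_mult_group)
qed

lemma twist_add:
  "\<lbrakk>a \<in> carrier A; b \<in> carrier A\<rbrakk> \<Longrightarrow> twist \<phi> u (a \<oplus>\<^bsub>A\<^esub> b) = twist \<phi> u a \<oplus>\<^bsub>A\<^esub> twist \<phi> u b"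
  by (simp add: twist_def l_distr r_distr)

lemma twist_zero: "twist \<phi> u \<zero>\<^bsub>A\<^esub> = \<zero>\<^bsub>A\<^esub>"
  by (simp add: twist_def)

lemma twist_smult:
  "\<lbrakk>r \<in> carrier R; a \<in> carrier A\<rbrakk> \<Longrightarrow> twist \<phi> u (r \<odot>\<^bsub>A\<^esub> a) = r \<odot>\<^bsub>A\<^esub> twist \<phi> u a"
  by (simp add: twist_def smult_mult_left smult_mult_right)

lemma fix_submodule: "submodule (tfix \<phi> Q) R A"
  by (rule submoduleI)
    (auto simp: fix_iff l_minus r_minus l_distr r_distr smult_mult_left smult_mult_right)

text \<open>An element \<open>u\<close> of \<open>Q\<close> moves past \<open>a\<close> as
  \<open>\<phi>(u)\<close> and then past \<open>b\<close> as \<open>\<psi>(\<phi>(u))\<close>, which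
  is why the grading group applies \<open>\<phi>\<close> first. Asking only for invariance of
  \<open>b\<close> under \<open>\<phi>(Q)\<close> makes the statement fit the arguments of traces as
  well.\<close>

lemma fix_mult:
  assumes Q: "Q \<subseteq> carrier P" and "\<phi> \<in> carrier (Aut P)" "\<psi> \<in> carrier (Aut P)"
    and a: "a \<in> tfix \<phi> Q" and b: "b \<in> tfix \<psi> (\<phi> ` Q)"
  shows "a \<otimes>\<^bsub>A\<^esub> b \<in> tfix (\<phi> \<otimes>\<^bsub>Aut P\<^esub> \<psi>) Q"
proof -
  have c: "a \<in> carrier A" "b \<in> carrier A" using a b by (auto simp: fix_iff)
  have "e u \<otimes>\<^bsub>A\<^esub> (a \<otimes>\<^bsub>A\<^esub> b) = a \<otimes>\<^bsub>A\<^esub> b \<otimes>\<^bsub>A\<^esub> e ((\<phi> \<otimes>\<^bsub>Aut P\<^esub> \<psi>) u)" if u: "u \<in> Q" for u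
  proof -
    have "e u \<otimes>\<^bsub>A\<^esub> (a \<otimes>\<^bsub>A\<^esub> b) = (e u \<otimes>\<^bsub>A\<^esub> a) \<otimes>\<^bsub>A\<^esub> b" using c by (simp add: m_assoc)
    also have "\<dots> = a \<otimes>\<^bsub>A\<^esub> (e (\<phi> u) \<otimes>\<^bsub>A\<^esub> b)" using a u c by (simp add: fix_iff m_assoc)
    also have "\<dots> = a \<otimes>\<^bsub>A\<^esub> (b \<otimes>\<^bsub>A\<^esub> e (\<psi> (\<phi> u)))" using b u by (simp add: fix_iff)
    finally show ?thesis using assms(1-3) u c by (auto simp: m_assoc P.Aut_mult_apply)
  qed
  then show ?thesis using c by (simp add: fix_iff)
qed

lemma fix_antimono: "Q \<subseteq> Q' \<Longrightarrow> a \<in> tfix \<phi> Q' \<Longrightarrow> a \<in> tfix \<phi> Q"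
  by (auto simp: fix_iff)

lemma Aut_image_subset: "\<phi> \<in> carrier (Aut P) \<Longrightarrow> Q \<subseteq> carrier P \<Longrightarrow> \<phi> ` Q \<subseteq> carrier P"
  using P.Aut_bij by (auto simp: bij_betw_def)

section \<open>Twisted relative traces and their products with fixed elements\<close>

lemma tr_def': "tr \<phi> Q c = (\<Oplus>\<^bsub>A\<^esub>X\<in>rcosets\<^bsub>P\<^esub> Q. twist \<phi> (coset_rep X) c)"
  by (simp add: twisted_trace_def twist_def lact_def ract_def)

text \<open>As \<open>c\<close> is invariant under \<open>Q\<close>, a summand of the trace depends
  only on the coset, and the arbitrary choice in \<open>coset_rep\<close> does not matter.\<close>

lemma twist_coset_rep:
  assumes \<phi>: "\<phi> \<in> carrier (Aut P)" and Q: "subgroup Q P" and c: "c \<in> tfix \<phi> Q" and u: "u \<in> carrier P"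
  shows "twist \<phi> (coset_rep (Q #>\<^bsub>P\<^esub> u)) c = twist \<phi> u c"
proof -
  interpret Q: subgroup Q P by fact
  have Qu: "Q #>\<^bsub>P\<^esub> u \<in> rcosets\<^bsub>P\<^esub> Q" using u Q.subset by (rule P.rcosetsI[rotated])
  note rep = P.coset_rep_mem[OF Q Qu]
  have "coset_rep (Q #>\<^bsub>P\<^esub> u) \<in> Q #>\<^bsub>P\<^esub> u"
    using P.rcos_self[OF rep(1) Q] rep(2) by simp
  then obtain q where q: "q \<in> Q" "coset_rep (Q #>\<^bsub>P\<^esub> u) = q \<otimes>\<^bsub>P\<^esub> u" by (auto simp: r_coset_def)
  have "twist \<phi> q c = c" "c \<in> carrier A" using c q(1) fix_iff_twist[OF Q.subset] by auto
  then show ?thesis using q u by (simp add: twist_mult[OF \<phi>])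
qed

text \<open>Admits other representatives than the selected ones: in \<open>tr_mult_left\<close> they
  arise as images under an automorphism, which \<open>coset_rep\<close> need not respect.\<close>

lemma tr_eq_finsum:
  assumes \<phi>: "\<phi> \<in> carrier (Aut P)" and Q: "subgroup Q P" and c: "c \<in> tfix \<phi> Q"
    and g: "\<And>u. u \<in> carrier P \<Longrightarrow> g (Q #>\<^bsub>P\<^esub> u) = twist \<phi> u c"
  shows "tr \<phi> Q c = (\<Oplus>\<^bsub>A\<^esub>X\<in>rcosets\<^bsub>P\<^esub> Q. g X)"
  unfolding tr_def'
proof (rule finsum_cong'[OF refl])
  have cA: "c \<in> carrier A" using c by (simp add: fix_iff)
  show eq: "twist \<phi> (coset_rep X) c = g X" if "X \<in> rcosets\<^bsub>P\<^esub> Q" for X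
    using g[OF P.coset_rep_mem(1)[OF Q that]] P.coset_rep_mem(2)[OF Q that] by simp
  show "g \<in> rcosets\<^bsub>P\<^esub> Q \<rightarrow> carrier A"
    using eq[symmetric] twist_closed[OF cA] by simp
qed

lemma tr_closed:
  assumes "c \<in> carrier A"
  shows "tr \<phi> Q c \<in> carrier A"
  unfolding tr_def' by (rule finsum_closed) (simp add: twist_closed assms)

lemma tr_hom:
  assumes "h \<in> carrier A \<rightarrow> carrier A" "h \<zero>\<^bsub>A\<^esub> = \<zero>\<^bsub>A\<^esub>"
    and "\<And>x y. \<lbrakk>x \<in> carrier A; y \<in> carrier A\<rbrakk> \<Longrightarrow> h (x \<oplus>\<^bsub>A\<^esub> y) = h x \<oplus>\<^bsub>A\<^esub> h y" "c \<in> carrier A"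
  shows "h (tr \<phi> Q c) = (\<Oplus>\<^bsub>A\<^esub>X\<in>rcosets\<^bsub>P\<^esub> Q. h (twist \<phi> (coset_rep X) c))"
  unfolding tr_def'
  by (rule finsum_hom) (use assms in \<open>auto intro: abelian_monoid_axioms twist_closed\<close>)

text \<open>Applying \<open>v\<close> only permutes the summands of a trace, since right
  multiplication by \<open>v\<close> permutes the cosets \<open>Qu\<close>.\<close>

lemma tr_fix:
  assumes \<phi>: "\<phi> \<in> carrier (Aut P)" and Q: "subgroup Q P" and c: "c \<in> tfix \<phi> Q"
  shows "tr \<phi> Q c \<in> tfix \<phi> (carrier P)"
proof -
  have cA: "c \<in> carrier A" using c by (simp add: fix_iff)
  have QP: "Q \<subseteq> carrier P" using Q by (rule subgroup.subset)
  have "twist \<phi> v (tr \<phi> Q c) = tr \<phi> Q c" if v: "v \<in> carrier P" for v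
  proof -
    let ?g = "\<lambda>X. twist \<phi> (coset_rep X) c"
    have "twist \<phi> v (tr \<phi> Q c) = (\<Oplus>\<^bsub>A\<^esub>X\<in>rcosets\<^bsub>P\<^esub> Q. twist \<phi> v (?g X))"
      by (rule tr_hom) (auto simp: twist_closed twist_zero twist_add cA)
    also have "\<dots> = (\<Oplus>\<^bsub>A\<^esub>X\<in>rcosets\<^bsub>P\<^esub> Q. ?g (X #>\<^bsub>P\<^esub> v))"
    proof (rule finsum_cong'[OF refl])
      fix X assume X: "X \<in> rcosets\<^bsub>P\<^esub> Q"
      note rep = P.coset_rep_mem[OF Q X]
      have "?g (Q #>\<^bsub>P\<^esub> (coset_rep X \<otimes>\<^bsub>P\<^esub> v)) = twist \<phi> v (?g X)"
        using twist_coset_rep[OF \<phi> Q c] twist_mult[OF \<phi> rep(1) v cA] rep(1) v by simp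
      moreover have "Q #>\<^bsub>P\<^esub> (coset_rep X \<otimes>\<^bsub>P\<^esub> v) = X #>\<^bsub>P\<^esub> v"
        using P.coset_mult_assoc[OF QP rep(1) v] rep(2) by simp
      ultimately show "twist \<phi> v (?g X) = ?g (X #>\<^bsub>P\<^esub> v)" by simp
    qed (simp add: twist_closed cA)
    also have "\<dots> = (\<Oplus>\<^bsub>A\<^esub>X\<in>(\<lambda>X. X #>\<^bsub>P\<^esub> v) ` (rcosets\<^bsub>P\<^esub> Q). ?g X)"
    proof (rule finsum_reindex[symmetric])
      have XP: "X \<subseteq> carrier P" if "X \<in> rcosets\<^bsub>P\<^esub> Q" for X
        using that P.rcosets_part_G[OF Q] by blast
      show "inj_on (\<lambda>X. X #>\<^bsub>P\<^esub> v) (rcosets\<^bsub>P\<^esub> Q)"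
      proof (rule inj_on_inverseI[of _ "\<lambda>X. X #>\<^bsub>P\<^esub> inv\<^bsub>P\<^esub> v"])
        fix X assume "X \<in> rcosets\<^bsub>P\<^esub> Q"
        then show "X #>\<^bsub>P\<^esub> v #>\<^bsub>P\<^esub> inv\<^bsub>P\<^esub> v = X"
          using v XP by (simp add: P.coset_mult_assoc)
      qed
    qed (simp add: twist_closed cA)
    also have "(\<lambda>X. X #>\<^bsub>P\<^esub> v) ` (rcosets\<^bsub>P\<^esub> Q) = rcosets\<^bsub>P\<^esub> Q"
    proof (intro equalityI subsetI)
      fix X assume "X \<in> (\<lambda>X. X #>\<^bsub>P\<^esub> v) ` (rcosets\<^bsub>P\<^esub> Q)"
      then obtain u where "u \<in> carrier P" "X = Q #>\<^bsub>P\<^esub> u #>\<^bsub>P\<^esub> v" by (auto simp: RCOSETS_def)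
      then show "X \<in> rcosets\<^bsub>P\<^esub> Q" using v QP by (simp add: P.coset_mult_assoc P.rcosetsI)
    next
      fix X assume "X \<in> rcosets\<^bsub>P\<^esub> Q"
      then obtain u where u: "u \<in> carrier P" "X = Q #>\<^bsub>P\<^esub> u" by (auto simp: RCOSETS_def)
      then have "X = (Q #>\<^bsub>P\<^esub> (u \<otimes>\<^bsub>P\<^esub> inv\<^bsub>P\<^esub> v)) #>\<^bsub>P\<^esub> v"
        using v QP by (simp add: P.coset_mult_assoc P.m_assoc)
      moreover have "Q #>\<^bsub>P\<^esub> (u \<otimes>\<^bsub>P\<^esub> inv\<^bsub>P\<^esub> v) \<in> rcosets\<^bsub>P\<^esub> Q"
        using u v QP by (intro P.rcosetsI) auto
      ultimately show "X \<in> (\<lambda>X. X #>\<^bsub>P\<^esub> v) ` (rcosets\<^bsub>P\<^esub> Q)" by blast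
    qed
    finally show ?thesis by (simp add: tr_def')
  qed
  then show ?thesis
    unfolding fix_iff_twist[OF order_refl] using tr_closed[OF cA] by blast
qed

text \<open>\<open>b\<close> is absorbed term by term, because it commutes, up to applying
  \<open>\<psi>\<close>, with \<open>\<phi>(u)\<close> for every \<open>u\<close> in
  \<open>P\<close>. On this side the subgroup does not change.\<close>

lemma tr_mult_right:
  assumes \<phi>: "\<phi> \<in> carrier (Aut P)" and \<psi>: "\<psi> \<in> carrier (Aut P)" and Q: "subgroup Q P"
    and c: "c \<in> tfix \<phi> Q" and b: "b \<in> tfix \<psi> (carrier P)"
  shows "tr \<phi> Q c \<otimes>\<^bsub>A\<^esub> b = tr (\<phi> \<otimes>\<^bsub>Aut P\<^esub> \<psi>) Q (c \<otimes>\<^bsub>A\<^esub> b)"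
proof -
  have cb: "c \<in> carrier A" "b \<in> carrier A" using c b by (auto simp: fix_iff)
  have "tr \<phi> Q c \<otimes>\<^bsub>A\<^esub> b = (\<Oplus>\<^bsub>A\<^esub>X\<in>rcosets\<^bsub>P\<^esub> Q. twist \<phi> (coset_rep X) c \<otimes>\<^bsub>A\<^esub> b)"
    by (rule tr_hom[of "\<lambda>x. x \<otimes>\<^bsub>A\<^esub> b"]) (auto simp: cb l_distr)
  also have "\<dots> = tr (\<phi> \<otimes>\<^bsub>Aut P\<^esub> \<psi>) Q (c \<otimes>\<^bsub>A\<^esub> b)"
    unfolding tr_def'
  proof (rule finsum_cong'[OF refl])
    fix X assume X: "X \<in> rcosets\<^bsub>P\<^esub> Q"
    define u where "u = coset_rep X"
    have u: "u \<in> carrier P" using P.coset_rep_mem[OF Q X] by (simp add: u_def)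
    have \<phi>u: "\<phi> u \<in> carrier P" using P.Aut_bij[OF \<phi>] u by (auto simp: bij_betw_def)
    have "e (\<phi> u) \<otimes>\<^bsub>A\<^esub> b = b \<otimes>\<^bsub>A\<^esub> e (\<psi> (\<phi> u))" using b \<phi>u by (simp add: fix_iff)
    then show "twist \<phi> (coset_rep X) c \<otimes>\<^bsub>A\<^esub> b = twist (\<phi> \<otimes>\<^bsub>Aut P\<^esub> \<psi>) (coset_rep X) (c \<otimes>\<^bsub>A\<^esub> b)"
      unfolding u_def[symmetric] twist_def P.Aut_mult_apply[OF \<phi> \<psi> u] using cb by (simp add: m_assoc)
  qed (simp add: twist_closed cb)
  finally show ?thesis .
qed

text \<open>Surjectivity of \<open>\<phi>\<close> keeps the preimage proper: an element outside
  \<open>Q\<close> is the image of some element, which then lies outside the preimage.\<close>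

lemma preimage_subgroup:
  assumes \<phi>: "\<phi> \<in> carrier (Aut P)" and Q: "Q \<in> proper_subgroups P"
  shows "{u \<in> carrier P. \<phi> u \<in> Q} \<in> proper_subgroups P"
proof -
  interpret \<phi>: group_hom P P \<phi> by (rule P.Aut_group_hom[OF \<phi>])
  have Q': "subgroup Q P" "Q \<subset> carrier P" using Q by (auto simp: proper_subgroups_def)
  interpret Q: subgroup Q P by (rule Q'(1))
  obtain v where v: "v \<in> carrier P" "v \<notin> Q" using Q'(2) by blast
  have "v \<in> \<phi> ` carrier P" using P.Aut_bij[OF \<phi>] v(1) by (simp add: bij_betw_def)
  then obtain u where "u \<in> carrier P" "\<phi> u = v" by blast
  then have "u \<in> carrier P - {u \<in> carrier P. \<phi> u \<in> Q}" using v by simp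
  moreover have "subgroup {u \<in> carrier P. \<phi> u \<in> Q} P"
    by (rule P.subgroupI) auto
  ultimately show ?thesis by (auto simp: proper_subgroups_def)
qed

text \<open>From the left, invariance of \<open>a\<close> only concerns elements written as
  \<open>\<phi>(u)\<close>. So the cosets of \<open>Q\<close> are written as images of the cosets
  \<open>Q'u\<close>, and \<open>a\<close> exchanges the factor \<open>\<phi>(u)^-1\<close> on its
  right for \<open>u^-1\<close> on its left.\<close>

lemma tr_mult_left:
  assumes \<phi>: "\<phi> \<in> carrier (Aut P)" and \<psi>: "\<psi> \<in> carrier (Aut P)" and Q: "Q \<in> proper_subgroups P"
    and a: "a \<in> tfix \<phi> (carrier P)" and c: "c \<in> tfix \<psi> Q"
  defines "Q' \<equiv> {u \<in> carrier P. \<phi> u \<in> Q}"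
  shows "a \<otimes>\<^bsub>A\<^esub> c \<in> tfix (\<phi> \<otimes>\<^bsub>Aut P\<^esub> \<psi>) Q'" (is ?mem)
    and "a \<otimes>\<^bsub>A\<^esub> tr \<psi> Q c = tr (\<phi> \<otimes>\<^bsub>Aut P\<^esub> \<psi>) Q' (a \<otimes>\<^bsub>A\<^esub> c)" (is ?tr)
proof -
  interpret \<phi>: group_hom P P \<phi> by (rule P.Aut_group_hom[OF \<phi>])
  interpret Aut: group "Aut P" by (rule P.Aut_group)
  have Qs: "subgroup Q P" using Q by (simp add: proper_subgroups_def)
  have Q's: "subgroup Q' P" using preimage_subgroup[OF \<phi> Q] by (simp add: proper_subgroups_def Q'_def)
  have QP: "Q \<subseteq> carrier P" and Q'P: "Q' \<subseteq> carrier P" using Qs Q's subgroup.subset by auto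
  have ac: "a \<in> carrier A" "c \<in> carrier A" using a c by (auto simp: fix_iff)
  have bij: "bij_betw \<phi> (carrier P) (carrier P)" by (rule P.Aut_bij[OF \<phi>])
  have im: "\<phi> ` Q' = Q"
  proof
    show "\<phi> ` Q' \<subseteq> Q" by (auto simp: Q'_def)
    show "Q \<subseteq> \<phi> ` Q'"
    proof
      fix q assume q: "q \<in> Q"
      then have "q \<in> \<phi> ` carrier P" using bij QP by (auto simp: bij_betw_def)
      then show "q \<in> \<phi> ` Q'" using q unfolding Q'_def by blast
    qed
  qed
  show ?mem
  proof (rule fix_mult[OF Q'P \<phi> \<psi>])
    show "a \<in> tfix \<phi> Q'" by (rule fix_antimono[OF Q'P a])
    show "c \<in> tfix \<psi> (\<phi> ` Q')" unfolding im by (rule c)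
  qed
  let ?g = "\<lambda>X. a \<otimes>\<^bsub>A\<^esub> twist \<psi> (coset_rep X) c"
  have coset_im: "\<phi> ` (Q' #>\<^bsub>P\<^esub> u) = Q #>\<^bsub>P\<^esub> \<phi> u" if u: "u \<in> carrier P" for u
  proof -
    have "\<phi> (q \<otimes>\<^bsub>P\<^esub> u) = \<phi> q \<otimes>\<^bsub>P\<^esub> \<phi> u" if "q \<in> Q'" for q
      using that u Q'P by (intro \<phi>.hom_mult) auto
    then show ?thesis
      unfolding im[symmetric] r_coset_def UNION_singleton_eq_range image_image by (rule image_cong[OF refl])
  qed
  have "a \<otimes>\<^bsub>A\<^esub> tr \<psi> Q c = (\<Oplus>\<^bsub>A\<^esub>X\<in>rcosets\<^bsub>P\<^esub> Q. ?g X)"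
    by (rule tr_hom[of "\<lambda>x. a \<otimes>\<^bsub>A\<^esub> x"]) (auto simp: ac r_distr)
  \<comment> \<open>The image of \<open>Q'u\<close> is \<open>Q\<phi>(u)\<close>, and
    \<open>\<phi>(u)\<close> runs through all of \<open>P\<close>.\<close>
  also have "rcosets\<^bsub>P\<^esub> Q = (\<lambda>Y. \<phi> ` Y) ` (rcosets\<^bsub>P\<^esub> Q')"
  proof -
    have "(\<lambda>Y. \<phi> ` Y) ` (rcosets\<^bsub>P\<^esub> Q') = (\<lambda>u. Q #>\<^bsub>P\<^esub> \<phi> u) ` carrier P"
      unfolding RCOSETS_def by (auto simp: coset_im image_iff)
    also have "\<dots> = (\<lambda>u. Q #>\<^bsub>P\<^esub> u) ` (\<phi> ` carrier P)" by (simp add: image_image)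
    also have "\<dots> = rcosets\<^bsub>P\<^esub> Q" using bij by (auto simp: bij_betw_def RCOSETS_def)
    finally show ?thesis by simp
  qed
  also have "(\<Oplus>\<^bsub>A\<^esub>X\<in>(\<lambda>Y. \<phi> ` Y) ` (rcosets\<^bsub>P\<^esub> Q'). ?g X) = (\<Oplus>\<^bsub>A\<^esub>Y\<in>rcosets\<^bsub>P\<^esub> Q'. ?g (\<phi> ` Y))"
  proof (rule finsum_reindex)
    have "rcosets\<^bsub>P\<^esub> Q' \<subseteq> Pow (carrier P)" using P.rcosets_part_G[OF Q's] by blast
    then show "inj_on (\<lambda>Y. \<phi> ` Y) (rcosets\<^bsub>P\<^esub> Q')"
      by (rule inj_on_subset[OF inj_on_image_Pow[OF bij_betw_imp_inj_on[OF bij]]])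
  qed (simp add: ac twist_closed)
  also have "\<dots> = tr (\<phi> \<otimes>\<^bsub>Aut P\<^esub> \<psi>) Q' (a \<otimes>\<^bsub>A\<^esub> c)"
  proof (rule tr_eq_finsum[symmetric, OF Aut.m_closed[OF \<phi> \<psi>] Q's \<open>?mem\<close>])
    fix u assume u: "u \<in> carrier P"
    have "?g (\<phi> ` (Q' #>\<^bsub>P\<^esub> u)) = a \<otimes>\<^bsub>A\<^esub> twist \<psi> (\<phi> u) c"
      using u by (simp add: coset_im twist_coset_rep[OF \<psi> Qs c])
    also have "\<dots> = (a \<otimes>\<^bsub>A\<^esub> e (\<phi> (inv\<^bsub>P\<^esub> u))) \<otimes>\<^bsub>A\<^esub> (c \<otimes>\<^bsub>A\<^esub> e (\<psi> (\<phi> u)))"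
      using u ac by (simp add: twist_def m_assoc)
    \<comment> \<open>Invariance of \<open>a\<close> is used at the inverse of \<open>u\<close>, so
      \<open>\<phi>\<close> must stay outside the inverse.\<close>
    also have "a \<otimes>\<^bsub>A\<^esub> e (\<phi> (inv\<^bsub>P\<^esub> u)) = e (inv\<^bsub>P\<^esub> u) \<otimes>\<^bsub>A\<^esub> a"
      using a u by (simp add: fix_iff del: \<phi>.hom_inv)
    finally show "?g (\<phi> ` (Q' #>\<^bsub>P\<^esub> u)) = twist (\<phi> \<otimes>\<^bsub>Aut P\<^esub> \<psi>) u (a \<otimes>\<^bsub>A\<^esub> c)"
      using u ac by (simp add: twist_def m_assoc P.Aut_mult_apply[OF \<phi> \<psi> u])
  qed
  finally show ?tr .
qed

section \<open>The twisted kernels as a graded ideal, checked on generators\<close>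

definition gens where
  "gens \<phi> = (\<Union>Q\<in>proper_subgroups P. tr \<phi> Q ` tfix \<phi> Q)
    \<union> {r \<odot>\<^bsub>A\<^esub> x | r x. r \<in> J \<and> x \<in> tfix \<phi> (carrier P)}"

lemma gens_cases:
  assumes "x \<in> gens \<phi>"
  obtains Q c where "Q \<in> proper_subgroups P" "c \<in> tfix \<phi> Q" "x = tr \<phi> Q c"
  | r y where "r \<in> J" "y \<in> tfix \<phi> (carrier P)" "x = r \<odot>\<^bsub>A\<^esub> y"
  using assms unfolding gens_def by blast

lemma tr_gens: "\<lbrakk>Q \<in> proper_subgroups P; c \<in> tfix \<phi> Q\<rbrakk> \<Longrightarrow> tr \<phi> Q c \<in> gens \<phi>"
  unfolding gens_def by blast

lemma smult_gens: "\<lbrakk>r \<in> J; x \<in> tfix \<phi> (carrier P)\<rbrakk> \<Longrightarrow> r \<odot>\<^bsub>A\<^esub> x \<in> gens \<phi>"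
  unfolding gens_def by blast

lemma gens_fix:
  assumes \<phi>: "\<phi> \<in> carrier (Aut P)"
  shows "gens \<phi> \<subseteq> tfix \<phi> (carrier P)"
proof
  fix x assume "x \<in> gens \<phi>"
  then show "x \<in> tfix \<phi> (carrier P)"
  proof (cases rule: gens_cases)
    case (1 Q c)
    then show ?thesis using tr_fix[OF \<phi>] by (simp add: proper_subgroups_def)
  next
    case (2 r y)
    then show ?thesis using submoduleE(4)[OF fix_submodule] J.a_subset by blast
  qed
qed

lemma fix_carrier: "tfix \<phi> Q \<subseteq> carrier A"
  by (auto simp: fix_iff)

lemma ker_eq:
  assumes \<phi>: "\<phi> \<in> carrier (Aut P)"
  shows "ker \<phi> = generate (add_monoid A) (gens \<phi>)"
proof -
  let ?X = "\<Union>{tr \<phi> Q ` tfix \<phi> Q | Q. Q \<in> proper_subgroups P}"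
  let ?Y = "{r \<odot>\<^bsub>A\<^esub> x | r x. r \<in> J \<and> x \<in> tfix \<phi> (carrier P)}"
  have eq: "?X \<union> ?Y = gens \<phi>" by (auto simp: gens_def)
  have "gens \<phi> \<subseteq> carrier A" using gens_fix[OF \<phi>] fix_carrier by blast
  then have "?X \<subseteq> carrier A" "?Y \<subseteq> carrier A" unfolding eq[symmetric] by blast+
  then show ?thesis
    unfolding twisted_kernel_def sum_subgroups_def ideal_smult_def eq[symmetric]
    by (rule set_add_generate)
qed

lemma gens_carrier: "\<phi> \<in> carrier (Aut P) \<Longrightarrow> gens \<phi> \<subseteq> carrier A"
  using gens_fix fix_carrier by blast

lemma ker_subgroup: "\<phi> \<in> carrier (Aut P) \<Longrightarrow> subgroup (ker \<phi>) (add_monoid A)"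
  using ker_eq gens_carrier add.generate_is_subgroup by simp

lemma gens_ker: "\<phi> \<in> carrier (Aut P) \<Longrightarrow> x \<in> gens \<phi> \<Longrightarrow> x \<in> ker \<phi>"
  by (simp add: ker_eq generate.incl)

text \<open>Generators are asked to go to generators: scalars and products with fixed elements turn
  traces into traces and multiples by \<open>J\<close> into multiples by \<open>J\<close>, possibly
  at another automorphism.\<close>

lemma ker_hom_mem:
  assumes "\<phi> \<in> carrier (Aut P)" "\<psi> \<in> carrier (Aut P)" "h \<in> carrier A \<rightarrow> carrier A"
    and "\<And>x y. \<lbrakk>x \<in> carrier A; y \<in> carrier A\<rbrakk> \<Longrightarrow> h (x \<oplus>\<^bsub>A\<^esub> y) = h x \<oplus>\<^bsub>A\<^esub> h y"
    and gens: "\<And>x. x \<in> gens \<phi> \<Longrightarrow> h x \<in> gens \<psi>" and x: "x \<in> ker \<phi>"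
  shows "h x \<in> ker \<psi>"
  by (rule generate_hom_mem[OF abelian_group_axioms abelian_group_axioms assms(3,4)
        ker_subgroup[OF assms(2)] gens_carrier[OF assms(1)]])
    (use assms gens_ker in \<open>auto simp: ker_eq\<close>)

lemma ker_fix:
  assumes \<phi>: "\<phi> \<in> carrier (Aut P)"
  shows "ker \<phi> \<subseteq> tfix \<phi> (carrier P)"
proof -
  have "subgroup (tfix \<phi> (carrier P)) (add_monoid A)"
    using fix_submodule by (simp add: submodule_def)
  then show ?thesis
    unfolding ker_eq[OF \<phi>] using add.generate_subgroup_incl[OF gens_fix[OF \<phi>]] by simp
qed

lemma ker_submodule:
  assumes \<phi>: "\<phi> \<in> carrier (Aut P)"
  shows "submodule (ker \<phi>) R A"
proof -
  have "r \<odot>\<^bsub>A\<^esub> x \<in> ker \<phi>" if r: "r \<in> carrier R" and x: "x \<in> ker \<phi>" for r x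
  proof (rule ker_hom_mem[OF \<phi> \<phi> _ _ _ x])
    fix y assume "y \<in> gens \<phi>"
    then show "r \<odot>\<^bsub>A\<^esub> y \<in> gens \<phi>"
    proof (cases rule: gens_cases)
      case (1 Q c)
      have c: "c \<in> carrier A" using 1 by (simp add: fix_iff)
      have "r \<odot>\<^bsub>A\<^esub> tr \<phi> Q c = tr \<phi> Q (r \<odot>\<^bsub>A\<^esub> c)"
        using r c tr_hom[of "\<lambda>x. r \<odot>\<^bsub>A\<^esub> x" c \<phi> Q]
        by (simp add: smult_r_distr tr_def' twist_smult)
      moreover have "r \<odot>\<^bsub>A\<^esub> c \<in> tfix \<phi> Q" using submoduleE(4)[OF fix_submodule] r 1 by blast
      ultimately show ?thesis using 1 by (auto simp: gens_def)
    next
      case (2 s z)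
      then have "r \<odot>\<^bsub>A\<^esub> y = (r \<otimes> s) \<odot>\<^bsub>A\<^esub> z" "r \<otimes> s \<in> J"
        using r J.I_l_closed J.a_subset fix_carrier by (auto simp: smult_assoc1 subset_iff)
      then show ?thesis using 2 by (auto simp: gens_def)
    qed
  qed (use r in \<open>auto simp: smult_r_distr\<close>)
  then show ?thesis
    using ker_subgroup[OF \<phi>] by (simp add: submodule_def submodule_axioms_def)
qed

text \<open>A factor on the left replaces the subgroup of a trace by its preimage under
  \<open>\<phi>\<close>; since \<open>gens\<close> collects the traces from all proper subgroups,
  the product is again a generator.\<close>

lemma fix_ker_mult:
  assumes \<phi>: "\<phi> \<in> carrier (Aut P)" and \<psi>: "\<psi> \<in> carrier (Aut P)"
    and a: "a \<in> tfix \<phi> (carrier P)" and x: "x \<in> ker \<psi>"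
  shows "a \<otimes>\<^bsub>A\<^esub> x \<in> ker (\<phi> \<otimes>\<^bsub>Aut P\<^esub> \<psi>)"
proof -
  interpret Aut: group "Aut P" by (rule P.Aut_group)
  have aA: "a \<in> carrier A" using a by (simp add: fix_iff)
  show ?thesis
  proof (rule ker_hom_mem[OF \<psi> Aut.m_closed[OF \<phi> \<psi>] _ _ _ x])
    fix y assume "y \<in> gens \<psi>"
    then show "a \<otimes>\<^bsub>A\<^esub> y \<in> gens (\<phi> \<otimes>\<^bsub>Aut P\<^esub> \<psi>)"
    proof (cases rule: gens_cases)
      case (1 Q c)
      show ?thesis
        unfolding gens_def 1(3) tr_mult_left(2)[OF \<phi> \<psi> 1(1) a 1(2)]
        using preimage_subgroup[OF \<phi> 1(1)] tr_mult_left(1)[OF \<phi> \<psi> 1(1) a 1(2)] by blast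
    next
      case (2 s z)
      have "z \<in> tfix \<psi> (\<phi> ` carrier P)"
        using 2 fix_antimono Aut_image_subset[OF \<phi>] by blast
      then have "a \<otimes>\<^bsub>A\<^esub> z \<in> tfix (\<phi> \<otimes>\<^bsub>Aut P\<^esub> \<psi>) (carrier P)"
        using fix_mult[OF _ \<phi> \<psi> a] by simp
      moreover have "a \<otimes>\<^bsub>A\<^esub> y = s \<odot>\<^bsub>A\<^esub> (a \<otimes>\<^bsub>A\<^esub> z)"
        unfolding 2(3) using 2 aA J.a_subset fix_carrier by (intro smult_mult_right) auto
      ultimately show ?thesis unfolding gens_def using 2(1) by blast
    qed
  qed (use aA in \<open>auto simp: r_distr\<close>)
qed

text \<open>A factor on the right leaves the subgroup \<open>Q\<close> of a trace alone, and the new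
  argument \<open>c b\<close> is fixed because \<open>b\<close> is invariant in particular under
  \<open>\<phi>(Q)\<close>.\<close>

lemma ker_fix_mult:
  assumes \<phi>: "\<phi> \<in> carrier (Aut P)" and \<psi>: "\<psi> \<in> carrier (Aut P)"
    and x: "x \<in> ker \<phi>" and b: "b \<in> tfix \<psi> (carrier P)"
  shows "x \<otimes>\<^bsub>A\<^esub> b \<in> ker (\<phi> \<otimes>\<^bsub>Aut P\<^esub> \<psi>)"
proof -
  interpret Aut: group "Aut P" by (rule P.Aut_group)
  have bA: "b \<in> carrier A" using b by (simp add: fix_iff)
  show ?thesis
  proof (rule ker_hom_mem[OF \<phi> Aut.m_closed[OF \<phi> \<psi>] _ _ _ x])
    fix y assume "y \<in> gens \<phi>"
    then show "y \<otimes>\<^bsub>A\<^esub> b \<in> gens (\<phi> \<otimes>\<^bsub>Aut P\<^esub> \<psi>)"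
    proof (cases rule: gens_cases)
      case (1 Q c)
      have Q: "subgroup Q P" "Q \<subseteq> carrier P" using 1(1) by (auto simp: proper_subgroups_def)
      have "b \<in> tfix \<psi> (\<phi> ` Q)"
        using b fix_antimono Aut_image_subset[OF \<phi> Q(2)] by blast
      then show ?thesis
        unfolding gens_def 1(3) tr_mult_right[OF \<phi> \<psi> Q(1) 1(2) b]
        using 1(1) fix_mult[OF Q(2) \<phi> \<psi> 1(2)] by blast
    next
      case (2 s z)
      have "b \<in> tfix \<psi> (\<phi> ` carrier P)"
        using b fix_antimono Aut_image_subset[OF \<phi>] by blast
      then have "z \<otimes>\<^bsub>A\<^esub> b \<in> tfix (\<phi> \<otimes>\<^bsub>Aut P\<^esub> \<psi>) (carrier P)"
        using fix_mult[OF _ \<phi> \<psi> 2(2)] by simp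
      moreover have "y \<otimes>\<^bsub>A\<^esub> b = s \<odot>\<^bsub>A\<^esub> (z \<otimes>\<^bsub>A\<^esub> b)"
        unfolding 2(3) using 2 bA J.a_subset fix_carrier by (intro smult_mult_left) auto
      ultimately show ?thesis unfolding gens_def using 2(1) by blast
    qed
  qed (use bA in \<open>auto simp: l_distr\<close>)
qed

lemma one_fix: "\<one>\<^bsub>A\<^esub> \<in> tfix \<one>\<^bsub>Aut P\<^esub> (carrier P)"
  by (simp add: fix_iff P.Aut_one_apply)

sublocale graded_subquotient R A "Aut P" J "\<lambda>\<phi>. tfix \<phi> (carrier P)" ker
proof (intro graded_subquotient.intro graded_subquotient_axioms.intro group_convolution.intro
    group_convolution_axioms.intro assoc_algebra_axioms P.Aut_group P.finite_Aut finite_P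
    J.ideal_axioms fix_submodule ker_submodule ker_fix one_fix)
  fix \<phi> \<psi> x y assume \<phi>: "\<phi> \<in> carrier (Aut P)" "\<psi> \<in> carrier (Aut P)"
    and x: "x \<in> tfix \<phi> (carrier P)" and y: "y \<in> tfix \<psi> (carrier P)"
  have "y \<in> tfix \<psi> (\<phi> ` carrier P)"
    using y fix_antimono Aut_image_subset[OF \<phi>(1)] by blast
  then show "x \<otimes>\<^bsub>A\<^esub> y \<in> tfix (\<phi> \<otimes>\<^bsub>Aut P\<^esub> \<psi>) (carrier P)"
    using fix_mult[OF _ \<phi> x] by simp
next
  fix \<phi> r x assume "\<phi> \<in> carrier (Aut P)" "r \<in> J" "x \<in> tfix \<phi> (carrier P)"
  then show "r \<odot>\<^bsub>A\<^esub> x \<in> ker \<phi>" by (intro gens_ker) (auto simp: gens_def)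
qed (assumption | erule (3) fix_ker_mult | erule (3) ker_fix_mult)+

end


section \<open>The Brauer kernel of the convolution algebra\<close>

context finite_interior_algebra
begin

abbreviation "act \<equiv> tilde_act R P A \<sigma>"

lemma act_apply: "\<phi> \<in> carrier (Aut P) \<Longrightarrow> act u f \<phi> = twist \<phi> u (f \<phi>)"
  by (simp add: tilde_act_def twist_def lact_def ract_def)

lemma act_closed: "f \<in> carrier C \<Longrightarrow> act u f \<in> carrier C"
  by (auto simp: conv_carrier act_apply twist_closed) (simp add: tilde_act_def)

lemma fixed_points_eq:
  assumes Q: "Q \<subseteq> carrier P"
  shows "fixed_points C act Q = (\<Pi>\<^sub>E \<phi>\<in>carrier (Aut P). tfix \<phi> Q)"
proof (intro equalityI subsetI)
  fix f assume f: "f \<in> fixed_points C act Q"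
  then have fC: "f \<in> carrier C" by (simp add: fixed_points_def)
  have inv: "act u f = f" if "u \<in> Q" for u
    using f that by (simp add: fixed_points_def)
  show "f \<in> (\<Pi>\<^sub>E \<phi>\<in>carrier (Aut P). tfix \<phi> Q)"
    unfolding PiE_mem_iff fix_iff_twist[OF Q]
  proof (intro conjI ballI)
    show "f \<in> extensional (carrier (Aut P))" using fC by (simp add: conv_carrier)
    fix \<phi> assume \<phi>: "\<phi> \<in> carrier (Aut P)"
    show "f \<phi> \<in> carrier A" by (rule conv_closed[OF fC \<phi>])
    show "twist \<phi> u (f \<phi>) = f \<phi>" if "u \<in> Q" for u
      using act_apply[OF \<phi>, of u f] inv[OF that] by simp
  qed
next
  fix f assume "f \<in> (\<Pi>\<^sub>E \<phi>\<in>carrier (Aut P). tfix \<phi> Q)"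
  then have f: "f \<in> extensional (carrier (Aut P))"
      "\<And>\<phi>. \<phi> \<in> carrier (Aut P) \<Longrightarrow> f \<phi> \<in> carrier A"
      "\<And>\<phi> u. \<lbrakk>\<phi> \<in> carrier (Aut P); u \<in> Q\<rbrakk> \<Longrightarrow> twist \<phi> u (f \<phi>) = f \<phi>"
    unfolding PiE_mem_iff fix_iff_twist[OF Q] by blast+
  have fC: "f \<in> carrier C" using f(1,2) by (simp add: conv_carrier)
  have "act u f = f" if "u \<in> Q" for u
    by (rule conv_eqI[OF act_closed[OF fC] fC]) (simp add: act_apply f(3) that)
  then show "f \<in> fixed_points C act Q" using fC by (simp add: fixed_points_def)
qed

lemma rel_trace_closed: "c \<in> carrier C \<Longrightarrow> rel_trace P C act Q c \<in> carrier C"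
  unfolding rel_trace_def
  by (rule abelian_monoid.finsum_closed[OF abelian_group.axioms(1)[OF conv_abelian_group]])
    (simp add: act_closed)

text \<open>Both traces run over the same cosets with the same representatives, and evaluation at
  \<open>\<phi>\<close> is additive.\<close>

lemma rel_trace_apply:
  assumes c: "c \<in> carrier C" and \<phi>: "\<phi> \<in> carrier (Aut P)"
  shows "rel_trace P C act Q c \<phi> = tr \<phi> Q (c \<phi>)"
proof -
  have "rel_trace P C act Q c \<phi> = (\<Oplus>\<^bsub>A\<^esub>X\<in>rcosets\<^bsub>P\<^esub> Q. act (coset_rep X) c \<phi>)"
    unfolding rel_trace_def
  proof (rule finsum_hom[of C A "\<lambda>f. f \<phi>"])
    show "abelian_monoid C" by (rule abelian_group.axioms(1)[OF conv_abelian_group])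
    show "\<zero>\<^bsub>C\<^esub> \<phi> = \<zero>\<^bsub>A\<^esub>" using \<phi> by (simp add: conv_algebra_simps(4))
  qed (use c \<phi> conv_closed in \<open>auto simp: conv_add act_closed intro: abelian_monoid_axioms\<close>)
  then show ?thesis by (simp add: act_apply[OF \<phi>] tr_def')
qed

definition tilde_gens where
  "tilde_gens = (\<Union>Q\<in>proper_subgroups P. rel_trace P C act Q ` fixed_points C act Q)
    \<union> {r \<odot>\<^bsub>C\<^esub> f | r f. r \<in> J \<and> f \<in> fixed_points C act (carrier P)}"

lemma tilde_gens_cases:
  assumes "f \<in> tilde_gens"
  obtains Q c where "Q \<in> proper_subgroups P" "c \<in> fixed_points C act Q" "f = rel_trace P C act Q c"
  | r c where "r \<in> J" "c \<in> fixed_points C act (carrier P)" "f = r \<odot>\<^bsub>C\<^esub> c"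
  using assms unfolding tilde_gens_def by blast

lemma rel_trace_tilde_gens:
  "\<lbrakk>Q \<in> proper_subgroups P; c \<in> fixed_points C act Q\<rbrakk> \<Longrightarrow> rel_trace P C act Q c \<in> tilde_gens"
  unfolding tilde_gens_def by blast

lemma smult_tilde_gens:
  "\<lbrakk>r \<in> J; f \<in> fixed_points C act (carrier P)\<rbrakk> \<Longrightarrow> r \<odot>\<^bsub>C\<^esub> f \<in> tilde_gens"
  unfolding tilde_gens_def by blast

lemma fixed_points_carrier: "fixed_points C act Q \<subseteq> carrier C"
  by (auto simp: fixed_points_def)

lemma tilde_gens_carrier: "tilde_gens \<subseteq> carrier C"
proof
  fix f assume "f \<in> tilde_gens"
  then show "f \<in> carrier C"
  proof (cases rule: tilde_gens_cases)
    case (1 Q c)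
    then show ?thesis using rel_trace_closed fixed_points_carrier by blast
  next
    case (2 r c)
    then show ?thesis using conv_smult_closed J.a_subset fixed_points_carrier by blast
  qed
qed

lemma brauer_kernel_eq_generate: "brauer_kernel J P C act = generate (add_monoid C) tilde_gens"
proof -
  let ?X = "\<Union>{rel_trace P C act Q ` fixed_points C act Q | Q. Q \<in> proper_subgroups P}"
  let ?Y = "{r \<odot>\<^bsub>C\<^esub> f | r f. r \<in> J \<and> f \<in> fixed_points C act (carrier P)}"
  have eq: "?X \<union> ?Y = tilde_gens" by (auto simp: tilde_gens_def)
  have "?X \<subseteq> carrier C" "?Y \<subseteq> carrier C"
    using tilde_gens_carrier unfolding eq[symmetric] by blast+
  then show ?thesis
    unfolding brauer_kernel_def sum_subgroups_def ideal_smult_def eq[symmetric]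
    by (rule abelian_group.set_add_generate[OF conv_abelian_group])
qed

text \<open>The element \<open>x \<otimes> \<phi>\<close> of the tilde algebra.\<close>

definition single where
  "single \<phi> x = (\<lambda>\<psi>\<in>carrier (Aut P). if \<psi> = \<phi> then x else \<zero>\<^bsub>A\<^esub>)"

lemma single_closed: "x \<in> carrier A \<Longrightarrow> single \<phi> x \<in> carrier C"
  by (auto simp: conv_carrier single_def)

lemma single_fixed:
  assumes Q: "Q \<subseteq> carrier P" and x: "x \<in> tfix \<phi> Q"
  shows "single \<phi> x \<in> fixed_points C act Q"
  unfolding fixed_points_eq[OF Q] single_def restrict_PiE_iff
  using x submodule_zero[OF fix_submodule] by simp

lemma tr_zero: "tr \<phi> Q \<zero>\<^bsub>A\<^esub> = \<zero>\<^bsub>A\<^esub>"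
  by (simp add: tr_def' twist_zero)

text \<open>A generator at one automorphism extends by zero to a generator of the whole kernel: zero
  is fixed by every subgroup and has trace zero, so the same \<open>Q\<close> serves for all the
  other components.\<close>

lemma single_gens:
  assumes \<phi>: "\<phi> \<in> carrier (Aut P)" and x: "x \<in> gens \<phi>"
  shows "single \<phi> x \<in> tilde_gens"
  using x
proof (cases rule: gens_cases)
  case (1 Q c)
  have QP: "Q \<subseteq> carrier P" using 1(1) by (auto simp: proper_subgroups_def)
  have cC: "single \<phi> c \<in> carrier C" using 1(2) fix_carrier by (intro single_closed) auto
  have "rel_trace P C act Q (single \<phi> c) = single \<phi> x"
  proof (rule conv_eqI[OF rel_trace_closed[OF cC]])
    show "single \<phi> x \<in> carrier C" using gens_carrier[OF \<phi>] x by (intro single_closed) auto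
    show "rel_trace P C act Q (single \<phi> c) \<psi> = single \<phi> x \<psi>" if "\<psi> \<in> carrier (Aut P)" for \<psi>
      unfolding rel_trace_apply[OF cC that] using that by (simp add: single_def tr_zero 1(3))
  qed
  with rel_trace_tilde_gens[OF 1(1) single_fixed[OF QP 1(2)]] show ?thesis by simp
next
  case (2 r y)
  have r: "r \<in> carrier R" using 2(1) J.a_subset by blast
  have "r \<odot>\<^bsub>C\<^esub> single \<phi> y = single \<phi> x"
    unfolding conv_algebra_simps(6) single_def 2(3) using r by (intro restrict_ext) simp
  with smult_tilde_gens[OF 2(1) single_fixed[OF order_refl 2(2)]] show ?thesis by simp
qed

text \<open>Evaluation at an automorphism sends generators to generators, which gives one inclusion.
  For the other, the components of a family may involve unrelated subgroups, so they are treated one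
  at a time and then added.\<close>

lemma brauer_kernel_eq: "brauer_kernel J P C act = K"
proof (intro equalityI subsetI)
  interpret C: abelian_group C by (rule conv_abelian_group)
  fix f assume "f \<in> brauer_kernel J P C act"
  then have f: "f \<in> generate (add_monoid C) tilde_gens" by (simp add: brauer_kernel_eq_generate)
  have fC: "f \<in> carrier C" using C.add.generate_in_carrier[OF _ f] tilde_gens_carrier by simp
  show "f \<in> K"
    unfolding K_mem
  proof (intro conjI ballI)
    show "f \<in> extensional (carrier (Aut P))" using fC by (simp add: conv_carrier)
    fix \<phi> assume \<phi>: "\<phi> \<in> carrier (Aut P)"
    show "f \<phi> \<in> ker \<phi>"
    proof (rule generate_hom_mem[OF conv_abelian_group abelian_group_axioms _ _
          ker_subgroup[OF \<phi>] tilde_gens_carrier _ f, of "\<lambda>f. f \<phi>"])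
      fix f assume "f \<in> tilde_gens"
      then have "f \<phi> \<in> gens \<phi>"
      proof (cases rule: tilde_gens_cases)
        case (1 Q c)
        have QP: "Q \<subseteq> carrier P" using 1(1) by (auto simp: proper_subgroups_def)
        have "c \<in> carrier C" using 1(2) fixed_points_carrier by blast
        then have "f \<phi> = tr \<phi> Q (c \<phi>)" by (simp add: 1(3) rel_trace_apply \<phi>)
        moreover have "c \<phi> \<in> tfix \<phi> Q"
          using 1(2) \<phi> unfolding fixed_points_eq[OF QP] by (rule PiE_mem)
        ultimately show ?thesis using tr_gens[OF 1(1)] by simp
      next
        case (2 r c)
        have "c \<phi> \<in> tfix \<phi> (carrier P)"
          using 2(2) \<phi> unfolding fixed_points_eq[OF order_refl] by (rule PiE_mem)
        moreover have "f \<phi> = r \<odot>\<^bsub>A\<^esub> c \<phi>" using \<phi> by (simp add: 2(3) conv_smult)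
        ultimately show ?thesis using smult_gens[OF 2(1)] by simp
      qed
      then show "f \<phi> \<in> ker \<phi>" by (rule gens_ker[OF \<phi>])
    qed (use \<phi> conv_closed in \<open>auto simp: conv_add\<close>)
  qed
next
  interpret C: abelian_group C by (rule conv_abelian_group)
  let ?H = "generate (add_monoid C) tilde_gens"
  have H: "subgroup ?H (add_monoid C)" by (rule C.add.generate_is_subgroup[OF tilde_gens_carrier])
  then interpret H: additive_subgroup ?H C by (rule additive_subgroup.intro)
  fix f assume f: "f \<in> K"
  have fk: "f \<phi> \<in> ker \<phi>" if "\<phi> \<in> carrier (Aut P)" for \<phi> using f that by (rule PiE_mem)
  have fC: "f \<in> carrier C" using f K_S S_carrier by blast
  \<comment> \<open>For fixed \<open>\<phi>\<close> the embedding of \<open>A\<close> as the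
    component at \<open>\<phi>\<close> is additive and sends generators to generators, hence kernel
    elements into \<open>?H\<close>.\<close>
  have single: "single \<phi> (f \<phi>) \<in> ?H" if \<phi>: "\<phi> \<in> carrier (Aut P)" for \<phi>
  proof (rule generate_hom_mem[OF abelian_group_axioms conv_abelian_group _ _ H gens_carrier[OF \<phi>]])
    show "f \<phi> \<in> generate (add_monoid A) (gens \<phi>)" using fk[OF \<phi>] by (simp add: ker_eq[OF \<phi>])
    show "single \<phi> (x \<oplus>\<^bsub>A\<^esub> y) = single \<phi> x \<oplus>\<^bsub>C\<^esub> single \<phi> y" for x y
      unfolding conv_algebra_simps(5) single_def by (intro restrict_ext) simp
    show "single \<phi> x \<in> ?H" if "x \<in> gens \<phi>" for x
      by (rule generate.incl[OF single_gens[OF \<phi> that]])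
  qed (simp add: single_closed)
  \<comment> \<open>There are finitely many automorphisms, so the components add up to
    \<open>f\<close> inside the generated subgroup.\<close>
  have "f = (\<Oplus>\<^bsub>C\<^esub>\<phi>\<in>carrier (Aut P). single \<phi> (f \<phi>))"
  proof (rule conv_eqI[OF fC])
    have sC: "single \<phi> (f \<phi>) \<in> carrier C" if "\<phi> \<in> carrier (Aut P)" for \<phi>
      using single[OF that] H.a_subset by blast
    then show "(\<Oplus>\<^bsub>C\<^esub>\<phi>\<in>carrier (Aut P). single \<phi> (f \<phi>)) \<in> carrier C" by (intro C.finsum_closed) simp
    fix \<psi> assume \<psi>: "\<psi> \<in> carrier (Aut P)"
    have "(\<Oplus>\<^bsub>C\<^esub>\<phi>\<in>carrier (Aut P). single \<phi> (f \<phi>)) \<psi> = (\<Oplus>\<^bsub>A\<^esub>\<phi>\<in>carrier (Aut P). single \<phi> (f \<phi>) \<psi>)"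
      by (rule finsum_hom[of C A "\<lambda>f. f \<psi>"])
        (use \<psi> sC conv_closed in \<open>auto simp: conv_add conv_algebra_simps(4) intro: abelian_monoid_axioms C.abelian_monoid_axioms\<close>)
    also have "\<dots> = single \<psi> (f \<psi>) \<psi>"
      using \<psi> finite_group conv_closed[OF fC \<psi>] by (intro finsum_single) (auto simp: single_def)
    finally show "f \<psi> = (\<Oplus>\<^bsub>C\<^esub>\<phi>\<in>carrier (Aut P). single \<phi> (f \<phi>)) \<psi>"
      using \<psi> by (simp add: single_def)
  qed
  also have "\<dots> \<in> ?H"
    by (rule C.finsum_mem) (use single H.a_subset in auto)
  finally show "f \<in> brauer_kernel J P C act" by (simp add: brauer_kernel_eq_generate)
qed

section \<open>Identification of the two Brauer quotients and their components with the general
  construction\<close>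

lemma tilde_brauer_eq: "tilde_brauer R J P A \<sigma> = B"
  unfolding tilde_brauer_def brauer_quotient_def tilde_algebra_eq_conv_algebra brauer_kernel_eq
    fixed_points_eq[OF order_refl] ..

lemma tilde_brauer_comp_eq: "tilde_brauer_comp R J P A \<sigma> = B_comp"
proof
  fix \<phi>
  have "S \<inter> tilde_comp P A \<phi> = {f \<in> S. \<forall>\<psi>\<in>carrier (Aut P). \<psi> \<noteq> \<phi> \<longrightarrow> f \<psi> = \<zero>\<^bsub>A\<^esub>}"
    unfolding tilde_comp_def tilde_algebra_eq_conv_algebra using S_carrier by blast
  then show "tilde_brauer_comp R J P A \<sigma> \<phi> = B_comp \<phi>"
    unfolding tilde_brauer_comp_def brauer_comp_def tilde_algebra_eq_conv_algebra brauer_kernel_eq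
      fixed_points_eq[OF order_refl] B_comp_def by simp
qed

lemma twisted_brauer_eq: "twisted_brauer R J P A \<sigma> = (\<lambda>\<phi>. D \<phi>)"
  by (rule ext) (simp add: twisted_brauer_def)

lemma extended_brauer_quotient_eq: "extended_brauer_quotient R J P A \<sigma> (carrier (Aut P)) = E"
  unfolding extended_brauer_quotient_def quotient_sum_def Let_def twisted_brauer_eq ..

lemma extended_brauer_comp_eq: "extended_brauer_comp R J P A \<sigma> (carrier (Aut P)) = E_comp"
  by (rule ext)
    (simp only: extended_brauer_comp_def E_comp_def extended_brauer_quotient_eq twisted_brauer_eq)

end

theorem theorem3p2:
  fixes \<O> :: "('r, 'm) ring_scheme"
    and J :: "'r set"
    and p :: nat
    and P :: "('g, 'n) monoid_scheme"
    and A :: "('r, 'a, 'l) module_scheme"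
    and \<sigma> :: "('g \<Rightarrow> 'r) \<Rightarrow> 'a"
  assumes "complete_dvr \<O> J"
    and "p > 0" and "has_characteristic (\<O> Quot J) p"
    and "p_group p P"
    and "interior_algebra \<O> P A \<sigma>"
  shows "graded_algebra (\<O> Quot J) (Aut P)
           (tilde_brauer \<O> J P A \<sigma>) (tilde_brauer_comp \<O> J P A \<sigma>)
       \<and> graded_algebra (\<O> Quot J) (Aut P)
           (extended_brauer_quotient \<O> J P A \<sigma> (carrier (Aut P)))
           (extended_brauer_comp \<O> J P A \<sigma> (carrier (Aut P)))
       \<and> (\<exists>h. h \<in> graded_alg_iso (\<O> Quot J) (Aut P)
           (tilde_brauer \<O> J P A \<sigma>) (tilde_brauer_comp \<O> J P A \<sigma>)
           (extended_brauer_quotient \<O> J P A \<sigma> (carrier (Aut P)))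
           (extended_brauer_comp \<O> J P A \<sigma> (carrier (Aut P))))"
proof -
  interpret A: interior_algebra \<O> P A \<sigma> by fact
  have "ideal J \<O>"
    using complete_dvr.maximal_J[OF assms(1)] by (rule maximalideal.axioms(1))
  moreover have "finite (carrier P)" using assms(4) by (simp add: p_group_def)
  ultimately interpret finite_interior_algebra \<O> A P J \<sigma>
    by (intro finite_interior_algebra.intro finite_interior_algebra_axioms.intro
        A.assoc_algebra_axioms A.group_axioms A.structure_map)
  \<comment> \<open>The identifications are equalities of records and of families of sets, so
    rewriting suffices and the isomorphism is \<open>comp_map\<close> itself.\<close>
  show ?thesis
    unfolding tilde_brauer_eq tilde_brauer_comp_eq extended_brauer_quotient_eq
      extended_brauer_comp_eq
    using graded_iso by blast
qed

end
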